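(* Let $S$ be a (local) section of $\pi$. Then $S$ can be transformed locally to the zero section $\mathbf 0$ of $\pi$ by a point transformation (i.e. every point of the domain of $S$ has a neighborhood $U$ and a point transformation $f$ defined on $U$ with $f^{(0)}\circ S\circ f^{-1}=\mathbf 0$ on $f(U)$) if and only if $\omega^{(2)}_S\equiv0$, where $\omega^{(2)}_S=(j_2S)^*(\omega^{(2)})$.
   Context: All manifolds and maps are smooth. $[h]^k_p$ denotes the $k$-jet of $h$ at $p$. **Bundle and lifts.** $\pi:E=\mathbb{R}^2\times\mathbb{R}^4\to\mathbb{R}^2$ is the product bundle, with base coordinates $(x^1,x^2)=(x,y)$ and fibre coordinates $u^0,u^1,u^2,u^3$. An ODE $y''=u^0(x,y)+u^1(x,y)y'+u^2(x,y)(y')^2+u^3(x,y)(y')^3$ is identified with the section $(x^1,x^2)\mapsto(x^1,x^2,u^0,\dots,u^3)$ of $\pi$; $\mathbf 0$ is the zero section. A point transformation is a diffeomorphism $f$ between open subsets of the base $\mathbb{R}^2$; $\Gamma$ is the pseudogroup of all of them. A point transformation $f$ takes each such ODE to an ODE of the same form, and this defines the lift $f^{(0)}$ of $f$ to $\pi$: with $g=(g^1,g^2)=f^{-1}$, $f^{(0)}$ sends $(p,u^0,\dots,u^3)$ to $(f(p),\tilde u^0,\dots,\tilde u^3)$, where $\tilde u^\alpha$ is the coefficient of $q^\alpha$ in the polynomial $J^{-1}\bigl(u^0a^3+u^1a^2b+u^2ab^2+u^3b^3-aB+bA\bigr)$, with $a=g^1_1+g^1_2q$, $b=g^2_1+g^2_2q$,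 $A=g^1_{11}+2g^1_{12}q+g^1_{22}q^2$, $B=g^2_{11}+2g^2_{12}q+g^2_{22}q^2$, $J=g^1_1g^2_2-g^1_2g^2_1$ (lower indices are partial derivatives of $g^i$ at $f(p)$). $f$ transforms a section $S$ to $f^{(0)}\circ S\circ f^{-1}$. $J^k\pi$ is the bundle of $k$-jets of sections of $\pi$, $\pi_k:J^k\pi\to\mathbb{R}^2$ and $\pi_{k,r}:J^k\pi\to J^r\pi$ are the projections, and $j_kS:q\mapsto[S]^k_q$. The lift $f^{(k)}$ to $J^k\pi$ is $f^{(k)}([S]^k_p)=[f^{(0)}\circ S\circ f^{-1}]^k_{f(p)}$. A vector field $X$ on the base with flow $f_t$ has lift $X^{(k)}$, the vector field on $J^k\pi$ with flow $f_t^{(k)}$; $X^{(k)}_{\theta_k}$ depends only on $[X]^{k+2}_p$. **Formal vector fields.** $W_p$ is the Lie algebra of $\infty$-jets at $p$ of vector fields on the base, $L^k_p=\{[X]^\infty_p: [X]^k_p=0\}$ for $k\ge0$, $V_p=W_p/L^0_p\cong T_p\mathbb{R}^2$. $W_p/L^k_p$ is identified with $k$-jets $[X]^k_p$. For $i>j\ge 0$, $\rho_{i,j}:W_p/L^i_p\to W_p/L^j_p$, $[X]^i_p\mapsto[X]^j_p$, and $\rho_i=\rho_{i,0}$. The bracket induces $[\cdot,\cdot]:W_p/L^k_p\times W_p/L^k_p\to W_p/L^{k-1}_p$. A 2-dimensional subspace $H\subset W_p/L^k_p$ is horizontal if $\rho_k(H)=V_p$. **The space $g$.** $g=g_p\subset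 L^1_p/L^2_p$ is the 2-dimensional space of 2-jets (with zero 1-jet) whose second derivatives $X^i_{jk}$ at $p$ satisfy $X^2_{11}=0$, $X^1_{11}-2X^2_{12}=0$, $2X^1_{12}-X^2_{22}=0$, $X^1_{22}=0$. **Isotropy spaces.** For $\theta_{k+1}=[S]^{k+1}_p$ and $\theta_k=\pi_{k+1,k}(\theta_{k+1})$, $\mathcal H_{\theta_{k+1}}\subset T_{\theta_k}J^k\pi$ is the tangent space at $\theta_k$ to the image of $j_kS$. Put $\mathcal A_{\theta_{k+1}}=\{[X]^{2+k}_p\in W_p/L^{2+k}_p : X^{(k)}_{\theta_k}\in\mathcal H_{\theta_{k+1}}\}$. If $[X]^{k+2}_p,[Y]^{k+2}_p\in\mathcal A_{\theta_{k+1}}$ ($k\ge1$), their bracket lies in $\mathcal A_{\theta_k}$. **The form $\omega^{(2)}$.** Let $H_p\subset W_p/L^1_p$ be the horizontal subspace of 1-jets of constant vector fields. Let $\theta_2\in J^2\pi$, $p=\pi_2(\theta_2)$, $\theta_1=\pi_{2,1}(\theta_2)$. There is a unique horizontal subspace $H_{\theta_1}\subset\mathcal A_{\theta_1}$ with $\rho_{2,1}(H_{\theta_1})=H_p$ and $[(\rho_2|_{H_{\theta_1}})^{-1}(v),(\rho_2|_{H_{\theta_1}})^{-1}(w)]=0$ in $W_p/L^1_p$ for all $v,w\in V_p$. There is a unique horizontal subspace $H_{\theta_2}\subset\mathcal A_{\theta_2}$ with $\rho_{3,2}(H_{\theta_2})=H_{\theta_1}$. Define $\omega_{\theta_2}(v,w)=[(\rho_3|_{H_{\theta_2}})^{-1}(v),(\rho_3|_{H_{\theta_2}})^{-1}(w)]\in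 W_p/L^2_p$; it takes values in $g_p$, so $\omega_{\theta_2}\in g_p\otimes\wedge^2V_p^*$. The horizontal $g$-valued 2-form $\omega^{(2)}$ on $J^2\pi$ is $\omega^{(2)}|_{\theta_2}=\pi_2^*(\omega_{\theta_2})$. Thus $\omega^{(2)}_S=(j_2S)^*(\omega^{(2)})$ is the form on the domain of $S$ whose value at $p$ is $\omega_{[S]^2_p}$. *)

theory Defs
  imports
    "HOL-Analysis.Analysis"
    "HOL-Library.Function_Algebras"
    "HOL-Computational_Algebra.Polynomial"
begin

fun C_on :: "nat \<Rightarrow> 'a::real_normed_vector set \<Rightarrow> ('a \<Rightarrow> 'b::real_normed_vector) \<Rightarrow> bool" where
  "C_on 0 D h \<longleftrightarrow> continuous_on D h"
| "C_on (Suc k) D h \<longleftrightarrow>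
     h differentiable_on D \<and> (\<forall>v. C_on k D (\<lambda>x. frechet_derivative h (at x) v))"

text \<open>Maps are total functions; only their values on the open set \<open>D\<close> matter.\<close>

definition smooth_on :: "'a::real_normed_vector set \<Rightarrow> ('a \<Rightarrow> 'b::real_normed_vector) \<Rightarrow> bool" where
  "smooth_on D h \<longleftrightarrow> open D \<and> (\<forall>k. C_on k D h)"

type_synonym base = "real^2"

definition partial :: "2 \<Rightarrow> (base \<Rightarrow> 'b::real_normed_vector) \<Rightarrow> base \<Rightarrow> 'b" where
  "partial i h = (\<lambda>p. frechet_derivative h (at p) (axis i 1))"

definition mderiv :: "nat \<times> nat \<Rightarrow> (base \<Rightarrow> 'b::real_normed_vector) \<Rightarrow> base \<Rightarrow> 'b" where
  "mderiv I h = (partial 1 ^^ fst I) ((partial 2 ^^ snd I) h)"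

text \<open>A \<open>k\<close>-jet at a given point \<open>p\<close> of a map from the base to a vector space is encoded by its
  coordinates: the family of partial derivatives at \<open>p\<close> indexed by the multi-indices of order at
  most \<open>k\<close>, extended by \<open>0\<close> to all multi-indices.\<close>

type_synonym 'b coeffs = "nat \<times> nat \<Rightarrow> 'b"

definition mjet :: "nat \<Rightarrow> (base \<Rightarrow> 'b::real_normed_vector) \<Rightarrow> base \<Rightarrow> 'b coeffs" where
  "mjet k h p = (\<lambda>I. if fst I + snd I \<le> k then mderiv I h p else 0)"

definition trunc :: "nat \<Rightarrow> ('b::zero) coeffs \<Rightarrow> 'b coeffs" where
  "trunc r a = (\<lambda>I. if fst I + snd I \<le> r then a I else 0)"

text \<open>Constructions using \<open>jet_rep\<close> do not depend on the chosen representative of the jet.\<close>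

definition jet_rep :: "nat \<Rightarrow> base \<Rightarrow> ('b::real_normed_vector) coeffs \<Rightarrow> base \<Rightarrow> 'b" where
  "jet_rep k p a = (SOME h. \<exists>D. p \<in> D \<and> smooth_on D h \<and> mjet k h p = a)"

text \<open>The pointwise vector space structure, so that \<open>subspace\<close> and \<open>dim\<close> apply to sets of jets.\<close>

instantiation "fun" :: (type, real_vector) real_vector
begin

definition scaleR_fun_def: "scaleR c f = (\<lambda>x. c *\<^sub>R f x)"

instance
  by standard (simp_all add: scaleR_fun_def plus_fun_def fun_eq_iff scaleR_add_right scaleR_add_left)

end

text \<open>The fibre coordinates \<open>u\<^sup>0, u\<^sup>1, u\<^sup>2, u\<^sup>3\<close> are \<open>u $ 0, u $ 1, u $ 2, u $ 3\<close>
  (the four elements of the index type \<open>4\<close>); the base coordinates are \<open>x $ 1\<close> and \<open>x $ 2\<close>.\<close>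

type_synonym fibre = "real^4"
type_synonym total = "base \<times> fibre"

definition local_section :: "base set \<Rightarrow> (base \<Rightarrow> total) \<Rightarrow> bool" where
  "local_section D S \<longleftrightarrow> smooth_on D S \<and> (\<forall>p\<in>D. fst (S p) = p)"

definition zero_section :: "base \<Rightarrow> total" where
  "zero_section p = (p, 0)"

text \<open>A point of \<open>J\<^sup>k\<pi>\<close> is a base point together with the jet coordinates of the fibre part
  of a section; tangent vectors to \<open>J\<^sup>k\<pi>\<close> are written in the same coordinates.\<close>

type_synonym jet = "base \<times> fibre coeffs"

definition jet :: "nat \<Rightarrow> (base \<Rightarrow> total) \<Rightarrow> base \<Rightarrow> jet" where
  "jet k S p = (p, mjet k (\<lambda>q. snd (S q)) p)"

definition jet_proj :: "nat \<Rightarrow> jet \<Rightarrow> jet" where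
  "jet_proj r \<theta> = (fst \<theta>, trunc r (snd \<theta>))"

text \<open>Velocity at time \<open>0\<close> of a curve in a jet bundle, coordinatewise.\<close>

definition has_velocity :: "(real \<Rightarrow> jet) \<Rightarrow> jet \<Rightarrow> bool" where
  "has_velocity c w \<longleftrightarrow>
     ((\<lambda>t. fst (c t)) has_vector_derivative fst w) (at 0) \<and>
     (\<forall>I. ((\<lambda>t. snd (c t) I) has_vector_derivative snd w I) (at 0))"

text \<open>The differential at \<open>p\<close> of the map \<open>j\<^sub>kS\<close>, coordinatewise.\<close>

definition jet_differential :: "nat \<Rightarrow> (base \<Rightarrow> total) \<Rightarrow> base \<Rightarrow> base \<Rightarrow> jet" where
  "jet_differential k S p v =
     (frechet_derivative (\<lambda>q. fst (jet k S q)) (at p) v,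
      \<lambda>I. frechet_derivative (\<lambda>q. snd (jet k S q) I) (at p) v)"

text \<open>\<open>contact_plane k \<theta>\<close> is the space \<open>\<H>\<^sub>\<theta>\<close> for \<open>\<theta>\<close> in \<open>J\<^sup>k\<^sup>+\<^sup>1\<pi>\<close>.\<close>

definition contact_plane :: "nat \<Rightarrow> jet \<Rightarrow> jet set" where
  "contact_plane k \<theta> =
     {jet_differential k S (fst \<theta>) v | D S v.
        local_section D S \<and> fst \<theta> \<in> D \<and> jet (k + 1) S (fst \<theta>) = \<theta>}"

definition point_transformation :: "base set \<Rightarrow> (base \<Rightarrow> base) \<Rightarrow> bool" where
  "point_transformation U f \<longleftrightarrow>
     smooth_on U f \<and> inj_on f U \<and> smooth_on (f ` U) (inv_into U f)"

definition lift0 :: "base set \<Rightarrow> (base \<Rightarrow> base) \<Rightarrow> total \<Rightarrow> total" where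
  "lift0 U f e =
    (let u = snd e;
         y = f (fst e);
         g = inv_into U f;
         d = (\<lambda>i j m. mderiv (i, j) g y $ m);
         a = [:d 1 0 1, d 0 1 1:];
         b = [:d 1 0 2, d 0 1 2:];
         A = [:d 2 0 1, 2 * d 1 1 1, d 0 2 1:];
         B = [:d 2 0 2, 2 * d 1 1 2, d 0 2 2:];
         J = d 1 0 1 * d 0 1 2 - d 0 1 1 * d 1 0 2;
         P = smult (inverse J)
               (smult (u $ 0) (a ^ 3) + smult (u $ 1) (a ^ 2 * b) + smult (u $ 2) (a * b ^ 2)
                + smult (u $ 3) (b ^ 3) - a * B + b * A)
     in (y, \<chi> \<alpha>. coeff P (if \<alpha> = 0 then 0 else if \<alpha> = 1 then 1 else if \<alpha> = 2 then 2 else 3)))"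

text \<open>For a section \<open>S\<close> over \<open>D\<close>, this is the transformed section over \<open>f ` (U \<inter> D)\<close>.\<close>

definition transform :: "base set \<Rightarrow> (base \<Rightarrow> base) \<Rightarrow> (base \<Rightarrow> total) \<Rightarrow> base \<Rightarrow> total" where
  "transform U f S = lift0 U f \<circ> S \<circ> inv_into U f"

definition lift :: "nat \<Rightarrow> base set \<Rightarrow> (base \<Rightarrow> base) \<Rightarrow> jet \<Rightarrow> jet" where
  "lift k U f \<theta> =
    (let S = (SOME S. \<exists>D. local_section D S \<and> fst \<theta> \<in> D \<and> jet k S (fst \<theta>) = \<theta>)
     in jet k (transform U f S) (f (fst \<theta>)))"

text \<open>\<open>\<phi>\<close> is the flow, for times \<open>\<bar>t\<bar> < \<epsilon>\<close> and starting in \<open>U\<close>, of the vector field \<open>X\<close> defined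
  on \<open>D\<close>.\<close>

definition local_flow ::
  "base set \<Rightarrow> (base \<Rightarrow> base) \<Rightarrow> real \<Rightarrow> base set \<Rightarrow> (real \<Rightarrow> base \<Rightarrow> base) \<Rightarrow> bool" where
  "local_flow D X \<epsilon> U \<phi> \<longleftrightarrow>
     0 < \<epsilon> \<and> smooth_on ({-\<epsilon><..<\<epsilon>} \<times> U) (\<lambda>(t, q). \<phi> t q) \<and>
     (\<forall>q\<in>U. \<phi> 0 q = q) \<and>
     (\<forall>t\<in>{-\<epsilon><..<\<epsilon>}. point_transformation U (\<phi> t) \<and>
        (\<forall>q\<in>U. \<phi> t q \<in> D \<and> ((\<lambda>s. \<phi> s q) has_vector_derivative X (\<phi> t q)) (at t)))"

text \<open>\<open>w\<close> is the value at \<open>\<theta>\<close> of the lift \<open>X\<^sup>(\<^sup>k\<^sup>)\<close> to \<open>J\<^sup>k\<pi>\<close> of the vector field \<open>X\<close> on \<open>D\<close>.\<close>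

definition has_lift :: "nat \<Rightarrow> base set \<Rightarrow> (base \<Rightarrow> base) \<Rightarrow> jet \<Rightarrow> jet \<Rightarrow> bool" where
  "has_lift k D X \<theta> w \<longleftrightarrow>
     (\<exists>\<epsilon> U \<phi>. fst \<theta> \<in> U \<and> local_flow D X \<epsilon> U \<phi> \<and> has_velocity (\<lambda>t. lift k U (\<phi> t) \<theta>) w)"

text \<open>\<open>vjets k p\<close> is \<open>W\<^sub>p / L\<^sup>k\<^sub>p\<close>; the map \<open>\<rho>\<^sub>i\<^sub>,\<^sub>j\<close> is \<open>trunc j\<close>.\<close>

definition vjets :: "nat \<Rightarrow> base \<Rightarrow> base coeffs set" where
  "vjets k p = {mjet k X p | D X. p \<in> D \<and> smooth_on D X}"

text \<open>The map \<open>\<rho>\<^sub>k\<close>, with \<open>V\<^sub>p = W\<^sub>p / L\<^sup>0\<^sub>p\<close> identified with the tangent space of the base at \<open>p\<close>.\<close>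

definition rho :: "base coeffs \<Rightarrow> base" where
  "rho a = a (0, 0)"

definition lie_bracket :: "(base \<Rightarrow> base) \<Rightarrow> (base \<Rightarrow> base) \<Rightarrow> base \<Rightarrow> base" where
  "lie_bracket X Y q = frechet_derivative Y (at q) (X q) - frechet_derivative X (at q) (Y q)"

text \<open>The bracket of two elements of \<open>W\<^sub>p / L\<^sup>k\<^sub>p\<close>, with value in \<open>W\<^sub>p / L\<^sup>k\<^sup>-\<^sup>1\<^sub>p\<close> (for \<open>k \<ge> 1\<close>).\<close>

definition jet_bracket :: "nat \<Rightarrow> base \<Rightarrow> base coeffs \<Rightarrow> base coeffs \<Rightarrow> base coeffs" where
  "jet_bracket k p a b = mjet (k - 1) (lie_bracket (jet_rep k p a) (jet_rep k p b)) p"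

definition horizontal :: "nat \<Rightarrow> base \<Rightarrow> base coeffs set \<Rightarrow> bool" where
  "horizontal k p H \<longleftrightarrow> H \<subseteq> vjets k p \<and> subspace H \<and> dim H = 2 \<and> rho ` H = UNIV"

text \<open>\<open>isotropy k \<theta>\<close> is the space \<open>\<A>\<^sub>\<theta> \<subseteq> W\<^sub>p / L\<^sup>k\<^sup>+\<^sup>2\<^sub>p\<close> for \<open>\<theta>\<close> in \<open>J\<^sup>k\<^sup>+\<^sup>1\<pi>\<close>.\<close>

definition isotropy :: "nat \<Rightarrow> jet \<Rightarrow> base coeffs set" where
  "isotropy k \<theta> =
     {mjet (k + 2) X (fst \<theta>) | D X w.
        fst \<theta> \<in> D \<and> smooth_on D X \<and> has_lift k D X (jet_proj k \<theta>) w \<and> w \<in> contact_plane k \<theta>}"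

definition H_const :: "base \<Rightarrow> base coeffs set" where
  "H_const p = {mjet 1 (\<lambda>_. v) p | v. True}"

definition H1 :: "jet \<Rightarrow> base coeffs set" where
  "H1 \<theta> = (THE H. horizontal 2 (fst \<theta>) H \<and> H \<subseteq> isotropy 0 \<theta> \<and> trunc 1 ` H = H_const (fst \<theta>) \<and>
      (\<forall>v w. jet_bracket 2 (fst \<theta>) (inv_into H rho v) (inv_into H rho w) = 0))"

definition H2 :: "jet \<Rightarrow> base coeffs set" where
  "H2 \<theta> = (THE H. horizontal 3 (fst \<theta>) H \<and> H \<subseteq> isotropy 1 \<theta> \<and> trunc 2 ` H = H1 (jet_proj 1 \<theta>))"

text \<open>\<open>\<omega>\<^sub>\<theta>\<close> for \<open>\<theta>\<close> in \<open>J\<^sup>2\<pi>\<close>, as a map into \<open>W\<^sub>p / L\<^sup>2\<^sub>p\<close>, of which \<open>g\<^sub>p\<close> is a subspace.\<close>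

definition omega :: "jet \<Rightarrow> base \<Rightarrow> base \<Rightarrow> base coeffs" where
  "omega \<theta> v w = jet_bracket 3 (fst \<theta>) (inv_into (H2 \<theta>) rho v) (inv_into (H2 \<theta>) rho w)"

text \<open>The pullback of \<open>\<omega>\<^sub>\<theta>\<close> along \<open>\<pi>\<^sub>2\<close>, on tangent vectors of \<open>J\<^sup>2\<pi>\<close> at \<open>\<theta>\<close>; in coordinates
  the differential of \<open>\<pi>\<^sub>2\<close> is \<open>fst\<close>.\<close>

definition omega2 :: "jet \<Rightarrow> jet \<Rightarrow> jet \<Rightarrow> base coeffs" where
  "omega2 \<theta> \<xi> \<eta> = omega \<theta> (fst \<xi>) (fst \<eta>)"

definition omega2_pullback :: "(base \<Rightarrow> total) \<Rightarrow> base \<Rightarrow> base \<Rightarrow> base \<Rightarrow> base coeffs" where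
  "omega2_pullback S p v w =
     omega2 (jet 2 S p) (jet_differential 2 S p v) (jet_differential 2 S p w)"

end

theory Submission
  imports Defs
begin

text \<open>The form \<open>\<omega>\<close> is an invariantly defined expression for the two classical Liouville invariants
  \<open>L\<^sub>1, L\<^sub>2\<close> of an equation \<open>y'' = u\<^sup>0 + u\<^sup>1 y' + u\<^sup>2 y'\<^sup>2 + u\<^sup>3 y'\<^sup>3\<close>, and the theorem is the
  linearizability criterion of Liouville, Lie and Tresse. There are two halves.

  The first half computes \<open>\<omega>\<close>. The lift of a vector field \<open>X\<close> has fibre component
  \<open>infl u (\<partial>\<^sub>1X) (\<partial>\<^sub>2X) (\<partial>\<^sub>1\<^sub>1X) (\<partial>\<^sub>1\<^sub>2X) (\<partial>\<^sub>2\<^sub>2X)\<close>, and its first prolongation is obtained by differentiating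
  once more (\<open>flow_velocity\<close>). A jet of a field that is constant to first order therefore lies in the isotropy
  space if and only if linear equations hold that express the symbol of \<open>infl\<close>, applied to the
  derivatives of highest order, by known quantities. The horizontal subspaces are thus found by
  solving one and the same invertible system (\<open>symbol_system\<close>) twice, first for the second and then for
  the third derivatives of \<open>X\<close> (\<open>H1_eq\<close>, \<open>H2_eq\<close>). Conversely the jets so obtained do belong to fields
  that have a flow (\<open>field_with_flow\<close>). The bracket of the two basic third order jets then has as second
  derivatives exactly \<open>(2L\<^sub>1, 0)\<close>, \<open>(L\<^sub>2, L\<^sub>1)\<close> and \<open>(0, 2L\<^sub>2)\<close> (\<open>brk_hjet3\<close>), so \<open>\<omega> = 0\<close> is the same as
  \<open>L\<^sub>1 = L\<^sub>2 = 0\<close> (\<open>omega_zero_iff\<close>).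

  The second half shows that \<open>L\<^sub>1 = L\<^sub>2 = 0\<close> characterizes the equations that can be transformed to \<open>y'' = 0\<close>.
  A point transformation \<open>f\<close> achieves this if and only if the equation is the one satisfied by the unparametrized
  geodesics of the flat connection pulled back by \<open>f\<close> (\<open>lift0_zero_iff\<close>), and flatness of a connection
  implies \<open>L\<^sub>1 = L\<^sub>2 = 0\<close> for its geodesics (\<open>flat_liouville\<close>). For the converse let \<open>\<Pi>\<close> be the trace-free
  connection whose geodesics are the solutions of the equation, and \<open>P\<close> its Ricci tensor. The linear system
  \<open>\<partial>\<^sub>a\<partial>\<^sub>b\<sigma> = \<Pi>\<^sup>c\<^sub>a\<^sub>b \<partial>\<^sub>c\<sigma> - P\<^sub>a\<^sub>b \<sigma>\<close>, written for \<open>(\<sigma>, \<partial>\<^sub>1\<sigma>, \<partial>\<^sub>2\<sigma>)\<close>, has \<open>L\<^sub>1\<close> and \<open>L\<^sub>2\<close> as its only curvature, so that it is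
  solvable for all initial values when they vanish (\<open>density_system\<close>). If \<open>\<sigma>\<^sub>1, \<sigma>\<^sub>2, \<sigma>\<^sub>3\<close> are
  independent solutions, then \<open>f = (\<sigma>\<^sub>2/\<sigma>\<^sub>1, \<sigma>\<^sub>3/\<sigma>\<^sub>1)\<close> is the transformation sought
  (\<open>quotient_chris\<close>): for \<open>y'' = 0\<close> the solutions \<open>\<sigma>\<close> are the affine functions, and the \<open>\<sigma>\<^sub>k\<close> are the homogeneous
  coordinates of the projective plane onto which \<open>f\<close> develops the solution curves.\<close>

section \<open>Smooth maps and directional derivatives\<close>

definition dird :: "'a::real_normed_vector \<Rightarrow> ('a \<Rightarrow> 'b::real_normed_vector) \<Rightarrow> 'a \<Rightarrow> 'b" where
  "dird v h = (\<lambda>x. frechet_derivative h (at x) v)"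

text \<open>The derivative is defined by choice for maps that are not differentiable, but the predicate from
  which it is chosen depends only on the germ.\<close>

lemma dird_cong:
  assumes "open S" "x \<in> S" "\<And>y. y \<in> S \<Longrightarrow> f y = g y"
  shows "dird v f x = dird v g x"
proof -
  have "(f has_derivative f') (at x) \<longleftrightarrow> (g has_derivative f') (at x)" for f'
    using has_derivative_transform_within_open[OF _ assms(1,2), of f f' UNIV g]
      has_derivative_transform_within_open[OF _ assms(1,2), of g f' UNIV f] assms(3) by metis
  then show ?thesis by (simp add: dird_def frechet_derivative_def)
qed

lemma has_derivative_dird: "h differentiable (at x) \<Longrightarrow> (h has_derivative (\<lambda>v. dird v h x)) (at x)"
  unfolding dird_def using frechet_derivative_works[of h "at x"] by simp

lemma dird_eq: "(h has_derivative h') (at x) \<Longrightarrow> dird v h x = h' v"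
  unfolding dird_def using frechet_derivative_at by metis

lemma C_on_Suc:
  "open D \<Longrightarrow> C_on (Suc k) D h \<longleftrightarrow> (\<forall>x\<in>D. h differentiable (at x)) \<and> (\<forall>v. C_on k D (dird v h))"
  by (simp add: dird_def differentiable_on_eq_differentiable_at)

declare C_on.simps(2) [simp del]

lemma C_on_Suc_imp: "open D \<Longrightarrow> C_on (Suc k) D h \<Longrightarrow> C_on k D h"
proof (induction k arbitrary: h)
  case 0
  then show ?case by (simp add: C_on.simps differentiable_imp_continuous_on)
next
  case (Suc k)
  then show ?case by (simp add: C_on_Suc)
qed

lemma C_on_cong:
  assumes "open D" "\<And>x. x \<in> D \<Longrightarrow> h x = k x" "C_on n D h"
  shows "C_on n D k"
  using assms(2,3)
proof (induction n arbitrary: h k)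
  case 0
  then show ?case using continuous_on_cong[OF refl, of D h k] by simp
next
  case (Suc n)
  have "k differentiable (at x)" if "x \<in> D" for x
  proof -
    have "(h has_derivative (\<lambda>v. dird v h x)) (at x)"
      using Suc.prems that assms(1) by (simp add: C_on_Suc has_derivative_dird)
    then have "(k has_derivative (\<lambda>v. dird v h x)) (at x)"
      using has_derivative_transform_within_open[of h _ x UNIV D k] assms(1) that Suc.prems by auto
    then show ?thesis by (rule differentiableI)
  qed
  moreover have "C_on n D (dird v k)" for v
  proof (rule Suc.IH)
    show "dird v h x = dird v k x" if "x \<in> D" for x
      using dird_cong[OF assms(1) that Suc.prems(1)] by auto
    show "C_on n D (dird v h)" using Suc.prems assms(1) by (simp add: C_on_Suc)
  qed
  ultimately show ?case using assms(1) by (simp add: C_on_Suc)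
qed

lemma C_on_subset: "open D \<Longrightarrow> open E \<Longrightarrow> E \<subseteq> D \<Longrightarrow> C_on n D h \<Longrightarrow> C_on n E h"
proof (induction n arbitrary: h)
  case 0
  then show ?case using continuous_on_subset by auto
next
  case (Suc n)
  then show ?case by (auto simp: C_on_Suc)
qed

lemma dird_const [simp]: "dird v (\<lambda>x. c) = (\<lambda>x. 0)"
  by (simp add: dird_def)

lemma dird_add:
  "f differentiable (at x) \<Longrightarrow> g differentiable (at x) \<Longrightarrow>
    dird v (\<lambda>x. f x + g x) x = dird v f x + dird v g x"
  by (rule dird_eq) (intro has_derivative_add has_derivative_dird)

lemma dird_diff:
  "f differentiable (at x) \<Longrightarrow> g differentiable (at x) \<Longrightarrow>
    dird v (\<lambda>x. f x - g x) x = dird v f x - dird v g x"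
  by (rule dird_eq) (intro has_derivative_diff has_derivative_dird)

lemma dird_minus:
  "f differentiable (at x) \<Longrightarrow> dird v (\<lambda>x. - f x) x = - dird v f x"
  by (rule dird_eq) (intro has_derivative_minus has_derivative_dird)

lemma dird_linear:
  "bounded_linear L \<Longrightarrow> f differentiable (at x) \<Longrightarrow> dird v (\<lambda>x. L (f x)) x = L (dird v f x)"
  by (rule dird_eq[OF bounded_linear.has_derivative[OF _ has_derivative_dird]])

lemma dird_bilinear:
  "bounded_bilinear B \<Longrightarrow> f differentiable (at x) \<Longrightarrow> g differentiable (at x) \<Longrightarrow>
    dird v (\<lambda>x. B (f x) (g x)) x = B (f x) (dird v g x) + B (dird v f x) (g x)"
  by (rule dird_eq[OF bounded_bilinear.FDERIV[OF _ has_derivative_dird has_derivative_dird]])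

lemma dird_mult:
  fixes f g :: "'a::real_normed_vector \<Rightarrow> 'b::real_normed_algebra"
  shows "f differentiable (at x) \<Longrightarrow> g differentiable (at x) \<Longrightarrow>
    dird v (\<lambda>x. f x * g x) x = f x * dird v g x + dird v f x * g x"
  by (rule dird_bilinear[OF bounded_bilinear_mult])

lemma dird_inverse:
  fixes f :: "'a::real_normed_vector \<Rightarrow> real"
  assumes "f differentiable (at x)" "f x \<noteq> 0"
  shows "dird v (\<lambda>x. inverse (f x)) x = - (inverse (f x) * inverse (f x) * dird v f x)"
  by (rule dird_eq) (use assms in \<open>auto intro!: derivative_eq_intros has_derivative_dird\<close>)

lemma dird_lin: "f differentiable (at x) \<Longrightarrow> linear (\<lambda>v. dird v f x)"
  by (simp add: dird_def linear_frechet_derivative)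

lemma dird_euclid:
  fixes f :: "'a::euclidean_space \<Rightarrow> 'b::real_normed_vector"
  assumes "f differentiable (at x)"
  shows "dird v f x = (\<Sum>b\<in>Basis. (v \<bullet> b) *\<^sub>R dird b f x)"
proof -
  have "dird v f x = dird (\<Sum>b\<in>Basis. (v \<bullet> b) *\<^sub>R b) f x" by (simp add: euclidean_representation)
  also have "\<dots> = (\<Sum>b\<in>Basis. (v \<bullet> b) *\<^sub>R dird b f x)"
    using linear_sum[OF dird_lin[OF assms], of "\<lambda>b. (v \<bullet> b) *\<^sub>R b" Basis]
    by (simp only: linear_scale[OF dird_lin[OF assms]])
  finally show ?thesis .
qed

lemma C_on_const: "C_on n D (\<lambda>x. c)"
proof (induction n arbitrary: c)
  case (Suc n)
  then show ?case by (simp add: C_on.simps)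
qed simp

lemma C_on_add:
  assumes "open D" "C_on n D f" "C_on n D g" shows "C_on n D (\<lambda>x. f x + g x)"
  using assms(2,3)
proof (induction n arbitrary: f g)
  case 0
  then show ?case by (simp add: continuous_on_add)
next
  case (Suc n)
  have "C_on n D (dird v (\<lambda>x. f x + g x))" for v
    by (rule C_on_cong[OF assms(1) _ Suc.IH[of "dird v f" "dird v g"]])
      (use Suc.prems assms(1) in \<open>auto simp: C_on_Suc dird_add\<close>)
  then show ?case using Suc.prems assms(1) by (auto simp: C_on_Suc)
qed

lemma C_on_linear:
  assumes "open D" "bounded_linear L" "C_on n D f" shows "C_on n D (\<lambda>x. L (f x))"
  using assms(3)
proof (induction n arbitrary: f)
  case 0
  then show ?case using assms(2) by (simp add: bounded_linear.continuous_on)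
next
  case (Suc n)
  have "C_on n D (dird v (\<lambda>x. L (f x)))" for v
    by (rule C_on_cong[OF assms(1) _ Suc.IH[of "dird v f"]])
      (use Suc.prems assms(1) in \<open>auto simp: C_on_Suc dird_linear[OF assms(2)]\<close>)
  moreover have "(\<lambda>x. L (f x)) differentiable at x" if "x \<in> D" for x
    by (rule differentiableI[OF bounded_linear.has_derivative[OF assms(2) has_derivative_dird]])
      (use Suc.prems assms(1) that in \<open>simp add: C_on_Suc\<close>)
  ultimately show ?case using Suc.prems assms(1) by (auto simp: C_on_Suc)
qed

lemma C_on_bilinear:
  assumes "open D" "bounded_bilinear B" "C_on n D f" "C_on n D g"
  shows "C_on n D (\<lambda>x. B (f x) (g x))"
  using assms(3,4)
proof (induction n arbitrary: f g)
  case 0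
  then show ?case by (auto intro: bounded_bilinear.continuous_on[OF assms(2)])
next
  case (Suc n)
  have fg: "C_on n D f" "C_on n D g"
    using Suc.prems[THEN C_on_Suc_imp[OF assms(1)]] by blast+
  have "C_on n D (dird v (\<lambda>x. B (f x) (g x)))" for v
    by (rule C_on_cong[OF assms(1) _ C_on_add[OF assms(1) Suc.IH[of f "dird v g"] Suc.IH[of "dird v f" g]]])
      (use Suc.prems assms(1) fg in \<open>auto simp: C_on_Suc dird_bilinear[OF assms(2)]\<close>)
  moreover have "(\<lambda>x. B (f x) (g x)) differentiable at x" if "x \<in> D" for x
    by (rule differentiableI[OF bounded_bilinear.FDERIV[OF assms(2) has_derivative_dird has_derivative_dird]])
      (use Suc.prems assms(1) that in \<open>simp_all add: C_on_Suc\<close>)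
  ultimately show ?case using Suc.prems assms(1) by (auto simp: C_on_Suc)
qed

lemma C_on_sum:
  assumes "open D" "\<And>i. i \<in> I \<Longrightarrow> C_on n D (f i)"
  shows "C_on n D (\<lambda>x. \<Sum>i\<in>I. f i x)"
  using assms(2)
proof (induction I rule: infinite_finite_induct)
  case (insert i I)
  then show ?case by (simp add: C_on_add[OF assms(1)])
qed (auto intro: C_on_const)

lemma dird_compose:
  fixes f :: "'a::real_normed_vector \<Rightarrow> 'b::euclidean_space"
  assumes "f differentiable (at x)" "h differentiable (at (f x))"
  shows "dird v (\<lambda>x. h (f x)) x = dird (dird v f x) h (f x)"
proof (rule dird_eq)
  show "((\<lambda>x. h (f x)) has_derivative (\<lambda>v. dird (dird v f x) h (f x))) (at x)"
    using has_derivative_compose[OF has_derivative_dird[OF assms(1)] has_derivative_dird[OF assms(2)]]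
    by simp
qed

text \<open>The direction in which \<open>h\<close> is differentiated in the chain rule depends on the point. Expanding it
  over the basis leaves fixed directions, to which the induction hypothesis applies.\<close>

lemma C_on_compose:
  fixes f :: "'a::real_normed_vector \<Rightarrow> 'b::euclidean_space"
  assumes "open D" "open E" "f ` D \<subseteq> E" "C_on n D f" "C_on n E h"
  shows "C_on n D (\<lambda>x. h (f x))"
  using assms(4,5)
proof (induction n arbitrary: h)
  case 0
  then show ?case using continuous_on_compose2[of E h D f] assms by auto
next
  case (Suc n)
  have f: "C_on n D f" by (rule C_on_Suc_imp[OF assms(1) Suc.prems(1)])
  have "C_on n D (dird v (\<lambda>x. h (f x)))" for v
  proof (rule C_on_cong[OF assms(1)])
    show "(\<Sum>b\<in>Basis. (dird v f x \<bullet> b) *\<^sub>R dird b h (f x)) = dird v (\<lambda>x. h (f x)) x" if "x \<in> D" for x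
    proof -
      have "f differentiable (at x)" "h differentiable (at (f x))"
        using that assms Suc.prems by (auto simp: C_on_Suc)
      then show ?thesis using dird_euclid[of h "f x" "dird v f x"] dird_compose[of f x h v] by simp
    qed
    show "C_on n D (\<lambda>x. \<Sum>b\<in>Basis. (dird v f x \<bullet> b) *\<^sub>R dird b h (f x))"
      using Suc.prems assms f
      by (intro C_on_sum C_on_bilinear[OF _ bounded_bilinear_scaleR]
          C_on_linear[OF _ bounded_linear_inner_left] Suc.IH) (auto simp: C_on_Suc)
  qed
  moreover have "(\<lambda>x. h (f x)) differentiable at x" if "x \<in> D" for x
    by (rule differentiableI[OF has_derivative_compose[OF has_derivative_dird has_derivative_dird]])
      (use Suc.prems assms that in \<open>auto simp: C_on_Suc\<close>)
  ultimately show ?case using Suc.prems assms(1) by (auto simp: C_on_Suc)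
qed

lemma C_on_inverse:
  fixes f :: "'a::real_normed_vector \<Rightarrow> real"
  assumes "open D" "C_on n D f" "\<And>x. x \<in> D \<Longrightarrow> f x \<noteq> 0"
  shows "C_on n D (\<lambda>x. inverse (f x))"
  using assms(2)
proof (induction n)
  case 0
  then show ?case using assms(3) by (auto intro: continuous_on_inverse)
next
  case (Suc n)
  have f: "C_on n D f" "C_on n D (\<lambda>x. inverse (f x))"
    using C_on_Suc_imp[OF assms(1) Suc.prems] Suc.IH by blast+
  have df: "f differentiable at x" if "x \<in> D" for x using that Suc.prems assms(1) by (auto simp: C_on_Suc)
  have "C_on n D (dird v (\<lambda>x. inverse (f x)))" for v
  proof (rule C_on_cong[OF assms(1)])
    show "- (inverse (f x) * inverse (f x) * dird v f x) = dird v (\<lambda>x. inverse (f x)) x" if "x \<in> D" for x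
      using that df assms(3) by (simp add: dird_inverse)
    show "C_on n D (\<lambda>x. - (inverse (f x) * inverse (f x) * dird v f x))"
      using Suc.prems assms(1) f
      by (intro C_on_linear[OF assms(1) bounded_linear_minus[OF bounded_linear_ident]]
         C_on_bilinear[OF assms(1) bounded_bilinear_mult]) (auto simp: C_on_Suc)
  qed
  then show ?case using df assms by (auto simp: C_on_Suc)
qed

lemma smooth_onD: "smooth_on D h \<Longrightarrow> C_on k D h"
  and smooth_on_open: "smooth_on D h \<Longrightarrow> open D"
  by (auto simp: smooth_on_def)

lemma smooth_on_differentiable: "smooth_on D h \<Longrightarrow> x \<in> D \<Longrightarrow> h differentiable (at x)"
  by (meson C_on_Suc smooth_on_def)

lemma smooth_on_dird: "smooth_on D h \<Longrightarrow> smooth_on D (dird v h)"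
  by (meson C_on_Suc smooth_on_def)

lemma smooth_on_cong:
  "smooth_on D h \<Longrightarrow> (\<And>x. x \<in> D \<Longrightarrow> h x = k x) \<Longrightarrow> smooth_on D k"
  unfolding smooth_on_def using C_on_cong[of D h k] by simp

lemma smooth_on_subset: "smooth_on D h \<Longrightarrow> open E \<Longrightarrow> E \<subseteq> D \<Longrightarrow> smooth_on E h"
  unfolding smooth_on_def using C_on_subset[of D E _ h] by simp

lemma smooth_on_continuous: "smooth_on D h \<Longrightarrow> continuous_on D h"
  using smooth_onD[of D h 0] by simp

lemma smooth_on_const: "open D \<Longrightarrow> smooth_on D (\<lambda>x. c)"
  by (simp add: smooth_on_def C_on_const)

lemma smooth_on_add: "smooth_on D f \<Longrightarrow> smooth_on D g \<Longrightarrow> smooth_on D (\<lambda>x. f x + g x)"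
  by (simp add: smooth_on_def C_on_add)

lemma smooth_on_linear: "bounded_linear L \<Longrightarrow> smooth_on D f \<Longrightarrow> smooth_on D (\<lambda>x. L (f x))"
  by (simp add: smooth_on_def C_on_linear)

lemma smooth_on_minus: "smooth_on D f \<Longrightarrow> smooth_on D (\<lambda>x. - f x)"
  by (rule smooth_on_linear[OF bounded_linear_minus[OF bounded_linear_ident]])

lemma smooth_on_diff: "smooth_on D f \<Longrightarrow> smooth_on D g \<Longrightarrow> smooth_on D (\<lambda>x. f x - g x)"
  using smooth_on_add[OF _ smooth_on_minus] by force

lemma smooth_on_bilinear:
  "bounded_bilinear B \<Longrightarrow> smooth_on D f \<Longrightarrow> smooth_on D g \<Longrightarrow> smooth_on D (\<lambda>x. B (f x) (g x))"
  by (simp add: smooth_on_def C_on_bilinear)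

lemma smooth_on_mult:
  fixes f g :: "'a::real_normed_vector \<Rightarrow> 'b::real_normed_algebra"
  shows "smooth_on D f \<Longrightarrow> smooth_on D g \<Longrightarrow> smooth_on D (\<lambda>x. f x * g x)"
  by (rule smooth_on_bilinear[OF bounded_bilinear_mult])

lemma smooth_on_scaleR: "smooth_on D f \<Longrightarrow> smooth_on D g \<Longrightarrow> smooth_on D (\<lambda>x. f x *\<^sub>R g x)"
  by (rule smooth_on_bilinear[OF bounded_bilinear_scaleR])

lemma smooth_on_power:
  fixes f :: "'a::real_normed_vector \<Rightarrow> real"
  shows "smooth_on D f \<Longrightarrow> smooth_on D (\<lambda>x. f x ^ n)"
  by (induction n) (auto intro: smooth_on_const smooth_on_mult smooth_on_open)

lemma smooth_on_sum:
  "open D \<Longrightarrow> (\<And>i. i \<in> I \<Longrightarrow> smooth_on D (f i)) \<Longrightarrow> smooth_on D (\<lambda>x. \<Sum>i\<in>I. f i x)"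
  by (simp add: smooth_on_def C_on_sum)

lemma smooth_on_compose:
  fixes f :: "'a::real_normed_vector \<Rightarrow> 'b::euclidean_space"
  shows "smooth_on D f \<Longrightarrow> smooth_on E h \<Longrightarrow> (\<And>x. x \<in> D \<Longrightarrow> f x \<in> E) \<Longrightarrow> smooth_on D (\<lambda>x. h (f x))"
  using C_on_compose[of D E f _ h] by (auto simp: smooth_on_def image_subset_iff)

lemma smooth_on_inverse:
  fixes f :: "'a::real_normed_vector \<Rightarrow> real"
  shows "smooth_on D f \<Longrightarrow> (\<And>x. x \<in> D \<Longrightarrow> f x \<noteq> 0) \<Longrightarrow> smooth_on D (\<lambda>x. inverse (f x))"
  by (simp add: smooth_on_def C_on_inverse)

lemma smooth_on_divide:
  fixes f :: "'a::real_normed_vector \<Rightarrow> real"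
  shows "smooth_on D f \<Longrightarrow> smooth_on D g \<Longrightarrow> (\<And>x. x \<in> D \<Longrightarrow> g x \<noteq> 0) \<Longrightarrow> smooth_on D (\<lambda>x. f x / g x)"
  unfolding divide_inverse by (intro smooth_on_mult smooth_on_inverse)

lemma smooth_on_ident: "open D \<Longrightarrow> smooth_on D (\<lambda>x. x)"
  unfolding smooth_on_def
proof (intro conjI allI)
  fix n assume "open D"
  show "C_on n D (\<lambda>x. x)"
    by (cases n) (use C_on_const in \<open>auto simp: C_on.simps\<close>)
qed

lemma smooth_on_bounded_linear: "bounded_linear L \<Longrightarrow> open D \<Longrightarrow> smooth_on D L"
  using smooth_on_linear[OF _ smooth_on_ident] by blast

lemma smooth_on_nth: "smooth_on D f \<Longrightarrow> smooth_on D (\<lambda>x. f x $ i)"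
  by (rule smooth_on_linear[OF bounded_linear_vec_nth])

lemma smooth_on_vec:
  fixes f :: "'a::real_normed_vector \<Rightarrow> real ^ 'n"
  assumes "open D" "\<And>i. smooth_on D (\<lambda>x. f x $ i)"
  shows "smooth_on D f"
proof -
  have "f = (\<lambda>x. \<Sum>i\<in>UNIV. (f x $ i) *\<^sub>R axis i 1)"
    by (simp add: fun_eq_iff basis_expansion flip: scalar_mult_eq_scaleR)
  moreover have "smooth_on D (\<lambda>x. \<Sum>i\<in>UNIV. (f x $ i) *\<^sub>R axis i (1::real))"
    by (intro smooth_on_sum smooth_on_scaleR smooth_on_const assms)
  ultimately show ?thesis by simp
qed

lemma dird_nth: "f differentiable (at x) \<Longrightarrow> dird v (\<lambda>x. f x $ i) x = dird v f x $ i"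
  by (rule dird_linear[OF bounded_linear_vec_nth])

lemma has_real_derivative_along_line:
  fixes h :: "'a::real_normed_vector \<Rightarrow> real"
  assumes "h differentiable (at (x + t *\<^sub>R v))"
  shows "((\<lambda>t. h (x + t *\<^sub>R v)) has_real_derivative dird v h (x + t *\<^sub>R v)) (at t)"
proof -
  have "((\<lambda>t. h (x + t *\<^sub>R v)) has_derivative (\<lambda>s. dird (s *\<^sub>R v) h (x + t *\<^sub>R v))) (at t)"
    by (rule has_derivative_compose[of "\<lambda>t. x + t *\<^sub>R v", OF _ has_derivative_dird[OF assms]])
      (auto intro!: derivative_eq_intros)
  then show ?thesis
    using linear_scale[OF dird_lin[OF assms]]
    by (simp add: has_field_derivative_def mult.commute[of _ "dird v h (x + t *\<^sub>R v)"])
qed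

text \<open>The mean value theorem is used first in the direction \<open>v\<close> and then in the direction \<open>w\<close>. The left-hand side is
  symmetric in \<open>v\<close> and \<open>w\<close>, so letting \<open>s\<close> tend to \<open>0\<close> gives the symmetry of second derivatives.\<close>

lemma mixed_difference:
  fixes h :: "'a::real_normed_vector \<Rightarrow> real"
  assumes h: "smooth_on D h" and e: "0 < s" "\<And>a b. 0 \<le> a \<Longrightarrow> a \<le> s \<Longrightarrow> 0 \<le> b \<Longrightarrow> b \<le> s \<Longrightarrow> x + a *\<^sub>R v + b *\<^sub>R w \<in> D"
  shows "\<exists>a b. 0 < a \<and> a < s \<and> 0 < b \<and> b < s \<and>
    h (x + s *\<^sub>R v + s *\<^sub>R w) - h (x + s *\<^sub>R v) - h (x + s *\<^sub>R w) + h x = s * s * dird w (dird v h) (x + a *\<^sub>R v + b *\<^sub>R w)"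
proof -
  let ?g = "\<lambda>a. h ((x + s *\<^sub>R w) + a *\<^sub>R v) - h (x + a *\<^sub>R v)"
  have 1: "(?g has_real_derivative (dird v h ((x + s *\<^sub>R w) + a *\<^sub>R v) - dird v h (x + a *\<^sub>R v))) (at a)"
    if "0 \<le> a" "a \<le> s" for a
  proof (intro DERIV_diff has_real_derivative_along_line smooth_on_differentiable[OF h])
    show "x + s *\<^sub>R w + a *\<^sub>R v \<in> D" using e(2)[of a s] that e(1) by (simp add: algebra_simps)
    show "x + a *\<^sub>R v \<in> D" using e(2)[of a 0] that e(1) by simp
  qed
  obtain a where a: "0 < a" "a < s" "?g s - ?g 0 = (s - 0) * (dird v h ((x + s *\<^sub>R w) + a *\<^sub>R v) - dird v h (x + a *\<^sub>R v))"
    using MVT2[OF e(1) 1] by blast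
  let ?k = "\<lambda>b. dird v h ((x + a *\<^sub>R v) + b *\<^sub>R w)"
  have 2: "(?k has_real_derivative dird w (dird v h) ((x + a *\<^sub>R v) + b *\<^sub>R w)) (at b)"
    if "0 \<le> b" "b \<le> s" for b
    by (intro has_real_derivative_along_line smooth_on_differentiable[OF smooth_on_dird[OF h]] e(2))
      (use a that in auto)
  obtain b where b: "0 < b" "b < s" "?k s - ?k 0 = (s - 0) * dird w (dird v h) ((x + a *\<^sub>R v) + b *\<^sub>R w)"
    using MVT2[OF e(1) 2] by blast
  have "?g s - ?g 0 = s * (?k s - ?k 0)" using a(3) by (simp add: algebra_simps)
  also have "\<dots> = s * s * dird w (dird v h) ((x + a *\<^sub>R v) + b *\<^sub>R w)" using b(3) by simp
  finally show ?thesis using a b by (intro exI[of _ a] exI[of _ b]) (simp add: algebra_simps)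
qed

lemma dird_commute:
  fixes h :: "'a::real_normed_vector \<Rightarrow> real"
  assumes h: "smooth_on D h" and x: "x \<in> D"
  shows "dird v (dird w h) x = dird w (dird v h) x"
proof (rule ccontr)
  assume ne: "\<not> ?thesis"
  \<comment> \<open>half the gap, so that numbers that are \<open>\<epsilon>\<close>-close to the two sides are different\<close>
  define \<epsilon> where "\<epsilon> = \<bar>dird v (dird w h) x - dird w (dird v h) x\<bar> / 2"
  have e: "\<epsilon> > 0" using ne by (simp add: \<epsilon>_def)
  have oD: "open D" using h smooth_on_open by blast
  have c: "continuous_on D (dird a (dird b h))" for a b
    using h by (intro smooth_on_continuous smooth_on_dird)
  have near: "\<exists>d>0. \<forall>y. dist y x < d \<longrightarrow> y \<in> D \<and> \<bar>dird a (dird b h) y - dird a (dird b h) x\<bar> < \<epsilon>" for a b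
  proof -
    obtain d1 where "d1 > 0" "\<And>y. dist y x < d1 \<Longrightarrow> y \<in> D"
      using oD x by (auto simp: open_dist)
    moreover obtain d2 where "d2 > 0" "\<And>y. y \<in> D \<Longrightarrow> dist y x < d2 \<Longrightarrow> dist (dird a (dird b h) y) (dird a (dird b h) x) < \<epsilon>"
      using c[of a b] x e unfolding continuous_on_iff by metis
    ultimately show ?thesis by (intro exI[of _ "min d1 d2"]) (auto simp: dist_real_def)
  qed
  obtain d1 d2 where d: "d1 > 0" "d2 > 0"
    "\<And>y. dist y x < d1 \<Longrightarrow> y \<in> D \<and> \<bar>dird v (dird w h) y - dird v (dird w h) x\<bar> < \<epsilon>"
    "\<And>y. dist y x < d2 \<Longrightarrow> y \<in> D \<and> \<bar>dird w (dird v h) y - dird w (dird v h) x\<bar> < \<epsilon>"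
    using near by meson
  define d where "d = min d1 d2"
  define s where "s = d / (norm v + norm w + 1)"
  have pos: "norm v + norm w + 1 > 0" using norm_ge_zero[of v] norm_ge_zero[of w] by linarith
  have s: "s > 0" using d(1,2) pos by (simp add: s_def d_def)
  have close: "dist (x + a *\<^sub>R v + b *\<^sub>R w) x < d" if "0 \<le> a" "a \<le> s" "0 \<le> b" "b \<le> s" for a b
  proof -
    have "dist (x + a *\<^sub>R v + b *\<^sub>R w) x = norm (a *\<^sub>R v + b *\<^sub>R w)"
      by (simp add: dist_norm algebra_simps)
    also have "\<dots> \<le> a * norm v + b * norm w"
      using norm_triangle_ineq[of "a *\<^sub>R v" "b *\<^sub>R w"] that by simp
    also have "\<dots> \<le> s * norm v + s * norm w"
      using that by (intro add_mono mult_right_mono) auto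
    also have "\<dots> < s * (norm v + norm w + 1)" using s by (simp add: algebra_simps)
    also have "\<dots> = d" using pos by (simp add: s_def)
    finally show ?thesis .
  qed
  have sub: "x + a *\<^sub>R v + b *\<^sub>R w \<in> D" "x + a *\<^sub>R w + b *\<^sub>R v \<in> D" if "0 \<le> a" "a \<le> s" "0 \<le> b" "b \<le> s" for a b
    using d(3) close[OF that] close[of b a] that by (auto simp: d_def algebra_simps)
  obtain a b where ab: "0 < a" "a < s" "0 < b" "b < s"
    "h (x + s *\<^sub>R v + s *\<^sub>R w) - h (x + s *\<^sub>R v) - h (x + s *\<^sub>R w) + h x = s * s * dird w (dird v h) (x + a *\<^sub>R v + b *\<^sub>R w)"
    using mixed_difference[OF h s sub(1)] by blast
  obtain a' b' where ab': "0 < a'" "a' < s" "0 < b'" "b' < s"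
    "h (x + s *\<^sub>R w + s *\<^sub>R v) - h (x + s *\<^sub>R w) - h (x + s *\<^sub>R v) + h x = s * s * dird v (dird w h) (x + a' *\<^sub>R w + b' *\<^sub>R v)"
    using mixed_difference[OF h s sub(2)] by blast
  have "s * s * dird w (dird v h) (x + a *\<^sub>R v + b *\<^sub>R w) = s * s * dird v (dird w h) (x + a' *\<^sub>R w + b' *\<^sub>R v)"
    using ab(5) ab'(5) by (simp add: algebra_simps)
  then have eq: "dird w (dird v h) (x + a *\<^sub>R v + b *\<^sub>R w) = dird v (dird w h) (x + a' *\<^sub>R w + b' *\<^sub>R v)"
    using s by simp
  have "\<bar>dird w (dird v h) (x + a *\<^sub>R v + b *\<^sub>R w) - dird w (dird v h) x\<bar> < \<epsilon>"
    using d(4) close[of a b] ab by (simp add: d_def)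
  moreover have "\<bar>dird v (dird w h) (x + a' *\<^sub>R w + b' *\<^sub>R v) - dird v (dird w h) x\<bar> < \<epsilon>"
    using d(3) close[of b' a'] ab' by (simp add: d_def algebra_simps)
  ultimately have "\<bar>dird v (dird w h) x - dird w (dird v h) x\<bar> < 2 * \<epsilon>" unfolding eq by linarith
  then show False by (simp add: \<epsilon>_def)
qed

section \<open>Local inverses of plane maps\<close>

lemma partial_dird: "partial i h = dird (axis i 1) h"
  by (simp add: partial_def dird_def)

lemma base_expand: "(v::base) = v $ 1 *\<^sub>R axis 1 1 + v $ 2 *\<^sub>R axis 2 1"
  by (simp add: vec_eq_iff axis_def forall_2)

lemma dird_base:
  fixes h :: "base \<Rightarrow> 'b::real_normed_vector"
  assumes "h differentiable (at x)"
  shows "dird v h x = v $ 1 *\<^sub>R partial 1 h x + v $ 2 *\<^sub>R partial 2 h x"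
proof -
  have "dird v h x = dird (v $ 1 *\<^sub>R axis 1 1 + v $ 2 *\<^sub>R axis 2 1) h x" using base_expand[of v] by simp
  also have "\<dots> = v $ 1 *\<^sub>R partial 1 h x + v $ 2 *\<^sub>R partial 2 h x"
    by (simp add: partial_dird linear_add[OF dird_lin[OF assms]] linear_scale[OF dird_lin[OF assms]])
  finally show ?thesis .
qed

lemma smooth_on_partial: "smooth_on D h \<Longrightarrow> smooth_on D (partial i h)"
  by (simp add: partial_dird smooth_on_dird)

lemma partial_nth: "f differentiable (at x) \<Longrightarrow> partial i (\<lambda>x. f x $ k) x = partial i f x $ k"
  by (simp add: partial_dird dird_nth)

definition jac :: "(base \<Rightarrow> base) \<Rightarrow> base \<Rightarrow> real" where
  "jac f q = partial 1 f q $ 1 * partial 2 f q $ 2 - partial 2 f q $ 1 * partial 1 f q $ 2"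

lemma smooth_on_jac: "smooth_on U f \<Longrightarrow> smooth_on U (jac f)"
  unfolding jac_def[abs_def] by (intro smooth_on_diff smooth_on_mult smooth_on_nth smooth_on_partial)

lemma cramer_base:
  fixes f :: "base \<Rightarrow> base"
  assumes "f differentiable (at x)" "jac f x \<noteq> 0" "dird w f x = v"
  shows "w $ 1 = (v $ 1 * partial 2 f x $ 2 - v $ 2 * partial 2 f x $ 1) / jac f x"
    "w $ 2 = (partial 1 f x $ 1 * v $ 2 - partial 1 f x $ 2 * v $ 1) / jac f x"
proof -
  have v: "v $ i = w $ 1 * partial 1 f x $ i + w $ 2 * partial 2 f x $ i" for i
    using assms(3) dird_base[OF assms(1), of w] by (metis vector_add_component vector_scaleR_component real_scaleR_def)
  show "w $ 1 = (v $ 1 * partial 2 f x $ 2 - v $ 2 * partial 2 f x $ 1) / jac f x"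
    "w $ 2 = (partial 1 f x $ 1 * v $ 2 - partial 1 f x $ 2 * v $ 1) / jac f x"
    unfolding eq_divide_eq v[of 1] v[of 2] using assms(2)
    by (simp_all add: jac_def algebra_simps)
qed

text \<open>By Cramer's rule the derivatives of \<open>g\<close> are smooth functions of the first derivatives of \<open>f\<close>, composed
  with \<open>g\<close>. So if \<open>g\<close> is \<open>k\<close> times continuously differentiable, then so are its derivatives.\<close>

lemma smooth_on_right_inverse:
  fixes f g :: "base \<Rightarrow> base"
  assumes f: "smooth_on U f" and V: "open V" and g: "\<And>y. y \<in> V \<Longrightarrow> g differentiable (at y)"
    and gU: "g ` V \<subseteq> U" and fg: "\<And>y. y \<in> V \<Longrightarrow> f (g y) = y" and J: "\<And>x. x \<in> U \<Longrightarrow> jac f x \<noteq> 0"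
  shows "smooth_on V g"
  unfolding smooth_on_def
proof (intro conjI allI V)
  have U: "open U" using f smooth_on_open by blast
  have inU: "g y \<in> U" if "y \<in> V" for y using gU that by auto
  define w1 where "w1 v x = (v $ 1 * partial 2 f x $ 2 - v $ 2 * partial 2 f x $ 1) / jac f x" for v :: base and x
  define w2 where "w2 v x = (partial 1 f x $ 1 * v $ 2 - partial 1 f x $ 2 * v $ 1) / jac f x" for v :: base and x
  have w: "smooth_on U (w1 v)" "smooth_on U (w2 v)" for v
    unfolding w1_def[abs_def] w2_def[abs_def]
    by (intro smooth_on_divide smooth_on_diff smooth_on_mult smooth_on_nth smooth_on_partial
        smooth_on_const smooth_on_jac f U J; assumption)+
  have dg: "dird v g y = w1 v (g y) *\<^sub>R axis 1 1 + w2 v (g y) *\<^sub>R axis 2 1" if y: "y \<in> V" for v y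
  proof -
    have df: "f differentiable (at (g y))" using smooth_on_differentiable[OF f inU[OF y]] .
    have "dird (dird v g y) f (g y) = dird v (\<lambda>y. f (g y)) y"
      by (rule dird_compose[symmetric, OF g[OF y] df])
    also have "\<dots> = dird v (\<lambda>y. y) y" by (rule dird_cong[OF V y fg])
    also have "\<dots> = v" by (simp add: dird_def)
    finally have "dird (dird v g y) f (g y) = v" .
    from cramer_base[OF df J[OF inU[OF y]] this]
    show ?thesis using base_expand[of "dird v g y"] by (simp add: w1_def w2_def)
  qed
  show "C_on k V g" for k
  proof (induction k)
    case 0
    show ?case using g by (auto intro!: differentiable_imp_continuous_on
          simp: V differentiable_on_eq_differentiable_at)
  next
    case (Suc k)
    have c: "C_on k V (\<lambda>y. w1 v (g y))" "C_on k V (\<lambda>y. w2 v (g y))" for v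
      by (rule C_on_compose[OF V U gU Suc smooth_onD[OF w(1)]])
        (rule C_on_compose[OF V U gU Suc smooth_onD[OF w(2)]])
    have "C_on k V (\<lambda>y. w1 v (g y) *\<^sub>R axis 1 1 + w2 v (g y) *\<^sub>R axis 2 1 :: base)" for v
      by (intro C_on_add[OF V] C_on_bilinear[OF V bounded_bilinear_scaleR] c C_on_const)
    then have "C_on k V (dird v g)" for v
      by (rule C_on_cong[OF V, rotated]) (simp add: dg)
    then show ?case using g by (simp add: C_on_Suc[OF V])
  qed
qed

lemma blinfun_dird:
  fixes h :: "'a::euclidean_space \<Rightarrow> 'b::real_normed_vector"
  shows "h differentiable (at x) \<Longrightarrow> blinfun_apply (Blinfun (\<lambda>v. dird v h x)) v = dird v h x"
  by (simp add: bounded_linear_Blinfun_apply has_derivative_bounded_linear[OF has_derivative_dird])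

text \<open>The inverse function theorem provides a differentiable local inverse; its smoothness is the
  bootstrap argument of \<open>smooth_on_right_inverse\<close>.\<close>

lemma local_point_transformation:
  fixes f :: "base \<Rightarrow> base"
  assumes f: "smooth_on U f" and q: "q \<in> U" and J: "jac f q \<noteq> 0"
  obtains V where "V \<subseteq> U" "q \<in> V" "open V" "point_transformation V f"
proof -
  define U0 where "U0 = U \<inter> jac f -` (- {0})"
  have U: "open U" using f smooth_on_open by blast
  have "continuous_on U (jac f)" by (intro smooth_on_continuous smooth_on_jac f)
  then have U0: "open U0" unfolding U0_def by (rule continuous_open_preimage[OF _ U]) auto
  have q0: "q \<in> U0" using q J by (simp add: U0_def)
  have f0: "smooth_on U0 f" by (rule smooth_on_subset[OF f U0]) (auto simp: U0_def)
  have J0: "jac f x \<noteq> 0" if "x \<in> U0" for x using that by (simp add: U0_def)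
  define f' where "f' x = Blinfun (\<lambda>v. dird v f x)" for x
  have f': "blinfun_apply (f' x) v = dird v f x" if "x \<in> U0" for x v
    unfolding f'_def by (rule blinfun_dird[OF smooth_on_differentiable[OF f0 that]])
  have contf': "continuous_on U0 f'"
  proof (rule continuous_on_blinfun_componentwise)
    fix i :: base
    have "continuous_on U0 (dird i f)" by (intro smooth_on_continuous smooth_on_dird f0)
    then show "continuous_on U0 (\<lambda>x. blinfun_apply (f' x) i)" by (simp add: f' cong: continuous_on_cong)
  qed
  have lin: "linear (\<lambda>v. dird v f q)" using dird_lin[OF smooth_on_differentiable[OF f0 q0]] .
  have "inj (\<lambda>v. dird v f q)"
  proof (rule linear_injective_0[THEN iffD2, OF lin], intro allI impI)
    fix w assume "dird w f q = 0"
    from cramer_base[OF smooth_on_differentiable[OF f q] J this] show "w = 0"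
      by (simp add: vec_eq_iff forall_2)
  qed
  then obtain g0 where g0: "linear g0" "g0 \<circ> (\<lambda>v. dird v f q) = id"
    using linear_injective_left_inverse[OF lin] by blast
  have "blinfun_apply (Blinfun g0) v = g0 v" for v
    using g0(1) by (simp add: bounded_linear_Blinfun_apply linear_conv_bounded_linear)
  then have inv: "Blinfun g0 o\<^sub>L f' q = id_blinfun"
    using g0(2) by (intro blinfun_eqI) (auto simp: f'[OF q0] fun_eq_iff)
  have der: "(f has_derivative blinfun_apply (f' x)) (at x)" if "x \<in> U0" for x
  proof -
    have "blinfun_apply (f' x) = (\<lambda>v. dird v f x)" using f'[OF that] by auto
    then show ?thesis using has_derivative_dird[OF smooth_on_differentiable[OF f0 that]] by simp
  qed
  obtain V W g g' where V: "open V" "V \<subseteq> U0" "q \<in> V" "open W" "f q \<in> W" "homeomorphism V W f g"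
    "\<And>y. y \<in> W \<Longrightarrow> (g has_derivative (g' y)) (at y)"
    using inverse_function_theorem[OF U0 der contf' q0 inv] by metis
  have hom: "f ` V = W" "g ` W = V" "\<And>x. x \<in> V \<Longrightarrow> g (f x) = x" "\<And>y. y \<in> W \<Longrightarrow> f (g y) = y"
    using V(6) by (auto simp: homeomorphism_def)
  have inj: "inj_on f V" using hom(3) by (metis inj_on_inverseI)
  have g: "smooth_on W g"
    by (rule smooth_on_right_inverse[OF f0 V(4)])
      (use V(2) V(7) hom J0 in \<open>auto intro: differentiableI\<close>)
  have "smooth_on (f ` V) (inv_into V f)"
    unfolding hom(1)
  proof (rule smooth_on_cong[OF g])
    show "g y = inv_into V f y" if "y \<in> W" for y
      by (rule sym, rule inv_into_f_eq[OF inj]) (use that hom in auto)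
  qed
  then have "point_transformation V f"
    unfolding point_transformation_def using inj smooth_on_subset[OF f0 V(1,2)] by simp
  moreover have "V \<subseteq> U" using V(2) by (auto simp: U0_def)
  ultimately show ?thesis using that V(1,3) by blast
qed

section \<open>Linear contractions depending on a parameter\<close>

text \<open>The equation \<open>y = b + P m y\<close> is an abstract linear integral equation with inhomogeneous term \<open>b\<close> and
  coefficient \<open>m\<close>. Smooth dependence of its solution on parameters is what makes the solutions of
  differential equations smooth.\<close>

definition fixpt :: "('m \<Rightarrow> 'e \<Rightarrow> 'e::banach) \<Rightarrow> 'm \<Rightarrow> 'e \<Rightarrow> 'e" where
  "fixpt P m b = (THE y. y = b + P m y)"

locale linear_contraction =
  fixes P :: "'m::real_normed_vector \<Rightarrow> 'e::banach \<Rightarrow> 'e"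
  assumes bil: "bounded_bilinear P" and bound: "norm (P m x) \<le> norm m * norm x"
begin

lemma ex1_fixpt:
  assumes "norm m \<le> 1/2"
  shows "\<exists>!y. y = b + P m y"
proof -
  have "dist (b + P m x) (b + P m y) \<le> 1/2 * dist x y" for x y
  proof -
    have "dist (b + P m x) (b + P m y) = norm (P m (x - y))"
      by (simp add: dist_norm bounded_bilinear.diff_right[OF bil])
    also have "\<dots> \<le> 1/2 * norm (x - y)"
      using bound[of m "x - y"] mult_right_mono[OF assms norm_ge_zero[of "x - y"]] by linarith
    finally show ?thesis by (simp add: dist_norm)
  qed
  then have "\<exists>!x. b + P m x = x" by (intro banach_fix_type[of "1/2"]) auto
  then show ?thesis by metis
qed

lemma fixpt_eq: "norm m \<le> 1/2 \<Longrightarrow> fixpt P m b = b + P m (fixpt P m b)"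
  unfolding fixpt_def by (rule theI'[OF ex1_fixpt])

lemma fixpt_unique: "norm m \<le> 1/2 \<Longrightarrow> y = b + P m y \<Longrightarrow> y = fixpt P m b"
  using ex1_fixpt[of m b] fixpt_eq[of m b] by blast

lemma norm_fixpt:
  assumes "norm m \<le> 1/2"
  shows "norm (fixpt P m b) \<le> norm b * 2"
proof -
  let ?y = "fixpt P m b"
  have "norm ?y \<le> norm b + norm (P m ?y)" using fixpt_eq[OF assms, of b] norm_triangle_ineq by metis
  also have "\<dots> \<le> norm b + 1/2 * norm ?y"
    using bound[of m ?y] mult_right_mono[OF assms norm_ge_zero[of ?y]] by linarith
  finally show ?thesis by simp
qed

lemma bounded_linear_fixpt:
  assumes "norm m \<le> 1/2"
  shows "bounded_linear (fixpt P m)"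
proof
  fix b c and r :: real
  have "fixpt P m b + fixpt P m c = (b + c) + P m (fixpt P m b + fixpt P m c)"
    unfolding bounded_bilinear.add_right[OF bil]
    by (subst (1) fixpt_eq[OF assms, of b], subst (1) fixpt_eq[OF assms, of c]) simp
  then show "fixpt P m (b + c) = fixpt P m b + fixpt P m c" using fixpt_unique[OF assms] by metis
  have "r *\<^sub>R fixpt P m b = r *\<^sub>R (b + P m (fixpt P m b))"
    using fixpt_eq[OF assms, of b] by simp
  also have "\<dots> = r *\<^sub>R b + P m (r *\<^sub>R fixpt P m b)"
    by (simp only: bounded_bilinear.scaleR_right[OF bil] scaleR_add_right)
  finally show "fixpt P m (r *\<^sub>R b) = r *\<^sub>R fixpt P m b" using fixpt_unique[OF assms] by metis
  show "\<exists>K. \<forall>x. norm (fixpt P m x) \<le> norm x * K" using norm_fixpt[OF assms] by blast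
qed

end

text \<open>Where one factor vanishes, a product is differentiable as soon as the other factor is
  continuous. This removes the circularity in differentiating a solution, which appears on both
  sides of \<open>fixpt_difference\<close>.\<close>

lemma has_derivative_bilinear_zero:
  assumes B: "bounded_bilinear B" and f: "(f has_derivative f') (at z)" "f z = 0" and k: "isCont k z"
  shows "((\<lambda>y. B (f y) (k y)) has_derivative (\<lambda>v. B (f' v) (k z))) (at z)"
proof -
  interpret B: bounded_bilinear B by fact
  obtain K where K: "K > 0" "\<And>a b. norm (B a b) \<le> norm a * norm b * K" using B.pos_bounded by blast
  have lf: "bounded_linear f'" using f(1) by (rule has_derivative_bounded_linear)
  obtain C where C: "\<And>v. norm (f' v) \<le> norm v * C" using bounded_linear.bounded[OF lf] by blast
  have r: "((\<lambda>y. norm (f y - f z - f' (y - z)) / norm (y - z)) \<longlongrightarrow> 0) (at z)"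
    using f(1) unfolding has_derivative_iff_norm by simp
  have kz: "((\<lambda>y. norm (k y - k z)) \<longlongrightarrow> 0) (at z)"
    using k unfolding isCont_def by (simp add: LIM_zero tendsto_norm_zero)
  have lim: "((\<lambda>y. (norm (f y - f z - f' (y - z)) / norm (y - z) + C) * norm (k y - k z) * K) \<longlongrightarrow> (0 + C) * 0 * K) (at z)"
    by (intro tendsto_intros r kz)
  have "((\<lambda>y. norm (B (f y) (k y - k z)) / norm (y - z)) \<longlongrightarrow> 0) (at z)"
  proof (rule Lim_null_comparison)
    show "\<forall>\<^sub>F y in at z. norm (norm (B (f y) (k y - k z)) / norm (y - z)) \<le>
        (norm (f y - f z - f' (y - z)) / norm (y - z) + C) * norm (k y - k z) * K"
    proof (rule eventually_at[THEN iffD2], intro exI[of _ 1] conjI ballI impI)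
      fix y assume "y \<noteq> z \<and> dist y z < 1"
      then have yz: "norm (y - z) > 0" by simp
      have "norm (f y) \<le> norm (f y - f z - f' (y - z)) + norm (f' (y - z))"
        using norm_triangle_ineq[of "f y - f z - f' (y - z)" "f' (y - z)"] f(2) by simp
      also have "\<dots> \<le> norm (f y - f z - f' (y - z)) + norm (y - z) * C" using C by simp
      finally have "norm (f y) / norm (y - z) \<le> (norm (f y - f z - f' (y - z)) + norm (y - z) * C) / norm (y - z)"
        by (intro divide_right_mono) auto
      also have "\<dots> = norm (f y - f z - f' (y - z)) / norm (y - z) + C"
        using yz by (simp add: field_simps)
      finally have le: "norm (f y) / norm (y - z) \<le> norm (f y - f z - f' (y - z)) / norm (y - z) + C" .
      have "norm (norm (B (f y) (k y - k z)) / norm (y - z)) = norm (B (f y) (k y - k z)) / norm (y - z)" by simp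
      also have "\<dots> \<le> (norm (f y) * norm (k y - k z) * K) / norm (y - z)"
        using K(2) by (intro divide_right_mono) auto
      also have "\<dots> = (norm (f y) / norm (y - z)) * norm (k y - k z) * K" by simp
      also have "\<dots> \<le> (norm (f y - f z - f' (y - z)) / norm (y - z) + C) * norm (k y - k z) * K"
        using le K(1) by (intro mult_right_mono) auto
      finally show "norm (norm (B (f y) (k y - k z)) / norm (y - z)) \<le>
        (norm (f y - f z - f' (y - z)) / norm (y - z) + C) * norm (k y - k z) * K" .
    qed simp
    show "((\<lambda>y. (norm (f y - f z - f' (y - z)) / norm (y - z) + C) * norm (k y - k z) * K) \<longlongrightarrow> 0) (at z)"
      using lim by simp
  qed
  then have 2: "((\<lambda>y. B (f y) (k y - k z)) has_derivative (\<lambda>v. 0)) (at z)"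
    unfolding has_derivative_iff_norm using f(2) by (simp add: B.zero_left)
  have 1: "((\<lambda>y. B (f y) (k z)) has_derivative (\<lambda>v. B (f' v) (k z))) (at z)"
    by (rule bounded_linear.has_derivative[OF B.bounded_linear_left f(1)])
  show ?thesis using has_derivative_add[OF 1 2] by (simp add: B.diff_right)
qed

context linear_contraction
begin

text \<open>The difference of the solutions of two equations solves the first equation with an inhomogeneous term
  that is small when the equations are close. Continuity and differentiability in parameters are
  both read off from this.\<close>

lemma fixpt_difference:
  assumes "norm m \<le> 1/2" "x = c + P m x" "x' = c' + P m' x'"
  shows "x' = x + fixpt P m (c' - c + P (m' - m) x')"
proof -
  interpret P: bounded_bilinear P by (rule bil)
  have "x' - x = (c' - c + P (m' - m) x') + P m (x' - x)"
    by (subst (1) assms(2), subst (1) assms(3)) (simp add: P.diff_left P.diff_right)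
  from fixpt_unique[OF assms(1) this] show ?thesis by (simp add: algebra_simps)
qed

lemma fixpt_has_derivative:
  assumes U: "open U" "z \<in> U" and M: "\<And>z. z \<in> U \<Longrightarrow> norm (M z) \<le> 1/2"
    and eq: "\<And>z. z \<in> U \<Longrightarrow> x z = c z + P (M z) (x z)" and cont: "isCont x z"
    and d: "(c has_derivative c') (at z)" "(M has_derivative M') (at z)"
  shows "(x has_derivative (\<lambda>v. fixpt P (M z) (c' v + P (M' v) (x z)))) (at z)"
proof -
  have "((\<lambda>y. P (M y - M z) (x y)) has_derivative (\<lambda>v. P (M' v) (x z))) (at z)"
    by (rule has_derivative_bilinear_zero[OF bil _ _ cont])
      (use has_derivative_diff[OF d(2) has_derivative_const] in auto)
  then have "((\<lambda>y. c y - c z + P (M y - M z) (x y)) has_derivative (\<lambda>v. c' v + P (M' v) (x z))) (at z)"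
    using has_derivative_add[OF has_derivative_diff[OF d(1) has_derivative_const[of "c z"]]] by simp
  then have "((\<lambda>y. x z + fixpt P (M z) (c y - c z + P (M y - M z) (x y))) has_derivative
      (\<lambda>v. 0 + fixpt P (M z) (c' v + P (M' v) (x z)))) (at z)"
    by (rule has_derivative_add[OF has_derivative_const
        bounded_linear.has_derivative[OF bounded_linear_fixpt[OF M[OF U(2)]]]])
  then have "((\<lambda>y. x z + fixpt P (M z) (c y - c z + P (M y - M z) (x y))) has_derivative
      (\<lambda>v. fixpt P (M z) (c' v + P (M' v) (x z)))) (at z)" by simp
  then show ?thesis
    by (rule has_derivative_transform_within_open[OF _ U])
      (rule fixpt_difference[OF M[OF U(2)] eq[OF U(2)] eq, symmetric])
qed

lemma fixpt_continuous:
  assumes U: "open U" and M: "\<And>z. z \<in> U \<Longrightarrow> norm (M z) \<le> 1/2"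
    and eq: "\<And>z. z \<in> U \<Longrightarrow> x z = c z + P (M z) (x z)"
    and c: "continuous_on U c" "continuous_on U M"
  shows "continuous_on U x"
  unfolding continuous_on_def
proof
  fix z assume z: "z \<in> U"
  have "((\<lambda>y. c y - c z + P (M y - M z) (x z)) \<longlongrightarrow> c z - c z + P (M z - M z) (x z)) (at z within U)"
    using c z by (intro tendsto_intros bounded_bilinear.tendsto[OF bil]) (auto simp: continuous_on_def)
  then have "((\<lambda>y. norm (c y - c z + P (M y - M z) (x z)) * 2) \<longlongrightarrow> 0) (at z within U)"
    by (intro tendsto_mult_left_zero tendsto_norm_zero) (simp add: bounded_bilinear.zero_left[OF bil])
  moreover have "norm (x y - x z) \<le> norm (c y - c z + P (M y - M z) (x z)) * 2" if y: "y \<in> U" for y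
  proof -
    have "x z = x y + fixpt P (M y) (c z - c y + P (M z - M y) (x z))"
      by (rule fixpt_difference[OF M[OF y] eq[OF y] eq[OF z]])
    then have "norm (x y - x z) = norm (fixpt P (M y) (c z - c y + P (M z - M y) (x z)))"
      by (metis add_diff_cancel_left' norm_minus_commute)
    also have "\<dots> \<le> norm (c z - c y + P (M z - M y) (x z)) * 2" by (rule norm_fixpt[OF M[OF y]])
    also have "norm (c z - c y + P (M z - M y) (x z)) = norm (- (c y - c z + P (M y - M z) (x z)))"
      by (simp add: bounded_bilinear.diff_left[OF bil] algebra_simps)
    finally show ?thesis by (simp only: norm_minus_cancel)
  qed
  then have "\<forall>\<^sub>F y in at z within U. norm (x y - x z) \<le> norm (c y - c z + P (M y - M z) (x z)) * 2"
    by (simp add: eventually_at_filter)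
  ultimately have "((\<lambda>y. x y - x z) \<longlongrightarrow> 0) (at z within U)" by (metis (no_types) Lim_null_comparison)
  then show "(x \<longlongrightarrow> x z) (at z within U)" by (simp add: LIM_zero_iff)
qed

text \<open>The derivative of the solution solves the same equation with a new inhomogeneous term, in which the
  solution itself occurs, but without derivatives. Hence every derivative of the data gives one of the solution.\<close>

lemma C_on_fixpt:
  assumes U: "open U" and M: "\<And>z. z \<in> U \<Longrightarrow> norm (M z) \<le> 1/2"
    and eq: "\<And>z. z \<in> U \<Longrightarrow> x z = c z + P (M z) (x z)"
    and c: "C_on n U c" "C_on n U M"
  shows "C_on n U x"
  using eq c
proof (induction n arbitrary: x c)
  case 0
  then show ?case using fixpt_continuous[OF U, of M x c] M by simp
next
  case (Suc n)
  have cn: "C_on n U c" "C_on n U M" using Suc.prems(2,3) C_on_Suc_imp[OF U] by auto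
  have xn: "C_on n U x" by (rule Suc.IH[OF Suc.prems(1) cn])
  have "C_on 0 U h" if "C_on n U h" for h :: "'a \<Rightarrow> 'e"
    using that by (induction n) (auto dest: C_on_Suc_imp[OF U] simp del: C_on.simps)
  then have contx: "continuous_on U x" using xn by fastforce
  have d: "(x has_derivative (\<lambda>v. fixpt P (M z) (dird v c z + P (dird v M z) (x z)))) (at z)" if "z \<in> U" for z
    using that U contx Suc.prems
    by (intro fixpt_has_derivative[OF U that M Suc.prems(1)] has_derivative_dird)
      (auto simp: C_on_Suc continuous_on_eq_continuous_at)
  have "C_on n U (dird v x)" for v
  proof (rule Suc.IH[of _ "\<lambda>z. dird v c z + P (dird v M z) (x z)"])
    show "dird v x z = dird v c z + P (dird v M z) (x z) + P (M z) (dird v x z)" if "z \<in> U" for z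
      unfolding dird_eq[OF d[OF that]] by (rule fixpt_eq[OF M[OF that]])
    show "C_on n U (\<lambda>z. dird v c z + P (dird v M z) (x z))"
      using Suc.prems U xn
      by (intro C_on_add[OF U] C_on_bilinear[OF U bil]) (auto simp: C_on_Suc)
    show "C_on n U M" by (rule cn)
  qed
  then show ?case using d U by (auto simp: C_on_Suc intro: differentiableI)
qed

end

section \<open>Curves over the unit interval and flat linear systems\<close>

definition clip :: "real \<Rightarrow> real" where "clip t = max 0 (min 1 t)"

lemma clip_bounds [simp]: "0 \<le> clip t" "clip t \<le> 1" and clip_id: "0 \<le> t \<Longrightarrow> t \<le> 1 \<Longrightarrow> clip t = t"
  by (auto simp: clip_def)

lemma continuous_clip: "continuous_on UNIV clip"
  unfolding clip_def[abs_def] by (intro continuous_intros)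

text \<open>Curves over the unit interval are made into elements of the Banach space of bounded continuous
  functions on the whole line by precomposing with \<open>clip\<close>.\<close>

definition curve :: "(real \<Rightarrow> 'b::real_normed_vector) \<Rightarrow> (real \<Rightarrow>\<^sub>C 'b)" where
  "curve f = Bcontfun (\<lambda>t. f (clip t))"

lemma curve_apply:
  assumes "continuous_on {0..1} f"
  shows "apply_bcontfun (curve f) t = f (clip t)"
proof -
  have "(\<lambda>t. f (clip t)) \<in> bcontfun"
    unfolding bcontfun_def
  proof (intro CollectI conjI)
    show "continuous_on UNIV (\<lambda>t. f (clip t))"
      by (rule continuous_on_compose2[OF assms continuous_clip]) auto
    have "range (\<lambda>t. f (clip t)) \<subseteq> f ` {0..1}" by auto
    then show "bounded (range (\<lambda>t. f (clip t)))"
      using compact_imp_bounded[OF compact_continuous_image[OF assms compact_Icc]] bounded_subset by blast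
  qed
  then show ?thesis by (simp add: curve_def Bcontfun_inverse)
qed

lemma norm_curve_le:
  assumes "continuous_on {0..1} f" "\<And>t. 0 \<le> t \<Longrightarrow> t \<le> 1 \<Longrightarrow> norm (f t) \<le> K"
  shows "norm (curve f) \<le> K"
  by (rule norm_bound) (simp add: curve_apply[OF assms(1)] assms(2))

lemma ray_in_ball: "z \<in> ball 0 r \<Longrightarrow> 0 \<le> t \<Longrightarrow> t \<le> 1 \<Longrightarrow> p + t *\<^sub>R z \<in> ball p r"
  for z p :: "'a::real_normed_vector"
  using mult_mono[of t 1 "norm z" "norm z"] by (simp add: dist_norm)

lemma continuous_on_ray:
  fixes h :: "'a::real_normed_vector \<Rightarrow> 'b::real_normed_vector"
  assumes "continuous_on (ball p r) h" "z \<in> ball 0 r"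
  shows "continuous_on {0..1} (\<lambda>t. h (p + t *\<^sub>R z))"
  by (rule continuous_on_compose2[OF assms(1)]) (use assms(2) ray_in_ball in \<open>auto intro!: continuous_intros\<close>)

text \<open>Restriction to rays is continuous in the end point, because continuous functions are uniformly
  continuous on closed balls.\<close>

lemma continuous_on_ray_curve:
  fixes h :: "'a::euclidean_space \<Rightarrow> 'b::real_normed_vector"
  assumes h: "continuous_on (ball p r) h"
  shows "continuous_on (ball 0 r) (\<lambda>z. curve (\<lambda>t. h (p + t *\<^sub>R z)))"
  unfolding continuous_on_iff
proof (intro ballI allI impI)
  fix z :: 'a and e :: real assume z: "z \<in> ball 0 r" and e: "0 < e"
  obtain r' where r': "norm z < r'" "r' < r" using z dense by auto
  have "uniformly_continuous_on (cball p r') h"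
    by (rule compact_uniformly_continuous[OF continuous_on_subset[OF h]]) (use r' in auto)
  then obtain d where d: "d > 0" "\<And>x y. x \<in> cball p r' \<Longrightarrow> y \<in> cball p r' \<Longrightarrow> dist y x < d \<Longrightarrow> dist (h y) (h x) < e / 2"
    unfolding uniformly_continuous_on_def using e by (metis half_gt_zero)
  show "\<exists>d>0. \<forall>x'\<in>ball 0 r. dist x' z < d \<longrightarrow>
      dist (curve (\<lambda>t. h (p + t *\<^sub>R x'))) (curve (\<lambda>t. h (p + t *\<^sub>R z))) < e"
  proof (intro exI[of _ "min d (r' - norm z)"] conjI ballI impI)
    fix y assume y: "y \<in> ball 0 r" "dist y z < min d (r' - norm z)"
    have ny: "norm y < r'" using y(2) norm_triangle_ineq[of z "y - z"] by (simp add: dist_norm)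
    have "dist (curve (\<lambda>t. h (p + t *\<^sub>R y))) (curve (\<lambda>t. h (p + t *\<^sub>R z))) \<le> e / 2"
    proof (rule dist_bound)
      fix t
      have "dist (h (p + clip t *\<^sub>R y)) (h (p + clip t *\<^sub>R z)) < e / 2"
      proof (rule d(2))
        show "p + clip t *\<^sub>R z \<in> cball p r'" "p + clip t *\<^sub>R y \<in> cball p r'"
          using mult_mono[of "clip t" 1 "norm z" r'] mult_mono[of "clip t" 1 "norm y" r'] r' ny
          by (simp_all add: dist_norm)
        have "dist (p + clip t *\<^sub>R y) (p + clip t *\<^sub>R z) = clip t * dist y z"
          by (simp add: dist_norm flip: scaleR_diff_right)
        also have "\<dots> \<le> 1 * dist y z" by (intro mult_right_mono) auto
        finally show "dist (p + clip t *\<^sub>R y) (p + clip t *\<^sub>R z) < d" using y(2) by simp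
      qed
      then show "dist (apply_bcontfun (curve (\<lambda>t. h (p + t *\<^sub>R y))) t) (apply_bcontfun (curve (\<lambda>t. h (p + t *\<^sub>R z))) t) \<le> e / 2"
        using y(1) z by (simp add: curve_apply continuous_on_ray[OF h])
    qed
    then show "dist (curve (\<lambda>t. h (p + t *\<^sub>R y))) (curve (\<lambda>t. h (p + t *\<^sub>R z))) < e" using e by simp
  qed (use d r' in auto)
qed

text \<open>The mean value inequality is applied for each \<open>t\<close> separately; the estimate is uniform in \<open>t\<close> because \<open>Dh\<close>,
  restricted to rays, depends continuously on the end point.\<close>

lemma ray_curve_has_derivative:
  fixes h :: "'a::euclidean_space \<Rightarrow> 'b::real_normed_vector"
  assumes h: "C_on (Suc 0) (ball p r) h" and z: "z \<in> ball 0 r"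
  shows "((\<lambda>z. curve (\<lambda>t. h (p + t *\<^sub>R z))) has_derivative
     (\<lambda>v. curve (\<lambda>t. t *\<^sub>R dird v h (p + t *\<^sub>R z)))) (at z)"
proof -
  have dh: "h differentiable (at x)" if "x \<in> ball p r" for x using h that by (simp add: C_on_Suc)
  have ch: "continuous_on (ball p r) h"
    using dh by (auto intro!: differentiable_imp_continuous_on differentiable_at_imp_differentiable_on)
  have cd: "continuous_on (ball p r) (dird v h)" for v using h by (simp add: C_on_Suc)
  define h' where "h' x = Blinfun (\<lambda>v. dird v h x)" for x
  have h': "blinfun_apply (h' x) v = dird v h x" if "x \<in> ball p r" for x v
    unfolding h'_def by (rule blinfun_dird[OF dh[OF that]])
  have ch': "continuous_on (ball p r) h'"
  proof (rule continuous_on_blinfun_componentwise)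
    show "continuous_on (ball p r) (\<lambda>x. blinfun_apply (h' x) i)" for i
      by (rule continuous_on_eq[OF cd[of i]]) (simp only: h')
  qed
  have cc: "continuous_on {0..1} (\<lambda>t. t *\<^sub>R dird v h (p + t *\<^sub>R z))" for v
    by (intro continuous_on_scaleR continuous_on_id continuous_on_ray[OF cd z])
  let ?D = "\<lambda>v. curve (\<lambda>t. t *\<^sub>R dird v h (p + t *\<^sub>R z))"
  have inb: "p + clip t *\<^sub>R x \<in> ball p r" if "x \<in> ball 0 r" for t x by (rule ray_in_ball[OF that]) auto
  have lin: "linear ?D"
  proof
    fix v w :: 'a and a :: real
    show "?D (v + w) = ?D v + ?D w"
      by (rule bcontfun_eqI)
        (simp add: curve_apply[OF cc] plus_bcontfun.rep_eq linear_add[OF dird_lin[OF dh[OF inb[OF z]]]] scaleR_add_right)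
    show "?D (a *\<^sub>R v) = a *\<^sub>R ?D v"
      by (rule bcontfun_eqI)
        (simp add: curve_apply[OF cc] scaleR_bcontfun.rep_eq linear_scale[OF dird_lin[OF dh[OF inb[OF z]]]])
  qed
  show ?thesis
    unfolding has_derivative_at_alt
  proof (intro conjI allI impI)
    show "bounded_linear ?D" using lin by (simp add: linear_conv_bounded_linear)
    fix e :: real assume e: "0 < e"
    obtain d where d: "d > 0" "\<And>y. y \<in> ball 0 r \<Longrightarrow> dist y z < d \<Longrightarrow>
        dist (curve (\<lambda>t. h' (p + t *\<^sub>R y))) (curve (\<lambda>t. h' (p + t *\<^sub>R z))) < e"
      using continuous_on_ray_curve[OF ch'] z e unfolding continuous_on_iff by metis
    obtain d' where d': "d' > 0" "ball z d' \<subseteq> ball 0 r" using z open_ball open_contains_ball by metis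
    define \<delta> where "\<delta> = min d d'"
    have h'close: "norm (h' (p + clip t *\<^sub>R y) - h' (p + clip t *\<^sub>R z)) \<le> e" if "y \<in> ball z \<delta>" for y t
    proof -
      have "y \<in> ball z d'" "dist y z < d" using that by (auto simp: \<delta>_def dist_commute)
      then have y: "y \<in> ball 0 r" "dist y z < d" using d'(2) by blast+
      have "dist (apply_bcontfun (curve (\<lambda>t. h' (p + t *\<^sub>R y))) t) (apply_bcontfun (curve (\<lambda>t. h' (p + t *\<^sub>R z))) t)
        \<le> dist (curve (\<lambda>t. h' (p + t *\<^sub>R y))) (curve (\<lambda>t. h' (p + t *\<^sub>R z)))" by (rule dist_bounded)
      also have "\<dots> < e" by (rule d(2)[OF y])
      finally show ?thesis using y(1) z by (simp add: curve_apply continuous_on_ray[OF ch'] dist_norm)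
    qed
    show "\<exists>d>0. \<forall>y. norm (y - z) < d \<longrightarrow>
      norm (curve (\<lambda>t. h (p + t *\<^sub>R y)) - curve (\<lambda>t. h (p + t *\<^sub>R z)) - ?D (y - z)) \<le> e * norm (y - z)"
    proof (intro exI[of _ \<delta>] conjI allI impI)
      show "0 < \<delta>" using d d' by (simp add: \<delta>_def)
      fix y assume "norm (y - z) < \<delta>"
      then have y: "y \<in> ball z \<delta>" by (simp add: dist_norm norm_minus_commute)
      have sub: "ball z \<delta> \<subseteq> ball 0 r" using d' by (auto simp: \<delta>_def)
      show "norm (curve (\<lambda>t. h (p + t *\<^sub>R y)) - curve (\<lambda>t. h (p + t *\<^sub>R z)) - ?D (y - z)) \<le> e * norm (y - z)"
      proof (rule norm_bound)
        fix t
        let ?k' = "\<lambda>x v. clip t *\<^sub>R blinfun_apply (h' (p + clip t *\<^sub>R x)) v"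
        have "norm (h (p + clip t *\<^sub>R y) - h (p + clip t *\<^sub>R z) - ?k' z (y - z)) \<le> norm (y - z) * e"
        proof (rule differentiable_bound_linearization[where S = "ball z \<delta>" and f' = ?k' and ?x0.0 = z
              and f = "\<lambda>x. h (p + clip t *\<^sub>R x)" and a = z and b = y])
          show "z + s *\<^sub>R (y - z) \<in> ball z \<delta>" if "s \<in> {0..1}" for s
            using y that mult_right_mono[of s 1 "norm (y - z)"]
            by (auto simp: dist_norm norm_minus_commute)
          show "z \<in> ball z \<delta>" using d d' by (simp add: \<delta>_def)
          show "((\<lambda>x. h (p + clip t *\<^sub>R x)) has_derivative ?k' x) (at x within ball z \<delta>)" if "x \<in> ball z \<delta>" for x
          proof -
            have xin: "p + clip t *\<^sub>R x \<in> ball p r" using inb that sub by blast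
            have "((\<lambda>x. h (p + clip t *\<^sub>R x)) has_derivative (\<lambda>v. dird (clip t *\<^sub>R v) h (p + clip t *\<^sub>R x))) (at x)"
              by (rule has_derivative_compose[of "\<lambda>x. p + clip t *\<^sub>R x" "\<lambda>v. clip t *\<^sub>R v", OF _ has_derivative_dird[OF dh[OF xin]]])
                (auto intro!: derivative_eq_intros)
            moreover have "(\<lambda>v. dird (clip t *\<^sub>R v) h (p + clip t *\<^sub>R x)) = ?k' x"
              by (simp add: fun_eq_iff h'[OF xin] linear_scale[OF dird_lin[OF dh[OF xin]]])
            ultimately show ?thesis by (simp add: has_derivative_at_withinI)
          qed
          show "onorm (?k' x - ?k' z) \<le> e" if x: "x \<in> ball z \<delta>" for x
            unfolding fun_diff_def
          proof (rule onorm_bound)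
            fix v
            have "norm (?k' x v - ?k' z v) = clip t * norm (blinfun_apply (h' (p + clip t *\<^sub>R x) - h' (p + clip t *\<^sub>R z)) v)"
              by (simp add: blinfun.diff_left flip: scaleR_diff_right)
            also have "\<dots> \<le> 1 * (norm (h' (p + clip t *\<^sub>R x) - h' (p + clip t *\<^sub>R z)) * norm v)"
              by (intro mult_mono norm_blinfun) auto
            also have "\<dots> \<le> e * norm v" using h'close[OF x] by (simp add: mult_right_mono)
            finally show "norm (?k' x v - ?k' z v) \<le> e * norm v" .
          qed (use e in simp)
        qed
        then show "norm (apply_bcontfun (curve (\<lambda>t. h (p + t *\<^sub>R y)) - curve (\<lambda>t. h (p + t *\<^sub>R z)) - ?D (y - z)) t) \<le> e * norm (y - z)"
          using y sub z
          by (auto simp: minus_bcontfun.rep_eq curve_apply[OF cc] curve_apply[OF continuous_on_ray[OF ch]] h'[OF inb[OF z]] mult.commute)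
      qed
    qed
  qed
qed

lemma bounded_linear_curve_scale:
  "bounded_linear (\<lambda>x :: real \<Rightarrow>\<^sub>C 'b::real_normed_vector. curve (\<lambda>t. t *\<^sub>R apply_bcontfun x t))"
proof
  have c: "continuous_on {0..1} (\<lambda>t. t *\<^sub>R apply_bcontfun x t)" for x :: "real \<Rightarrow>\<^sub>C 'b"
    by (intro continuous_intros continuous_on_apply_bcontfun)
  fix x y :: "real \<Rightarrow>\<^sub>C 'b" and a :: real
  show "curve (\<lambda>t. t *\<^sub>R apply_bcontfun (x + y) t) = curve (\<lambda>t. t *\<^sub>R apply_bcontfun x t) + curve (\<lambda>t. t *\<^sub>R apply_bcontfun y t)"
    by (rule bcontfun_eqI) (simp only: curve_apply[OF c], simp add: plus_bcontfun.rep_eq curve_apply[OF c] scaleR_add_right)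
  show "curve (\<lambda>t. t *\<^sub>R apply_bcontfun (a *\<^sub>R x) t) = a *\<^sub>R curve (\<lambda>t. t *\<^sub>R apply_bcontfun x t)"
    by (rule bcontfun_eqI) (simp only: curve_apply[OF c], simp add: scaleR_bcontfun.rep_eq curve_apply[OF c])
  show "\<exists>K. \<forall>x :: real \<Rightarrow>\<^sub>C 'b. norm (curve (\<lambda>t. t *\<^sub>R apply_bcontfun x t)) \<le> norm x * K"
  proof (intro exI[of _ 1] allI)
    fix x :: "real \<Rightarrow>\<^sub>C 'b"
    show "norm (curve (\<lambda>t. t *\<^sub>R apply_bcontfun x t)) \<le> norm x * 1"
    proof (rule norm_curve_le[OF c])
      fix t :: real assume "0 \<le> t" "t \<le> 1"
      then show "norm (t *\<^sub>R apply_bcontfun x t) \<le> norm x * 1"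
        using mult_mono[of t 1 "norm (apply_bcontfun x t)" "norm x"] norm_bounded[of x t] by simp
    qed
  qed
qed

text \<open>Each differentiation with respect to the end point brings out a factor \<open>t\<close>, and multiplication by \<open>t\<close> is a
  bounded linear operator on curves.\<close>

lemma C_on_ray_curve:
  fixes h :: "'a::euclidean_space \<Rightarrow> 'b::real_normed_vector"
  assumes "C_on n (ball p r) h"
  shows "C_on n (ball 0 r) (\<lambda>z. curve (\<lambda>t. h (p + t *\<^sub>R z)))"
  using assms
proof (induction n arbitrary: h)
  case 0
  then show ?case using continuous_on_ray_curve by simp
next
  case (Suc n)
  have h1: "C_on (Suc 0) (ball p r) h" using Suc.prems
  proof (induction n)
    case (Suc n)
    then show ?case using C_on_Suc_imp[OF open_ball] by blast
  qed
  note d = ray_curve_has_derivative[OF h1]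
  have "C_on n (ball 0 r) (dird v (\<lambda>z. curve (\<lambda>t. h (p + t *\<^sub>R z))))" for v
  proof (rule C_on_cong[OF open_ball])
    show "curve (\<lambda>t. t *\<^sub>R apply_bcontfun (curve (\<lambda>t. dird v h (p + t *\<^sub>R z))) t) = dird v (\<lambda>z. curve (\<lambda>t. h (p + t *\<^sub>R z))) z"
      if "z \<in> ball 0 r" for z
    proof -
      have "continuous_on (ball p r) (dird v h)" using h1 by (simp add: C_on_Suc)
      then have "curve (\<lambda>t. t *\<^sub>R apply_bcontfun (curve (\<lambda>t. dird v h (p + t *\<^sub>R z))) t) = curve (\<lambda>t. t *\<^sub>R dird v h (p + t *\<^sub>R z))"
        unfolding curve_def[of "\<lambda>t. t *\<^sub>R _ t"]
        by (simp add: curve_apply continuous_on_ray[OF _ that] clip_id)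
      then show ?thesis using dird_eq[OF d[OF that]] by simp
    qed
    show "C_on n (ball 0 r) (\<lambda>z. curve (\<lambda>t. t *\<^sub>R apply_bcontfun (curve (\<lambda>t. dird v h (p + t *\<^sub>R z))) t))"
      by (rule C_on_linear[OF open_ball bounded_linear_curve_scale], rule Suc.IH)
        (use Suc.prems in \<open>simp add: C_on_Suc\<close>)
  qed
  then show ?case using differentiableI[OF d] by (simp add: C_on_Suc)
qed

definition curve_integral :: "(real \<Rightarrow>\<^sub>C ('b::banach \<Rightarrow>\<^sub>L 'b)) \<Rightarrow> (real \<Rightarrow>\<^sub>C 'b) \<Rightarrow> (real \<Rightarrow>\<^sub>C 'b)" where
  "curve_integral m x = curve (\<lambda>t. integral {0..t} (\<lambda>s. blinfun_apply (apply_bcontfun m s) (apply_bcontfun x s)))"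

lemma continuous_on_blinfun_curve:
  "continuous_on T (\<lambda>s. blinfun_apply (apply_bcontfun m s) (apply_bcontfun x s))"
  by (intro bounded_bilinear.continuous_on[OF bounded_bilinear_blinfun_apply] continuous_on_apply_bcontfun)

lemma integrable_blinfun_curve:
  fixes m :: "real \<Rightarrow>\<^sub>C ('b::banach \<Rightarrow>\<^sub>L 'b)"
  shows "(\<lambda>s. blinfun_apply (apply_bcontfun m s) (apply_bcontfun x s)) integrable_on {a..b}"
  by (rule integrable_continuous_interval[OF continuous_on_blinfun_curve])

lemma curve_integral_apply:
  "apply_bcontfun (curve_integral m x) t =
    integral {0..clip t} (\<lambda>s. blinfun_apply (apply_bcontfun m s) (apply_bcontfun x s))"
  unfolding curve_integral_def
  by (rule curve_apply[OF indefinite_integral_continuous_1[OF integrable_blinfun_curve]])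

lemma norm_curve_integral: "norm (curve_integral m x) \<le> norm m * norm x"
proof (rule norm_bound)
  fix t
  have "norm (integral {0..clip t} (\<lambda>s. blinfun_apply (apply_bcontfun m s) (apply_bcontfun x s))) \<le> norm m * norm x * (clip t - 0)"
  proof (rule integral_bound)
    fix s
    have "norm (blinfun_apply (apply_bcontfun m s) (apply_bcontfun x s)) \<le> norm (apply_bcontfun m s) * norm (apply_bcontfun x s)"
      by (rule norm_blinfun)
    also have "\<dots> \<le> norm m * norm x" by (intro mult_mono norm_bounded) auto
    finally show "norm (blinfun_apply (apply_bcontfun m s) (apply_bcontfun x s)) \<le> norm m * norm x" .
  qed (auto intro: continuous_on_blinfun_curve)
  also have "\<dots> \<le> norm m * norm x * 1" by (intro mult_left_mono) auto
  finally show "norm (apply_bcontfun (curve_integral m x) t) \<le> norm m * norm x"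
    by (simp add: curve_integral_apply)
qed

lemma bounded_bilinear_curve_integral:
  "bounded_bilinear (curve_integral :: (real \<Rightarrow>\<^sub>C ('b::banach \<Rightarrow>\<^sub>L 'b)) \<Rightarrow> _)"
proof
  fix m m' :: "real \<Rightarrow>\<^sub>C ('b \<Rightarrow>\<^sub>L 'b)" and x x' :: "real \<Rightarrow>\<^sub>C 'b" and r :: real
  show "curve_integral (m + m') x = curve_integral m x + curve_integral m' x"
    by (rule bcontfun_eqI)
      (simp add: curve_integral_apply plus_bcontfun.rep_eq blinfun.add_left integral_add integrable_blinfun_curve)
  show "curve_integral m (x + x') = curve_integral m x + curve_integral m x'"
    by (rule bcontfun_eqI)
      (simp add: curve_integral_apply plus_bcontfun.rep_eq blinfun.add_right integral_add integrable_blinfun_curve)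
  show "curve_integral (r *\<^sub>R m) x = r *\<^sub>R curve_integral m x"
    by (rule bcontfun_eqI) (simp add: curve_integral_apply scaleR_bcontfun.rep_eq blinfun.scaleR_left)
  show "curve_integral m (r *\<^sub>R x) = r *\<^sub>R curve_integral m x"
    by (rule bcontfun_eqI) (simp add: curve_integral_apply scaleR_bcontfun.rep_eq blinfun.scaleR_right)
  show "\<exists>K. \<forall>(m :: real \<Rightarrow>\<^sub>C ('b \<Rightarrow>\<^sub>L 'b)) x. norm (curve_integral m x) \<le> norm m * norm x * K"
    by (intro exI[of _ 1] allI) (simp add: norm_curve_integral)
qed

instance bcontfun :: (metric_space, banach) banach ..

interpretation curve_integral: linear_contraction curve_integral
  by (rule linear_contraction.intro[OF bounded_bilinear_curve_integral norm_curve_integral])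

text \<open>A linear total differential system \<open>\<partial>\<^sub>i W = A\<^sub>i W\<close> is integrated along the rays through \<open>p\<close>.
  The radial equation depends smoothly on the end point of the ray, and the derivative of its
  solution in a direction \<open>v\<close> solves the same integral equation as \<open>t A\<^sub>v W\<close>, by flatness.\<close>

theorem flat_linear_system:
  fixes A1 A2 :: "base \<Rightarrow> ('b::banach \<Rightarrow>\<^sub>L 'b)"
  assumes A: "smooth_on (ball p R) A1" "smooth_on (ball p R) A2" and R: "0 < R"
    and flat: "\<And>q w. q \<in> ball p R \<Longrightarrow>
      blinfun_apply (partial 1 A2 q) w - blinfun_apply (partial 2 A1 q) w =
      blinfun_apply (A1 q) (blinfun_apply (A2 q) w) - blinfun_apply (A2 q) (blinfun_apply (A1 q) w)"
  obtains r where "0 < r" "r \<le> R"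
    "\<And>w0. \<exists>W. smooth_on (ball p r) W \<and> W p = w0 \<and>
      (\<forall>q\<in>ball p r. partial 1 W q = blinfun_apply (A1 q) (W q) \<and> partial 2 W q = blinfun_apply (A2 q) (W q))"
proof -
  define B where "B v q = v $ 1 *\<^sub>R A1 q + v $ 2 *\<^sub>R A2 q" for v :: base and q
  have contA: "continuous_on (ball p R) A1" "continuous_on (ball p R) A2" using A smooth_on_continuous by auto
  have cb: "cball p (R/2) \<subseteq> ball p R" using R by auto
  have "bounded (A1 ` cball p (R/2))" "bounded (A2 ` cball p (R/2))"
    by (intro compact_imp_bounded compact_continuous_image continuous_on_subset[OF contA(1) cb]
        continuous_on_subset[OF contA(2) cb] compact_cball)+
  then obtain K1 K2 where K: "K1 > 0" "K2 > 0" "\<And>q. q \<in> cball p (R/2) \<Longrightarrow> norm (A1 q) \<le> K1"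
      "\<And>q. q \<in> cball p (R/2) \<Longrightarrow> norm (A2 q) \<le> K2"
    unfolding bounded_pos by auto
  \<comment> \<open>small enough for the coefficient along a ray to have norm at most \<open>1/2\<close>, see \<open>M_small\<close>\<close>
  define r where "r = min (R/2) (1 / (2 * (K1 + K2)))"
  have r: "0 < r" "r \<le> R/2" "r * (K1 + K2) \<le> 1/2"
  proof -
    show "0 < r" "r \<le> R/2" using R K by (auto simp: r_def)
    have "r * (K1 + K2) \<le> 1 / (2 * (K1 + K2)) * (K1 + K2)"
      using K by (intro mult_right_mono) (auto simp: r_def)
    moreover have "1 / (2 * k) * k = 1/2" if "k > 0" for k :: real using that by simp
    ultimately show "r * (K1 + K2) \<le> 1/2" using K by (metis add_pos_pos)
  qed
  have rR: "r \<le> R" using r R by simp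
  have sub: "ball p r \<subseteq> ball p R" using rR by auto
  note Ar = smooth_on_subset[OF A(1) open_ball sub] smooth_on_subset[OF A(2) open_ball sub]
  note contAr = smooth_on_continuous[OF Ar(1)] smooth_on_continuous[OF Ar(2)]
  define M where "M z = z $ 1 *\<^sub>R curve (\<lambda>t. A1 (p + t *\<^sub>R z)) + z $ 2 *\<^sub>R curve (\<lambda>t. A2 (p + t *\<^sub>R z))" for z :: base
  have M_apply: "apply_bcontfun (M z) t = B z (p + clip t *\<^sub>R z)" if "z \<in> ball 0 r" for z t
    by (simp add: M_def B_def plus_bcontfun.rep_eq scaleR_bcontfun.rep_eq
        curve_apply[OF continuous_on_ray[OF contAr(1) that]] curve_apply[OF continuous_on_ray[OF contAr(2) that]])
  have M_smooth: "C_on n (ball 0 r) M" for n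
    unfolding M_def[abs_def]
    by (intro C_on_add C_on_bilinear[OF _ bounded_bilinear_scaleR] C_on_ray_curve
        C_on_linear[OF _ bounded_linear_vec_nth] smooth_onD Ar smooth_on_ident open_ball)
  have M_small: "norm (M z) \<le> 1/2" if z: "z \<in> ball 0 r" for z
  proof (rule norm_bound)
    fix t
    have q: "p + clip t *\<^sub>R z \<in> cball p (R/2)"
      using ray_in_ball[OF z, of "clip t" p] r by auto
    have "norm (B z (p + clip t *\<^sub>R z)) \<le> \<bar>z $ 1\<bar> * norm (A1 (p + clip t *\<^sub>R z)) + \<bar>z $ 2\<bar> * norm (A2 (p + clip t *\<^sub>R z))"
      unfolding B_def by (rule order_trans[OF norm_triangle_ineq]) simp
    also have "\<dots> \<le> r * K1 + r * K2"
      using z component_le_norm_cart[of z 1] component_le_norm_cart[of z 2] K(3)[OF q] K(4)[OF q] r(1)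
      by (intro add_mono mult_mono) auto
    also have "\<dots> \<le> 1/2" using r(3) by (simp add: algebra_simps)
    finally show "norm (apply_bcontfun (M z) t) \<le> 1/2" by (simp add: M_apply[OF z])
  qed
  have "\<exists>W. smooth_on (ball p r) W \<and> W p = w0 \<and>
      (\<forall>q\<in>ball p r. partial 1 W q = blinfun_apply (A1 q) (W q) \<and> partial 2 W q = blinfun_apply (A2 q) (W q))" for w0
  proof -
    let ?c = "const_bcontfun w0 :: real \<Rightarrow>\<^sub>C 'b"
    define x where "x z = fixpt curve_integral (M z) ?c" for z
    have x: "x z = ?c + curve_integral (M z) (x z)" if "z \<in> ball 0 r" for z
      unfolding x_def by (rule curve_integral.fixpt_eq[OF M_small[OF that]])
    have x_smooth: "C_on n (ball 0 r) x" for n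
      by (rule curve_integral.C_on_fixpt[OF open_ball M_small x C_on_const M_smooth])
    have x_apply: "apply_bcontfun (x z) t = w0 + integral {0..clip t} (\<lambda>s. blinfun_apply (B z (p + clip s *\<^sub>R z)) (apply_bcontfun (x z) s))"
      if "z \<in> ball 0 r" for z t
      by (subst x[OF that]) (simp add: plus_bcontfun.rep_eq const_bcontfun.rep_eq curve_integral_apply M_apply[OF that])
    have dx: "dird v x z = curve (\<lambda>t. t *\<^sub>R blinfun_apply (B v (p + t *\<^sub>R z)) (apply_bcontfun (x z) t))"
      if z: "z \<in> ball 0 r" for v z
    proof -
      have diffx: "x differentiable (at z)" using x_smooth[of "Suc 0"] z by (simp add: C_on_Suc)
      have diffM: "M differentiable (at z)" using M_smooth[of "Suc 0"] z by (simp add: C_on_Suc)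
      define X where "X t = apply_bcontfun (x z) t" for t
      have cB: "continuous_on {0..1} (\<lambda>t. B v (p + t *\<^sub>R z))" for v
        unfolding B_def by (intro continuous_on_add continuous_on_scaleR continuous_on_const continuous_on_ray[OF _ z] contAr)
      \<comment> \<open>the expected derivative of the solution in the direction \<open>v\<close>\<close>
      define Y where "Y t = t *\<^sub>R blinfun_apply (B v (p + t *\<^sub>R z)) (X t)" for t
      have cX: "continuous_on T X" for T unfolding X_def by (rule continuous_on_apply_bcontfun)
      have cY: "continuous_on {0..1} Y" unfolding Y_def
        by (intro continuous_on_scaleR continuous_on_id bounded_bilinear.continuous_on[OF bounded_bilinear_blinfun_apply] cB cX)
      have inb: "p + t *\<^sub>R z \<in> ball p r" if "0 \<le> t" "t \<le> 1" for t by (rule ray_in_ball[OF z that])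
      have diffA: "A1 differentiable (at (p + t *\<^sub>R z))" "A2 differentiable (at (p + t *\<^sub>R z))" if "0 \<le> t" "t \<le> 1" for t
        using smooth_on_differentiable[OF Ar(1) inb[OF that]] smooth_on_differentiable[OF Ar(2) inb[OF that]] by auto
      \<comment> \<open>the derivative of the coefficient along the ray\<close>
      define DM where "DM t = B v (p + t *\<^sub>R z) + t *\<^sub>R (z $ 1 *\<^sub>R dird v A1 (p + t *\<^sub>R z) + z $ 2 *\<^sub>R dird v A2 (p + t *\<^sub>R z))" for t
      have dM: "apply_bcontfun (dird v M z) t = DM (clip t)" for t
      proof -
        have d1: "((\<lambda>z. curve (\<lambda>t. A1 (p + t *\<^sub>R z))) has_derivative (\<lambda>v. curve (\<lambda>t. t *\<^sub>R dird v A1 (p + t *\<^sub>R z)))) (at z)"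
          "((\<lambda>z. curve (\<lambda>t. A2 (p + t *\<^sub>R z))) has_derivative (\<lambda>v. curve (\<lambda>t. t *\<^sub>R dird v A2 (p + t *\<^sub>R z)))) (at z)"
          by (rule ray_curve_has_derivative[OF smooth_onD[OF Ar(1)] z] ray_curve_has_derivative[OF smooth_onD[OF Ar(2)] z])+
        have "(M has_derivative (\<lambda>v. (z $ 1 *\<^sub>R curve (\<lambda>t. t *\<^sub>R dird v A1 (p + t *\<^sub>R z)) + v $ 1 *\<^sub>R curve (\<lambda>t. A1 (p + t *\<^sub>R z)))
            + (z $ 2 *\<^sub>R curve (\<lambda>t. t *\<^sub>R dird v A2 (p + t *\<^sub>R z)) + v $ 2 *\<^sub>R curve (\<lambda>t. A2 (p + t *\<^sub>R z))))) (at z)"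
          unfolding M_def[abs_def]
          by (intro has_derivative_add has_derivative_scaleR d1 bounded_linear_imp_has_derivative bounded_linear_vec_nth)
        then have "dird v M z = (z $ 1 *\<^sub>R curve (\<lambda>t. t *\<^sub>R dird v A1 (p + t *\<^sub>R z)) + v $ 1 *\<^sub>R curve (\<lambda>t. A1 (p + t *\<^sub>R z)))
            + (z $ 2 *\<^sub>R curve (\<lambda>t. t *\<^sub>R dird v A2 (p + t *\<^sub>R z)) + v $ 2 *\<^sub>R curve (\<lambda>t. A2 (p + t *\<^sub>R z)))"
          by (rule dird_eq)
        moreover have "continuous_on {0..1} (\<lambda>t. t *\<^sub>R dird v A1 (p + t *\<^sub>R z))" "continuous_on {0..1} (\<lambda>t. t *\<^sub>R dird v A2 (p + t *\<^sub>R z))"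
          by (intro continuous_on_scaleR continuous_on_id continuous_on_ray[OF _ z] smooth_on_continuous smooth_on_dird Ar)+
        ultimately show ?thesis
          by (simp add: DM_def B_def plus_bcontfun.rep_eq scaleR_bcontfun.rep_eq curve_apply
              continuous_on_ray[OF contAr(1) z] continuous_on_ray[OF contAr(2) z] algebra_simps)
      qed
      have dX: "(X has_vector_derivative blinfun_apply (B z (p + t *\<^sub>R z)) (X t)) (at t within {0..1})" if t: "t \<in> {0..1}" for t
      proof -
        let ?g = "\<lambda>s. blinfun_apply (B z (p + clip s *\<^sub>R z)) (X s)"
        have cg: "continuous_on {0..1} ?g"
          using continuous_on_blinfun_curve[of "{0..1}" "M z" "x z"] by (simp add: M_apply[OF z] X_def)
        have "((\<lambda>t. w0 + integral {0..t} ?g) has_vector_derivative 0 + ?g t) (at t within {0..1})"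
          by (intro has_vector_derivative_add has_vector_derivative_const integral_has_vector_derivative[OF cg t])
        then show ?thesis
        proof (rule has_vector_derivative_transform[rotated 2, THEN has_vector_derivative_eq_rhs])
          show "0 + ?g t = blinfun_apply (B z (p + t *\<^sub>R z)) (X t)" using t by (simp add: clip_id)
          show "X s = w0 + integral {0..s} ?g" if "s \<in> {0..1}" for s
            using that unfolding X_def by (subst x_apply[OF z]) (simp add: clip_id)
        qed (use t in auto)
      qed
      define DB where "DB t = v $ 1 *\<^sub>R dird z A1 (p + t *\<^sub>R z) + v $ 2 *\<^sub>R dird z A2 (p + t *\<^sub>R z)" for t
      have dB: "((\<lambda>t. B v (p + t *\<^sub>R z)) has_vector_derivative DB t) (at t within {0..1})" if t: "t \<in> {0..1}" for t
      proof -
        have "((\<lambda>t. h (p + t *\<^sub>R z)) has_vector_derivative dird z h (p + t *\<^sub>R z)) (at t within {0..1})"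
          if "h differentiable (at (p + t *\<^sub>R z))" for h :: "base \<Rightarrow> 'b \<Rightarrow>\<^sub>L 'b"
        proof -
          have "((\<lambda>t. h (p + t *\<^sub>R z)) has_derivative (\<lambda>s. dird (s *\<^sub>R z) h (p + t *\<^sub>R z))) (at t within {0..1})"
            by (rule has_derivative_compose[of "\<lambda>t. p + t *\<^sub>R z" "\<lambda>s. s *\<^sub>R z", OF _ has_derivative_dird[OF that]])
              (auto intro!: derivative_eq_intros)
          then show ?thesis
            by (simp add: has_vector_derivative_def linear_scale[OF dird_lin[OF that]])
        qed
        then show ?thesis unfolding B_def DB_def using diffA t
          by (intro has_vector_derivative_add has_vector_derivative_scaleR[OF DERIV_const, THEN has_vector_derivative_eq_rhs]) auto
      qed
      \<comment> \<open>\<open>G\<close> is the integrand for the differentiated integral equation; that it is the derivative of \<open>Y\<close> is flatness\<close>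
      define G where "G t = blinfun_apply (DM t) (X t) + blinfun_apply (B z (p + t *\<^sub>R z)) (Y t)" for t
      have dY: "(Y has_vector_derivative G t) (at t within {0..1})" if t: "t \<in> {0..1}" for t
      proof -
        let ?q = "p + t *\<^sub>R z"
        have q: "?q \<in> ball p R" by (rule subsetD[OF sub inb]) (use t in auto)
        have "((\<lambda>t. blinfun_apply (B v (p + t *\<^sub>R z)) (X t)) has_vector_derivative
            blinfun_apply (B v ?q) (blinfun_apply (B z ?q) (X t)) + blinfun_apply (DB t) (X t)) (at t within {0..1})"
          by (rule bounded_bilinear.has_vector_derivative[OF bounded_bilinear_blinfun_apply dB[OF t] dX[OF t]])
        then have "(Y has_vector_derivative t *\<^sub>R (blinfun_apply (B v ?q) (blinfun_apply (B z ?q) (X t)) + blinfun_apply (DB t) (X t))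
            + 1 *\<^sub>R blinfun_apply (B v ?q) (X t)) (at t within {0..1})"
          unfolding Y_def by (intro has_vector_derivative_scaleR DERIV_ident)
        moreover have "G t = t *\<^sub>R (blinfun_apply (B v ?q) (blinfun_apply (B z ?q) (X t)) + blinfun_apply (DB t) (X t))
            + 1 *\<^sub>R blinfun_apply (B v ?q) (X t)"
        proof -
          let ?a = "blinfun_apply (A1 ?q)" and ?b = "blinfun_apply (A2 ?q)"
          note dd = dird_base[OF diffA(1)] dird_base[OF diffA(2)]
          have fl: "blinfun_apply (partial 1 A2 ?q) (X t) = blinfun_apply (partial 2 A1 ?q) (X t) + (?a (?b (X t)) - ?b (?a (X t)))"
            using flat[OF q, of "X t"] by (simp add: algebra_simps)
          show ?thesis
            using t unfolding G_def DM_def Y_def B_def DB_def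
            by (simp add: dd blinfun.add_left blinfun.scaleR_left blinfun.add_right blinfun.scaleR_right fl
                scaleR_add_right scaleR_diff_right)
              (simp add: algebra_simps)
        qed
        ultimately show ?thesis by simp
      qed
      have Yint: "Y t = integral {0..t} G" if t: "0 \<le> t" "t \<le> 1" for t
      proof -
        have "(G has_integral (Y t - Y 0)) {0..t}"
          by (rule fundamental_theorem_of_calculus[OF t(1)])
            (use t in \<open>auto intro!: has_vector_derivative_within_subset[OF dY]\<close>)
        then show ?thesis by (simp add: integral_unique Y_def)
      qed
      have "curve Y = 0 + curve_integral (dird v M z) (x z) + curve_integral (M z) (curve Y)"
      proof (rule bcontfun_eqI)
        fix t
        have "apply_bcontfun (0 + curve_integral (dird v M z) (x z) + curve_integral (M z) (curve Y)) t
          = integral {0..clip t} (\<lambda>s. blinfun_apply (apply_bcontfun (dird v M z) s) (apply_bcontfun (x z) s) +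
              blinfun_apply (apply_bcontfun (M z) s) (apply_bcontfun (curve Y) s))"
          by (simp add: plus_bcontfun.rep_eq zero_bcontfun.rep_eq curve_integral_apply integral_add integrable_blinfun_curve)
        also have "\<dots> = integral {0..clip t} G"
          by (rule integral_cong)
            (use clip_id[OF _ order_trans[OF _ clip_bounds(2)]] in \<open>auto simp: dM M_apply[OF z] curve_apply[OF cY] G_def X_def\<close>)
        also have "\<dots> = apply_bcontfun (curve Y) t" by (simp add: Yint curve_apply[OF cY])
        finally show "apply_bcontfun (curve Y) t = apply_bcontfun (0 + curve_integral (dird v M z) (x z) + curve_integral (M z) (curve Y)) t" ..
      qed
      then have fixY: "curve Y = fixpt curve_integral (M z) (0 + curve_integral (dird v M z) (x z))"
        by (rule curve_integral.fixpt_unique[OF M_small[OF z]])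
      have "isCont x z" using diffx differentiable_imp_continuous_within by blast
      then have D: "(x has_derivative (\<lambda>v. fixpt curve_integral (M z) (0 + curve_integral (dird v M z) (x z)))) (at z)"
        by (intro curve_integral.fixpt_has_derivative[OF open_ball z M_small x] has_derivative_const has_derivative_dird diffM)
      have "dird v x z = curve Y" by (rule trans[OF dird_eq[OF D] fixY[symmetric]])
      then show ?thesis unfolding Y_def[abs_def] X_def .
    qed
    define W where "W q = apply_bcontfun (x (q - p)) 1" for q
    have ev: "bounded_linear (\<lambda>x :: real \<Rightarrow>\<^sub>C 'b. apply_bcontfun x 1)"
      by (rule bounded_linear_intro[of _ 1]) (auto simp: plus_bcontfun.rep_eq scaleR_bcontfun.rep_eq norm_bounded)
    have inb: "q - p \<in> ball 0 r" if "q \<in> ball p r" for q using that by (simp add: dist_norm norm_minus_commute)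
    have xs: "smooth_on (ball 0 r) x" by (simp add: smooth_on_def x_smooth)
    have sx: "smooth_on (ball p r) (\<lambda>q. x (q - p))"
      by (rule smooth_on_compose[OF _ xs inb]) (intro smooth_on_diff smooth_on_ident smooth_on_const open_ball)
    have Ws: "smooth_on (ball p r) W"
      unfolding W_def[abs_def] by (rule smooth_on_linear[OF ev sx])
    have dW: "dird v W q = blinfun_apply (B v q) (W q)" if q: "q \<in> ball p r" for v q
    proof -
      have "(\<lambda>q. q - p) differentiable at q" by simp
      then have "dird v (\<lambda>q. x (q - p)) q = dird (dird v (\<lambda>q. q - p) q) x (q - p)"
        by (rule dird_compose) (rule smooth_on_differentiable[OF xs inb[OF q]])
      moreover have "dird v (\<lambda>q. q - p) q = v" by (rule dird_eq) (auto intro!: derivative_eq_intros)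
      ultimately have "dird v W q = apply_bcontfun (dird v x (q - p)) 1"
        unfolding W_def by (simp add: dird_linear[OF ev smooth_on_differentiable[OF sx q]])
      also have "\<dots> = blinfun_apply (B v q) (W q)"
      proof -
        have "continuous_on {0..1} (\<lambda>t. t *\<^sub>R blinfun_apply (B v (p + t *\<^sub>R (q - p))) (apply_bcontfun (x (q - p)) t))"
          unfolding B_def
          by (intro continuous_on_scaleR continuous_on_id bounded_bilinear.continuous_on[OF bounded_bilinear_blinfun_apply]
             continuous_on_add continuous_on_const continuous_on_ray[OF _ inb[OF q]] contAr continuous_on_apply_bcontfun)
        then show ?thesis by (simp add: dx[OF inb[OF q]] curve_apply W_def clip_id)
      qed
      finally show ?thesis .
    qed
    have "W p = w0" unfolding W_def using x_apply[of 0 1] r(1) by (simp add: B_def)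
    then show ?thesis using Ws dW
      by (intro exI[of _ W]) (auto simp: partial_dird B_def axis_def)
  qed
  then show ?thesis using that r(1) rR by blast
qed

section \<open>Transport of derivatives by point transformations\<close>

lemma dird_commute_vec:
  fixes h :: "'a::real_normed_vector \<Rightarrow> real^'n"
  assumes h: "smooth_on D h" and x: "x \<in> D"
  shows "dird v (dird w h) x = dird w (dird v h) x"
proof -
  have D: "open D" using h smooth_on_open by blast
  have 1: "dird v (dird w h) x $ i = dird v (dird w (\<lambda>x. h x $ i)) x" for i v w
  proof -
    have "dird v (dird w h) x $ i = dird v (\<lambda>x. dird w h x $ i) x"
      by (rule dird_nth[symmetric]) (rule smooth_on_differentiable[OF smooth_on_dird[OF h] x])
    also have "\<dots> = dird v (dird w (\<lambda>x. h x $ i)) x"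
      by (rule dird_cong[OF D x]) (simp add: dird_nth smooth_on_differentiable[OF h])
    finally show ?thesis .
  qed
  show ?thesis
    unfolding vec_eq_iff 1 using dird_commute[OF smooth_on_nth[OF h] x] by blast
qed

lemma index4_simps [simp]:
  "(0::4) \<noteq> 1" "(0::4) \<noteq> 2" "(0::4) \<noteq> 3" "(1::4) \<noteq> 0" "(2::4) \<noteq> 0" "(3::4) \<noteq> 0"
  "(1::4) \<noteq> 2" "(1::4) \<noteq> 3" "(2::4) \<noteq> 1" "(2::4) \<noteq> 3" "(3::4) \<noteq> 1" "(3::4) \<noteq> 2"
  by simp_all

lemma exhaust_index4: "(\<alpha>::4) = 0 \<or> \<alpha> = 1 \<or> \<alpha> = 2 \<or> \<alpha> = 3"
  using exhaust_4[of \<alpha>] by auto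

lemma vec4_eq_iff: "(x::real^4) = y \<longleftrightarrow> x $ 0 = y $ 0 \<and> x $ 1 = y $ 1 \<and> x $ 2 = y $ 2 \<and> x $ 3 = y $ 3"
  unfolding vec_eq_iff using exhaust_index4 by metis

lemma vec2_eq_iff: "(x::real^2) = y \<longleftrightarrow> x $ 1 = y $ 1 \<and> x $ 2 = y $ 2"
  by (simp add: vec_eq_iff forall_2)

lemma axis2_nth [simp]: "axis 1 c $ (1::2) = c" "axis 1 c $ (2::2) = 0" "axis 2 c $ (1::2) = 0" "axis 2 c $ (2::2) = c"
  by (simp_all add: axis_def)

definition vec4 :: "real \<Rightarrow> real \<Rightarrow> real \<Rightarrow> real \<Rightarrow> real^4" where
  "vec4 a b c d = (\<chi> \<alpha>. if \<alpha> = 0 then a else if \<alpha> = 1 then b else if \<alpha> = 2 then c else d)"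

lemma vec4_nth [simp]: "vec4 a b c d $ 0 = a" "vec4 a b c d $ 1 = b" "vec4 a b c d $ 2 = c" "vec4 a b c d $ 3 = d"
  by (simp_all add: vec4_def)

text \<open>The transformed fibre coordinates, as functions of the old ones and of the inverse map \<open>g\<close>: the
  arguments stand for \<open>g\<^sub>1\<close>, \<open>g\<^sub>2\<close>, \<open>g\<^sub>1\<^sub>1\<close>, \<open>g\<^sub>1\<^sub>2\<close>, \<open>g\<^sub>2\<^sub>2\<close>. The polynomial in \<open>q\<close> is multiplied out.\<close>

definition lcoef :: "real^4 \<Rightarrow> base \<Rightarrow> base \<Rightarrow> base \<Rightarrow> base \<Rightarrow> base \<Rightarrow> real^4" where
  "lcoef u P Q K L M = inverse (P$1 * Q$2 - Q$1 * P$2) *\<^sub>R vec4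
    (u$0 * P$1^3 + u$1 * P$1^2 * P$2 + u$2 * P$1 * P$2^2 + u$3 * P$2^3 - P$1 * K$2 + P$2 * K$1)
    (3 * u$0 * P$1^2 * Q$1 + u$1 * (2 * P$1 * Q$1 * P$2 + P$1^2 * Q$2) + u$2 * (Q$1 * P$2^2 + 2 * P$1 * P$2 * Q$2)
      + 3 * u$3 * P$2^2 * Q$2 - 2 * P$1 * L$2 - Q$1 * K$2 + 2 * P$2 * L$1 + Q$2 * K$1)
    (3 * u$0 * P$1 * Q$1^2 + u$1 * (Q$1^2 * P$2 + 2 * P$1 * Q$1 * Q$2) + u$2 * (2 * Q$1 * P$2 * Q$2 + P$1 * Q$2^2)
      + 3 * u$3 * P$2 * Q$2^2 - P$1 * M$2 - 2 * Q$1 * L$2 + P$2 * M$1 + 2 * Q$2 * L$1)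
    (u$0 * Q$1^3 + u$1 * Q$1^2 * Q$2 + u$2 * Q$1 * Q$2^2 + u$3 * Q$2^3 - Q$1 * M$2 + Q$2 * M$1)"

lemma mderiv_simps:
  "mderiv (0, 0) h = h" "mderiv (Suc 0, 0) h = partial 1 h" "mderiv (0, Suc 0) h = partial 2 h"
  "mderiv (2, 0) h = partial 1 (partial 1 h)" "mderiv (Suc 0, Suc 0) h = partial 1 (partial 2 h)"
  "mderiv (0, 2) h = partial 2 (partial 2 h)"
  "mderiv (3, 0) h = partial 1 (partial 1 (partial 1 h))" "mderiv (2, Suc 0) h = partial 1 (partial 1 (partial 2 h))"
  "mderiv (Suc 0, 2) h = partial 1 (partial 2 (partial 2 h))" "mderiv (0, 3) h = partial 2 (partial 2 (partial 2 h))"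
  by (simp_all add: mderiv_def numeral_2_eq_2 numeral_3_eq_3)

lemma lift0_lcoef:
  "lift0 U f e = (let g = inv_into U f; y = f (fst e) in
     (y, lcoef (snd e) (partial 1 g y) (partial 2 g y) (partial 1 (partial 1 g) y)
       (partial 1 (partial 2 g) y) (partial 2 (partial 2 g) y)))"
  unfolding lift0_def Let_def prod.inject vec4_eq_iff
  by (simp add: mderiv_simps mderiv_simps(4-6)[unfolded numeral_2_eq_2] lcoef_def power3_eq_cube power2_eq_square coeff_pCons numeral_2_eq_2
      numeral_3_eq_3 algebra_simps)

text \<open>For a map \<open>f\<close> and two directions \<open>d 1\<close>, \<open>d 2\<close>, the functions below express, at a point \<open>x\<close>, the
  first derivatives of the inverse of \<open>f\<close> at \<open>f x\<close>, and the operators which become partial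
  derivatives when functions are transported by \<open>f\<close>. They are used for a single map of the plane, and
  for a family of such maps, where the directions are those of the plane.\<close>

definition jacd :: "(2 \<Rightarrow> 'a::real_normed_vector) \<Rightarrow> ('a \<Rightarrow> base) \<Rightarrow> 'a \<Rightarrow> real" where
  "jacd d f x = dird (d 1) f x $ 1 * dird (d 2) f x $ 2 - dird (d 2) f x $ 1 * dird (d 1) f x $ 2"

definition ginv :: "(2 \<Rightarrow> 'a::real_normed_vector) \<Rightarrow> ('a \<Rightarrow> base) \<Rightarrow> 2 \<Rightarrow> 'a \<Rightarrow> base" where
  "ginv d f l x = inverse (jacd d f x) *\<^sub>R
     (if l = 1 then dird (d 2) f x $ 2 *\<^sub>R axis 1 1 - dird (d 1) f x $ 2 *\<^sub>R axis 2 1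
      else dird (d 1) f x $ 1 *\<^sub>R axis 2 1 - dird (d 2) f x $ 1 *\<^sub>R axis 1 1)"

definition nab :: "(2 \<Rightarrow> 'a::real_normed_vector) \<Rightarrow> ('a \<Rightarrow> base) \<Rightarrow> 2 \<Rightarrow> ('a \<Rightarrow> 'b::real_normed_vector) \<Rightarrow> 'a \<Rightarrow> 'b" where
  "nab d f l h x = ginv d f l x $ 1 *\<^sub>R dird (d 1) h x + ginv d f l x $ 2 *\<^sub>R dird (d 2) h x"

definition tcoef :: "(2 \<Rightarrow> 'a::real_normed_vector) \<Rightarrow> ('a \<Rightarrow> base) \<Rightarrow> ('a \<Rightarrow> real^4) \<Rightarrow> 'a \<Rightarrow> real^4" where
  "tcoef d f u x = lcoef (u x) (ginv d f 1 x) (ginv d f 2 x) (nab d f 1 (ginv d f 1) x)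
     (nab d f 1 (ginv d f 2) x) (nab d f 2 (ginv d f 2) x)"

lemma smooth_on_jacd: "smooth_on D f \<Longrightarrow> smooth_on D (jacd d f)"
  unfolding jacd_def[abs_def] by (intro smooth_on_diff smooth_on_mult smooth_on_nth smooth_on_dird)

lemma smooth_on_ginv:
  assumes "smooth_on D f" "\<And>x. x \<in> D \<Longrightarrow> jacd d f x \<noteq> 0"
  shows "smooth_on D (ginv d f l)"
proof -
  have D: "open D" using assms(1) smooth_on_open by blast
  show ?thesis
    unfolding ginv_def[abs_def]
    by (cases "l = 1") (auto intro!: smooth_on_scaleR smooth_on_diff smooth_on_const smooth_on_inverse
        smooth_on_nth smooth_on_dird smooth_on_jacd assms D)
qed

lemma smooth_on_nab:
  assumes "smooth_on D f" "\<And>x. x \<in> D \<Longrightarrow> jacd d f x \<noteq> 0" "smooth_on D h"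
  shows "smooth_on D (nab d f l h)"
  unfolding nab_def[abs_def]
  by (intro smooth_on_add smooth_on_scaleR smooth_on_nth smooth_on_dird smooth_on_ginv assms)

lemma ginv_det:
  assumes "jacd d f x \<noteq> 0"
  shows "ginv d f 1 x $ 1 * ginv d f 2 x $ 2 - ginv d f 2 x $ 1 * ginv d f 1 x $ 2 = inverse (jacd d f x)"
  using assms by (simp add: ginv_def field_simps) (simp add: jacd_def algebra_simps)

lemma smooth_on_vec4:
  assumes "smooth_on D a" "smooth_on D b" "smooth_on D c" "smooth_on D e"
  shows "smooth_on D (\<lambda>x. vec4 (a x) (b x) (c x) (e x))"
proof (rule smooth_on_vec)
  show "open D" using assms(1) smooth_on_open by blast
  show "smooth_on D (\<lambda>x. vec4 (a x) (b x) (c x) (e x) $ i)" for i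
    using exhaust_index4[of i] assms by auto
qed

lemma smooth_on_tcoef:
  assumes "smooth_on D f" "\<And>x. x \<in> D \<Longrightarrow> jacd d f x \<noteq> 0" "smooth_on D u"
  shows "smooth_on D (tcoef d f u)"
proof -
  have D: "open D" using assms(1) smooth_on_open by blast
  have J: "ginv d f 1 x $ 1 * ginv d f 2 x $ 2 - ginv d f 2 x $ 1 * ginv d f 1 x $ 2 \<noteq> 0" if "x \<in> D" for x
    using ginv_det[OF assms(2)[OF that]] assms(2)[OF that] by simp
  note G = smooth_on_ginv[OF assms(1,2)]
  note K = smooth_on_nab[OF assms(1,2) G]
  show ?thesis
    unfolding tcoef_def[abs_def] lcoef_def
    by (intro smooth_on_scaleR smooth_on_inverse smooth_on_vec4 smooth_on_add smooth_on_diff smooth_on_mult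
        smooth_on_power smooth_on_nth smooth_on_const G K assms D J; assumption)
qed

abbreviation "pdir \<equiv> (\<lambda>i::2. axis i (1::real) :: base)"

lemma jacd_pdir: "jacd pdir f = jac f"
  by (simp add: fun_eq_iff jacd_def jac_def partial_dird)

abbreviation fib :: "(base \<Rightarrow> total) \<Rightarrow> base \<Rightarrow> fibre" where
  "fib S \<equiv> (\<lambda>q. snd (S q))"

lemma section_smooth: "local_section D S \<Longrightarrow> smooth_on D (\<lambda>q. snd (S q))"
  unfolding local_section_def by (auto intro: smooth_on_linear[OF bounded_linear_snd])

context
  fixes U :: "base set" and f :: "base \<Rightarrow> base"
  assumes pt: "point_transformation U f"
begin

lemma pt_smooth: "smooth_on U f" "smooth_on (f ` U) (inv_into U f)" "open U"
  using pt smooth_on_open by (auto simp: point_transformation_def)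

lemma pt_inv: "q \<in> U \<Longrightarrow> inv_into U f (f q) = q"
  using pt by (simp add: point_transformation_def)

lemma pt_image_open:
  assumes "V \<subseteq> U" "open V"
  shows "open (f ` V)"
proof -
  have "f ` V = (f ` U) \<inter> inv_into U f -` V" using assms(1) pt_inv by (auto simp: image_iff)
  moreover have "open ((f ` U) \<inter> inv_into U f -` V)"
    using smooth_on_continuous[OF pt_smooth(2)] smooth_on_open[OF pt_smooth(2)] assms(2)
    by (rule continuous_open_preimage)
  ultimately show ?thesis by simp
qed

lemma pt_dird_inv:
  assumes q: "q \<in> U"
  shows "dird (dird v (inv_into U f) (f q)) f q = v"
proof -
  have fq: "f q \<in> f ` U" using q by simp
  have "dird (dird v (inv_into U f) (f q)) f (inv_into U f (f q)) = dird v (\<lambda>y. f (inv_into U f y)) (f q)"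
    by (rule dird_compose[symmetric])
      (use smooth_on_differentiable[OF pt_smooth(2) fq] smooth_on_differentiable[OF pt_smooth(1) q] pt_inv[OF q] in auto)
  also have "\<dots> = dird v (\<lambda>y. y) (f q)"
    by (rule dird_cong[OF smooth_on_open[OF pt_smooth(2)] fq]) (simp add: f_inv_into_f)
  also have "\<dots> = v" by (simp add: dird_def)
  finally show ?thesis by (simp add: pt_inv[OF q])
qed

text \<open>The smooth inverse makes the differential surjective, hence its determinant nonzero.\<close>

lemma pt_jac:
  assumes q: "q \<in> U"
  shows "jac f q \<noteq> 0"
proof
  assume 0: "jac f q = 0"
  have d: "f differentiable (at q)" using smooth_on_differentiable[OF pt_smooth(1) q] .
  have eq: "v $ i = w $ 1 * partial 1 f q $ i + w $ 2 * partial 2 f q $ i" if "w = dird v (inv_into U f) (f q)" for v w i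
    using pt_dird_inv[OF q, of v] dird_base[OF d, of w] that
    by (metis vector_add_component vector_scaleR_component real_scaleR_def)
  define w where "w = dird (axis 1 1) (inv_into U f) (f q)"
  define w' where "w' = dird (axis 2 1) (inv_into U f) (f q)"
  have e: "1 = w $ 1 * partial 1 f q $ 1 + w $ 2 * partial 2 f q $ 1" "0 = w $ 1 * partial 1 f q $ 2 + w $ 2 * partial 2 f q $ 2"
     "0 = w' $ 1 * partial 1 f q $ 1 + w' $ 2 * partial 2 f q $ 1" "1 = w' $ 1 * partial 1 f q $ 2 + w' $ 2 * partial 2 f q $ 2"
    using eq[OF w_def, of 1] eq[OF w_def, of 2] eq[OF w'_def, of 1] eq[OF w'_def, of 2] by simp_all
  have "1 = (w $ 1 * partial 1 f q $ 1 + w $ 2 * partial 2 f q $ 1) * (w' $ 1 * partial 1 f q $ 2 + w' $ 2 * partial 2 f q $ 2)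
     - (w $ 1 * partial 1 f q $ 2 + w $ 2 * partial 2 f q $ 2) * (w' $ 1 * partial 1 f q $ 1 + w' $ 2 * partial 2 f q $ 1)"
    unfolding e[symmetric] by simp
  also have "\<dots> = (w $ 1 * w' $ 2 - w $ 2 * w' $ 1) * jac f q" by (simp add: jac_def algebra_simps)
  finally show False using 0 by simp
qed

lemma pt_partial_inv:
  assumes q: "q \<in> U"
  shows "partial l (inv_into U f) (f q) = ginv pdir f l q"
proof -
  have d: "f differentiable (at q)" using smooth_on_differentiable[OF pt_smooth(1) q] .
  note c = cramer_base[OF d pt_jac[OF q] pt_dird_inv[OF q, of "axis l 1"]]
  show ?thesis
    using exhaust_2[of l] c
    by (auto simp: vec2_eq_iff partial_dird ginv_def jacd_pdir[unfolded fun_eq_iff] divide_inverse mult.commute)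
qed

text \<open>This turns derivatives at the moving point \<open>f q\<close> into derivatives at the fixed point \<open>q\<close>. Iterating it
  gives the second derivatives of the inverse map and the derivatives of a transformed section.\<close>

lemma pt_transport:
  assumes V: "V \<subseteq> U" "open V" "q \<in> V" and H: "H differentiable (at q)"
    and h: "\<And>q. q \<in> V \<Longrightarrow> h (f q) = H q"
  shows "partial l h (f q) = nab pdir f l H q"
proof -
  have q: "q \<in> U" using V by auto
  have "partial l h (f q) = dird (axis l 1) (\<lambda>y. H (inv_into U f y)) (f q)"
    unfolding partial_dird
    by (rule dird_cong[OF pt_image_open[OF V(1,2)]]) (use V h pt_inv in auto)
  also have "\<dots> = dird (dird (axis l 1) (inv_into U f) (f q)) H (inv_into U f (f q))"
    by (rule dird_compose) (use smooth_on_differentiable[OF pt_smooth(2)] q H pt_inv[OF q] in auto)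
  also have "\<dots> = nab pdir f l H q"
    unfolding pt_inv[OF q] dird_base[OF H] using pt_partial_inv[OF q, of l]
    by (simp add: nab_def partial_dird)
  finally show ?thesis .
qed

lemma pt_partial2_inv:
  assumes q: "q \<in> U"
  shows "partial j (partial l (inv_into U f)) (f q) = nab pdir f j (ginv pdir f l) q"
proof -
  have "smooth_on U (ginv pdir f l)"
    by (rule smooth_on_ginv[OF pt_smooth(1)]) (simp add: jacd_pdir pt_jac)
  then show ?thesis
    by (intro pt_transport[OF subset_refl pt_smooth(3) q smooth_on_differentiable[OF _ q]] pt_partial_inv)
qed

lemma pt_lift0:
  assumes q: "q \<in> U"
  shows "lift0 U f (q, u q) = (f q, tcoef pdir f u q)"
  unfolding lift0_lcoef Let_def by (simp add: pt_partial_inv[OF q] pt_partial2_inv[OF q] tcoef_def)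

lemma pt_transform:
  assumes S: "local_section D S" and q: "q \<in> U" "q \<in> D"
  shows "snd (transform U f S (f q)) = tcoef pdir f (\<lambda>q. snd (S q)) q"
proof -
  have "S q = (q, snd (S q))" using S q(2) by (metis local_section_def prod.collapse)
  then show ?thesis using pt_lift0[OF q(1), of "\<lambda>q. snd (S q)"] by (simp add: transform_def pt_inv[OF q(1)])
qed

lemma pt_partial_transform:
  assumes S: "local_section D S" and q: "q \<in> U" "q \<in> D"
  shows "partial l (\<lambda>y. snd (transform U f S y)) (f q) = nab pdir f l (tcoef pdir f (\<lambda>q. snd (S q))) q"
proof -
  have u: "smooth_on D (\<lambda>q. snd (S q))" by (rule section_smooth[OF S])
  have o: "open (U \<inter> D)" using pt_smooth(3) smooth_on_open[OF u] by blast
  have "smooth_on (U \<inter> D) (tcoef pdir f (\<lambda>q. snd (S q)))"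
    by (rule smooth_on_tcoef[OF smooth_on_subset[OF pt_smooth(1) o] _ smooth_on_subset[OF u o]])
      (auto simp: jacd_pdir pt_jac)
  then show ?thesis
    using q by (intro pt_transport[of "U \<inter> D"] o smooth_on_differentiable[of "U \<inter> D"]) (auto intro: pt_transform[OF S])
qed

end

section \<open>Lifts of flows\<close>

lemma lcoef_nth: "lcoef u P Q K L M $ \<alpha> = inverse (P$1 * Q$2 - Q$1 * P$2) * (vec4
    (u$0 * P$1^3 + u$1 * P$1^2 * P$2 + u$2 * P$1 * P$2^2 + u$3 * P$2^3 - P$1 * K$2 + P$2 * K$1)
    (3 * u$0 * P$1^2 * Q$1 + u$1 * (2 * P$1 * Q$1 * P$2 + P$1^2 * Q$2) + u$2 * (Q$1 * P$2^2 + 2 * P$1 * P$2 * Q$2)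
      + 3 * u$3 * P$2^2 * Q$2 - 2 * P$1 * L$2 - Q$1 * K$2 + 2 * P$2 * L$1 + Q$2 * K$1)
    (3 * u$0 * P$1 * Q$1^2 + u$1 * (Q$1^2 * P$2 + 2 * P$1 * Q$1 * Q$2) + u$2 * (2 * Q$1 * P$2 * Q$2 + P$1 * Q$2^2)
      + 3 * u$3 * P$2 * Q$2^2 - P$1 * M$2 - 2 * Q$1 * L$2 + P$2 * M$1 + 2 * Q$2 * L$1)
    (u$0 * Q$1^3 + u$1 * Q$1^2 * Q$2 + u$2 * Q$1 * Q$2^2 + u$3 * Q$2^3 - Q$1 * M$2 + Q$2 * M$1) $ \<alpha>)"
  by (simp add: lcoef_def)

text \<open>The fibre component, at fibre coordinates \<open>u\<close>, of the lift of a vector field \<open>X\<close>; \<open>a, b\<close> stand for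
  \<open>\<partial>\<^sub>1X, \<partial>\<^sub>2X\<close> and \<open>k, l, m\<close> for \<open>\<partial>\<^sub>1\<^sub>1X, \<partial>\<^sub>1\<^sub>2X, \<partial>\<^sub>2\<^sub>2X\<close>. It arises by differentiating \<open>lcoef\<close> at the identity, where the inverse flow
  contributes the derivatives of \<open>- X\<close>. The terms in \<open>k, l, m\<close> form the symbol.\<close>

definition infl :: "real^4 \<Rightarrow> base \<Rightarrow> base \<Rightarrow> base \<Rightarrow> base \<Rightarrow> base \<Rightarrow> real^4" where
  "infl u a b k l m = vec4
    ((b$2 - 2 * a$1) * u$0 - u$1 * a$2 + k$2)
    (- 3 * u$0 * b$1 - u$1 * a$1 - 2 * u$2 * a$2 + 2 * l$2 - k$1)
    (- 2 * u$1 * b$1 - u$2 * b$2 - 3 * u$3 * a$2 + m$2 - 2 * l$1)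
    ((a$1 - 2 * b$2) * u$3 - u$2 * b$1 - m$1)"

text \<open>Vector-valued derivatives are taken componentwise, because \<open>lcoef\<close> is polynomial in the components up to the
  factor \<open>1/J\<close> and is differentiated by the rules for real functions.\<close>

definition has_nth_derivative :: "(real \<Rightarrow> real^'n) \<Rightarrow> real^'n \<Rightarrow> real \<Rightarrow> bool" where
  "has_nth_derivative c c' t \<longleftrightarrow> (\<forall>i. ((\<lambda>t. c t $ i) has_real_derivative c' $ i) (at t))"

lemma lcoef_has_derivative:
  assumes "has_nth_derivative P (- a) 0" "has_nth_derivative Q (- b) 0"
    "has_nth_derivative K (- k) 0" "has_nth_derivative L (- l) 0" "has_nth_derivative M (- m) 0"
    and [simp]: "P 0 = axis 1 1" "Q 0 = axis 2 1" "K 0 = 0" "L 0 = 0" "M 0 = 0"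
  shows "has_nth_derivative (\<lambda>t. lcoef u (P t) (Q t) (K t) (L t) (M t)) (infl u a b k l m) 0"
  unfolding has_nth_derivative_def
proof
  fix \<alpha> :: 4
  have d: "((\<lambda>t. P t $ i) has_real_derivative - a $ i) (at 0)" "((\<lambda>t. Q t $ i) has_real_derivative - b $ i) (at 0)"
    "((\<lambda>t. K t $ i) has_real_derivative - k $ i) (at 0)" "((\<lambda>t. L t $ i) has_real_derivative - l $ i) (at 0)"
    "((\<lambda>t. M t $ i) has_real_derivative - m $ i) (at 0)" for i
    using assms(1-5) by (simp_all add: has_nth_derivative_def)
  consider "\<alpha> = 0" | "\<alpha> = 1" | "\<alpha> = 2" | "\<alpha> = 3" using exhaust_index4 by blast
  then show "((\<lambda>t. lcoef u (P t) (Q t) (K t) (L t) (M t) $ \<alpha>) has_real_derivative infl u a b k l m $ \<alpha>) (at 0)"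
  proof cases
    case 1
    show ?thesis unfolding 1 lcoef_nth infl_def vec4_nth
      by (rule derivative_eq_intros d refl | simp)+ (simp add: algebra_simps power2_eq_square power3_eq_cube)
  next
    case 2
    show ?thesis unfolding 2 lcoef_nth infl_def vec4_nth
      by (rule derivative_eq_intros d refl | simp)+ (simp add: algebra_simps power2_eq_square power3_eq_cube)
  next
    case 3
    show ?thesis unfolding 3 lcoef_nth infl_def vec4_nth
      by (rule derivative_eq_intros d refl | simp)+ (simp add: algebra_simps power2_eq_square power3_eq_cube)
  next
    case 4
    show ?thesis unfolding 4 lcoef_nth infl_def vec4_nth
      by (rule derivative_eq_intros d refl | simp)+ (simp add: algebra_simps power2_eq_square power3_eq_cube)
  qed
qed

lemma slice_dird:
  assumes "H differentiable (at (t, q))"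
  shows "dird v (\<lambda>q. H (t, q)) q = dird (0, v) H (t, q)"
proof (rule dird_eq)
  show "((\<lambda>q. H (t, q)) has_derivative (\<lambda>v. dird (0, v) H (t, q))) (at q)"
    by (rule has_derivative_compose[of "\<lambda>q. (t, q)" "\<lambda>v. (0, v)", OF _ has_derivative_dird[OF assms]])
      (auto intro!: derivative_eq_intros)
qed

lemma slice_partial:
  "H differentiable (at (t, q)) \<Longrightarrow> partial i (\<lambda>q. H (t, q)) q = dird (0, pdir i) H (t, q)"
  by (simp add: partial_dird slice_dird)

lemma time_derivative:
  fixes H :: "real \<times> base \<Rightarrow> real^'n"
  assumes "H differentiable (at (0, q))"
  shows "has_nth_derivative (\<lambda>t. H (t, q)) (dird (1, 0) H (0, q)) 0"
  unfolding has_nth_derivative_def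
proof
  fix i
  have 1: "(\<lambda>x. H x $ i) differentiable (at ((0, q) + 0 *\<^sub>R (1, 0)))"
    using bounded_linear.has_derivative[OF bounded_linear_vec_nth has_derivative_dird[OF assms], of i]
    by (auto intro: differentiableI)
  show "((\<lambda>t. H (t, q) $ i) has_real_derivative dird (1, 0) H (0, q) $ i) (at 0)"
    using has_real_derivative_along_line[OF 1] by (simp add: dird_nth[OF assms])
qed

lemma has_nth_derivative_unique: "has_nth_derivative c a t \<Longrightarrow> has_nth_derivative c b t \<Longrightarrow> a = b"
  unfolding has_nth_derivative_def vec_eq_iff using DERIV_unique by blast

lemma has_nth_derivative_cong:
  assumes "has_nth_derivative c a t" "open T" "t \<in> T" "\<And>s. s \<in> T \<Longrightarrow> c s = c' s"
  shows "has_nth_derivative c' a t"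
  unfolding has_nth_derivative_def
proof
  fix i
  show "((\<lambda>t. c' t $ i) has_real_derivative a $ i) (at t)"
    by (rule has_field_derivative_transform_within_open[OF _ assms(2,3), of "\<lambda>t. c t $ i"])
      (use assms in \<open>auto simp: has_nth_derivative_def\<close>)
qed

abbreviation "tdir \<equiv> (\<lambda>i::2. (0::real, axis i (1::real) :: base))"

text \<open>A family of plane maps is regarded as one map on the product of the time axis and the plane. Then the
  time derivative and the derivatives in the plane are directional derivatives of the same smooth
  function, and commute.\<close>

locale plane_motion =
  fixes F :: "real \<times> base \<Rightarrow> base" and e :: real and U :: "base set" and X :: "base \<Rightarrow> base"
  assumes e: "0 < e" and U: "open U" and F: "smooth_on ({-e<..<e} \<times> U) F"
    and start: "\<And>q. q \<in> U \<Longrightarrow> F (0, q) = q"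
    and J: "\<And>x. x \<in> {-e<..<e} \<times> U \<Longrightarrow> jacd tdir F x \<noteq> 0"
    and X: "\<And>q. q \<in> U \<Longrightarrow> dird (1, 0) F (0, q) = X q"
begin

abbreviation "\<Omega> \<equiv> {-e<..<e} \<times> U"

lemma in_Omega: "q \<in> U \<Longrightarrow> (0, q) \<in> \<Omega>" using e by auto

lemma X_smooth: "smooth_on U X"
proof (rule smooth_on_cong[of _ "\<lambda>q. dird (1, 0) F (0, q)"])
  have "smooth_on U (\<lambda>q. (0::real, q))"
    using smooth_on_linear[OF _ smooth_on_ident[OF U], of "\<lambda>q. (0::real, q)"]
    by (simp add: bounded_linear_Pair bounded_linear_zero bounded_linear_ident)
  then show "smooth_on U (\<lambda>q. dird (1, 0) F (0, q))"
    by (rule smooth_on_compose[OF _ smooth_on_dird[OF F]]) (rule in_Omega)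
qed (rule X)

lemma G_smooth: "smooth_on \<Omega> (ginv tdir F l)" by (rule smooth_on_ginv[OF F J])

lemma dF0: "q \<in> U \<Longrightarrow> dird (0, v) F (0, q) = v"
  using slice_dird[OF smooth_on_differentiable[OF F in_Omega], of q v]
    dird_cong[OF U _ start, where x = q and v = v] dird_eq[OF has_derivative_ident, of v q] by simp

lemma G0: "q \<in> U \<Longrightarrow> ginv tdir F l (0, q) = pdir l"
  using exhaust_2[of l] by (auto simp: ginv_def jacd_def dF0)

lemma time_dF:
  assumes q: "q \<in> U"
  shows "has_nth_derivative (\<lambda>t. dird (0, v) F (t, q)) (dird v X q) 0"
proof -
  have "dird (1, 0) (dird (0, v) F) (0, q) = dird (0, v) (dird (1, 0) F) (0, q)"
    by (rule dird_commute_vec[OF F in_Omega[OF q]])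
  also have "\<dots> = dird v (\<lambda>q. dird (1, 0) F (0, q)) q"
    by (rule slice_dird[symmetric, OF smooth_on_differentiable[OF smooth_on_dird[OF F] in_Omega[OF q]]])
  also have "\<dots> = dird v X q" by (rule dird_cong[OF U q X])
  finally show ?thesis
    using time_derivative[OF smooth_on_differentiable[OF smooth_on_dird[OF F] in_Omega[OF q]], of "(0, v)"] by simp
qed

lemma TG:
  assumes q: "q \<in> U"
  shows "dird (1, 0) (ginv tdir F l) (0, q) = - partial l X q"
proof -
  have d: "((\<lambda>t. dird (0, v) F (t, q) $ i) has_real_derivative dird v X q $ i) (at 0)" for v i
    using time_dF[OF q] by (simp add: has_nth_derivative_def)
  have "((\<lambda>t. ginv tdir F l (t, q) $ k) has_real_derivative - partial l X q $ k) (at 0)" for k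
  proof -
    consider "k = 1" "l = 1" | "k = 1" "l = 2" | "k = 2" "l = 1" | "k = 2" "l = 2"
      using exhaust_2[of k] exhaust_2[of l] by auto
    then show ?thesis
      unfolding ginv_def jacd_def
      by cases (auto intro!: derivative_eq_intros d simp: dF0[OF q] partial_dird)
  qed
  then have "has_nth_derivative (\<lambda>t. ginv tdir F l (t, q)) (- partial l X q) 0"
    by (simp add: has_nth_derivative_def)
  then show ?thesis
    using time_derivative[OF smooth_on_differentiable[OF G_smooth in_Omega[OF q]]] has_nth_derivative_unique by blast
qed

lemma nab0: "q \<in> U \<Longrightarrow> nab tdir F l H (0, q) = dird (0, pdir l) H (0, q)"
  using exhaust_2[of l] by (auto simp: nab_def G0)

text \<open>The time derivative does not commute with the operator \<open>nab\<close>, which at time \<open>t\<close> represents the partial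
  derivative at the moved point. At time \<open>0\<close> the commutator comes from the derivative \<open>- \<partial>X\<close> of the inverse
  differential.\<close>

lemma T_nab:
  fixes H :: "real \<times> base \<Rightarrow> real^'n"
  assumes H: "smooth_on \<Omega> H" and q: "q \<in> U"
  shows "dird (1, 0) (nab tdir F l H) (0, q) = partial l (\<lambda>q. dird (1, 0) H (0, q)) q
    - (partial l X q $ 1 *\<^sub>R partial 1 (\<lambda>q. H (0, q)) q + partial l X q $ 2 *\<^sub>R partial 2 (\<lambda>q. H (0, q)) q)"
proof -
  note q0 = in_Omega[OF q]
  have dH: "H differentiable (at (0, q))" "dird v H differentiable (at (0, q))" for v
    using smooth_on_differentiable[OF H q0] smooth_on_differentiable[OF smooth_on_dird[OF H] q0] by auto
  have dG: "(\<lambda>x. ginv tdir F l x $ k) differentiable (at (0, q))" for k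
    by (rule smooth_on_differentiable[OF smooth_on_nth[OF G_smooth] q0])
  have sc: "dird (1, 0) (\<lambda>x. ginv tdir F l x $ k *\<^sub>R dird (tdir k) H x) (0, q) =
      pdir l $ k *\<^sub>R dird (1, 0) (dird (tdir k) H) (0, q) - (partial l X q $ k) *\<^sub>R dird (tdir k) H (0, q)" for k
    using dird_bilinear[OF bounded_bilinear_scaleR dG dH(2), of "(1,0)" k "tdir k"]
    by (simp add: G0[OF q] TG[OF q] dird_nth[OF smooth_on_differentiable[OF G_smooth q0]])
  have df: "(\<lambda>x. ginv tdir F l x $ k *\<^sub>R dird (tdir k) H x) differentiable (at (0, q))" for k
    by (rule smooth_on_differentiable[OF _ q0]) (intro smooth_on_scaleR smooth_on_nth G_smooth smooth_on_dird H)
  have "dird (1, 0) (nab tdir F l H) (0, q) = pdir l $ 1 *\<^sub>R dird (1, 0) (dird (tdir 1) H) (0, q) + pdir l $ 2 *\<^sub>R dird (1, 0) (dird (tdir 2) H) (0, q)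
     - (partial l X q $ 1 *\<^sub>R dird (tdir 1) H (0, q) + partial l X q $ 2 *\<^sub>R dird (tdir 2) H (0, q))"
    unfolding nab_def[abs_def] dird_add[OF df df] sc by simp
  also have "pdir l $ 1 *\<^sub>R dird (1, 0) (dird (tdir 1) H) (0, q) + pdir l $ 2 *\<^sub>R dird (1, 0) (dird (tdir 2) H) (0, q)
     = dird (1, 0) (dird (tdir l) H) (0, q)"
    using exhaust_2[of l] by auto
  also have "\<dots> = partial l (\<lambda>q. dird (1, 0) H (0, q)) q"
    using dird_commute_vec[OF H q0] slice_partial[OF dH(2)] by metis
  finally show ?thesis by (simp add: slice_partial[OF dH(1)])
qed

lemma T_nab_G:
  assumes q: "q \<in> U"
  shows "dird (1, 0) (nab tdir F j (ginv tdir F l)) (0, q) = - partial j (partial l X) q"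
proof -
  have "partial k (\<lambda>q. ginv tdir F l (0, q)) q = 0" for k
    unfolding partial_dird using dird_cong[OF U q, of "\<lambda>q. ginv tdir F l (0, q)" "\<lambda>_. pdir l"] G0 by simp
  moreover have "partial j (\<lambda>q. dird (1, 0) (ginv tdir F l) (0, q)) q = partial j (\<lambda>q. - partial l X q) q"
    unfolding partial_dird by (rule dird_cong[OF U q]) (simp add: TG partial_dird)
  moreover have "\<dots> = - partial j (partial l X) q"
    unfolding partial_dird by (intro dird_minus smooth_on_differentiable[OF smooth_on_dird[OF X_smooth] q])
  ultimately show ?thesis using T_nab[OF G_smooth q, of j l] by simp
qed

lemma nab_G0:
  assumes q: "q \<in> U"
  shows "nab tdir F j (ginv tdir F l) (0, q) = 0"
proof -
  have "nab tdir F j (ginv tdir F l) (0, q) = dird (pdir j) (\<lambda>q. ginv tdir F l (0, q)) q"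
    by (simp add: nab0[OF q] slice_dird[OF smooth_on_differentiable[OF G_smooth in_Omega[OF q]]])
  also have "\<dots> = dird (pdir j) (\<lambda>_. pdir l) q" by (rule dird_cong[OF U q G0])
  finally show ?thesis by simp
qed

context
  fixes V :: "base set" and u :: "base \<Rightarrow> real^4"
  assumes V: "V \<subseteq> U" "open V" and u: "smooth_on V u"
begin

abbreviation "\<Omega>V \<equiv> {-e<..<e} \<times> V"

lemma OV: "open \<Omega>V" "\<Omega>V \<subseteq> \<Omega>" using V by (auto intro: open_Times)

lemma tc_smooth: "smooth_on \<Omega>V (tcoef tdir F (\<lambda>x. u (snd x)))"
proof (rule smooth_on_tcoef[OF smooth_on_subset[OF F OV]])
  show "smooth_on \<Omega>V (\<lambda>x. u (snd x))"
    by (rule smooth_on_compose[OF smooth_on_bounded_linear[OF bounded_linear_snd OV(1)] u]) auto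
qed (use OV J in auto)

lemma tc0: "q \<in> V \<Longrightarrow> tcoef tdir F (\<lambda>x. u (snd x)) (0, q) = u q"
  using V by (auto simp: tcoef_def G0 nab_G0 lcoef_def vec4_eq_iff subset_iff)

abbreviation "infl_at q \<equiv> infl (u q) (partial 1 X q) (partial 2 X q) (partial 1 (partial 1 X) q)
    (partial 1 (partial 2 X) q) (partial 2 (partial 2 X) q)"

lemma T_tc:
  assumes q: "q \<in> V"
  shows "dird (1, 0) (tcoef tdir F (\<lambda>x. u (snd x))) (0, q) = infl_at q"
proof -
  have qU: "q \<in> U" using q V by auto
  note q0 = in_Omega[OF qU]
  have G: "has_nth_derivative (\<lambda>t. ginv tdir F l (t, q)) (- partial l X q) 0" for l
    using time_derivative[OF smooth_on_differentiable[OF G_smooth q0]] TG[OF qU] by metis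
  have K: "has_nth_derivative (\<lambda>t. nab tdir F j (ginv tdir F l) (t, q)) (- partial j (partial l X) q) 0" for j l
    using time_derivative[OF smooth_on_differentiable[OF smooth_on_nab[OF F J G_smooth] q0]] T_nab_G[OF qU] by metis
  have "has_nth_derivative (\<lambda>t. tcoef tdir F (\<lambda>x. u (snd x)) (t, q)) (infl_at q) 0"
    unfolding tcoef_def snd_conv
    by (rule lcoef_has_derivative[OF G G K K K]) (simp_all add: G0[OF qU] nab_G0[OF qU])
  moreover have "(0, q) \<in> \<Omega>V" using q e by auto
  ultimately show ?thesis
    using time_derivative[OF smooth_on_differentiable[OF tc_smooth]] has_nth_derivative_unique by blast
qed

lemma T_nab_tc:
  assumes q: "q \<in> V"
  shows "dird (1, 0) (nab tdir F l (tcoef tdir F (\<lambda>x. u (snd x)))) (0, q) = partial l (\<lambda>q. infl_at q) q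
    - (partial l X q $ 1 *\<^sub>R partial 1 u q + partial l X q $ 2 *\<^sub>R partial 2 u q)"
proof -
  interpret W: plane_motion F e V X
    using e V F J X start by unfold_locales (auto intro: smooth_on_subset[OF F OV])
  have "partial k (\<lambda>q. tcoef tdir F (\<lambda>x. u (snd x)) (0, q)) q = partial k u q" for k
    unfolding partial_dird by (rule dird_cong[OF V(2) q tc0])
  moreover have "partial l (\<lambda>q. dird (1, 0) (tcoef tdir F (\<lambda>x. u (snd x))) (0, q)) q = partial l (\<lambda>q. infl_at q) q"
    unfolding partial_dird[of l] by (rule dird_cong[OF V(2) q T_tc])
  ultimately show ?thesis using W.T_nab[OF tc_smooth q, of l] by simp
qed

end

lemma slice_G:
  assumes "(t, q) \<in> \<Omega>"
  shows "ginv pdir (\<lambda>q. F (t, q)) l q = ginv tdir F l (t, q)"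
  using smooth_on_differentiable[OF F assms] by (simp add: ginv_def jacd_def slice_dird)

lemma slice_nab:
  assumes V: "open V" "V \<subseteq> U" and t: "t \<in> {-e<..<e}" "q \<in> V"
    and H: "H differentiable (at (t, q))" "\<And>q. q \<in> V \<Longrightarrow> h q = H (t, q)"
  shows "nab pdir (\<lambda>q. F (t, q)) l h q = nab tdir F l H (t, q)"
proof -
  have "dird v h q = dird (0, v) H (t, q)" for v
    by (rule trans[OF dird_cong[OF V(1) t(2) H(2)] slice_dird[OF H(1)]])
  moreover have "(t, q) \<in> \<Omega>" using t V by auto
  ultimately show ?thesis by (simp add: nab_def slice_G)
qed

lemma slice_tcoef:
  assumes "(t, q) \<in> \<Omega>"
  shows "tcoef pdir (\<lambda>q. F (t, q)) u q = tcoef tdir F (\<lambda>x. u (snd x)) (t, q)"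
proof -
  have "nab pdir (\<lambda>q. F (t, q)) j (ginv pdir (\<lambda>q. F (t, q)) l) q = nab tdir F j (ginv tdir F l) (t, q)" for j l
    by (rule slice_nab[OF U]) (use assms in \<open>auto intro: slice_G smooth_on_differentiable[OF G_smooth]\<close>)
  then show ?thesis by (simp add: tcoef_def slice_G[OF assms])
qed

end

lemma local_flow_motion:
  assumes lf: "local_flow D X e U \<phi>"
  shows "plane_motion (\<lambda>(t, q). \<phi> t q) e U X"
proof
  let ?F = "\<lambda>(t, q). \<phi> t q"
  show e: "0 < e" using lf by (simp add: local_flow_def)
  have pt: "point_transformation U (\<phi> t)" if "t \<in> {-e<..<e}" for t using lf that by (simp add: local_flow_def)
  have "point_transformation U (\<phi> 0)" using pt[of 0] e by simp
  then show "open U" using pt_smooth(3) by blast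
  show F: "smooth_on ({-e<..<e} \<times> U) ?F" using lf by (simp add: local_flow_def)
  show "?F (0, q) = q" if "q \<in> U" for q using lf that by (simp add: local_flow_def)
  show "jacd tdir ?F x \<noteq> 0" if x: "x \<in> {-e<..<e} \<times> U" for x
  proof -
    obtain t q where tq: "x = (t, q)" "t \<in> {-e<..<e}" "q \<in> U" using x by auto
    have "jacd pdir (\<phi> t) q = jacd tdir ?F (t, q)"
      using slice_dird[OF smooth_on_differentiable[OF F x[unfolded tq(1)]]] by (simp add: jacd_def)
    then show ?thesis using pt_jac[OF pt[OF tq(2)] tq(3)] tq(1) by (simp add: jacd_pdir)
  qed
  show "dird (1, 0) ?F (0, q) = X q" if q: "q \<in> U" for q
  proof -
    have 0: "(0::real) \<in> {-e<..<e}" using e by simp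
    have "((\<lambda>s. \<phi> s q) has_vector_derivative X (\<phi> 0 q)) (at 0)" using lf q 0 unfolding local_flow_def by blast
    moreover have "\<phi> 0 q = q" using lf q by (simp add: local_flow_def)
    ultimately have 1: "((\<lambda>s. \<phi> s q) has_vector_derivative X q) (at 0)" by simp
    have d: "?F differentiable (at (0, q))" by (rule smooth_on_differentiable[OF F]) (use q 0 in auto)
    have "((\<lambda>s. ?F (s, q)) has_derivative (\<lambda>s. dird (s, 0) ?F (0, q))) (at 0)"
      by (rule has_derivative_compose[of "\<lambda>s. (s, q)" "\<lambda>s. (s, 0)", OF _ has_derivative_dird[OF d]])
        (auto intro!: derivative_eq_intros)
    then have "((\<lambda>s. \<phi> s q) has_derivative (\<lambda>s. dird (s, 0) ?F (0, q))) (at 0)" by simp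
    from has_derivative_unique[OF this 1[unfolded has_vector_derivative_def]]
    have "dird (1, 0) ?F (0, q) = 1 *\<^sub>R X q" by (rule fun_cong)
    then show ?thesis by simp
  qed
qed

context
  fixes D D' U :: "base set" and X :: "base \<Rightarrow> base" and e :: real and \<phi> :: "real \<Rightarrow> base \<Rightarrow> base"
    and S :: "base \<Rightarrow> total" and p :: base
  assumes lf: "local_flow D X e U \<phi>" and S: "local_section D' S" and p: "p \<in> U" "p \<in> D'"
begin

abbreviation "lie_fib \<equiv> (\<lambda>q. infl (fib S q) (partial 1 X q) (partial 2 X q) (partial 1 (partial 1 X) q)
    (partial 1 (partial 2 X) q) (partial 2 (partial 2 X) q))"

text \<open>The transformed section and its derivatives are evaluated at the moving point \<open>\<phi> t p\<close>, as in the lift of the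
  flow to jets; therefore no derivative of the section along \<open>X\<close> appears.\<close>

lemma flow_velocity:
  "has_nth_derivative (\<lambda>t. snd (transform U (\<phi> t) S (\<phi> t p))) (lie_fib p) 0"
  "has_nth_derivative (\<lambda>t. partial l (\<lambda>y. snd (transform U (\<phi> t) S y)) (\<phi> t p))
     (partial l lie_fib p - (partial l X p $ 1 *\<^sub>R partial 1 (fib S) p + partial l X p $ 2 *\<^sub>R partial 2 (fib S) p)) 0"
proof -
  let ?F = "\<lambda>(t, q). \<phi> t q"
  interpret plane_motion ?F e U X by (rule local_flow_motion[OF lf])
  let ?V = "U \<inter> D'"
  have V: "?V \<subseteq> U" "open ?V" using U smooth_on_open[OF section_smooth[OF S]] by auto
  have u: "smooth_on ?V (fib S)" by (rule smooth_on_subset[OF section_smooth[OF S] V(2)]) auto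
  have pV: "p \<in> ?V" using p by auto
  have pt: "point_transformation U (\<phi> t)" if "t \<in> {-e<..<e}" for t using lf that by (simp add: local_flow_def)
  let ?T = "tcoef tdir ?F (\<lambda>x. fib S (snd x))"
  have 0: "(0::real) \<in> {-e<..<e}" using e by simp
  have p0: "(0, p) \<in> {-e<..<e} \<times> ?V" using 0 p by auto
  have sl: "tcoef pdir (\<phi> t) (fib S) q = ?T (t, q)" if "t \<in> {-e<..<e}" "q \<in> ?V" for t q
    using slice_tcoef[of t q "fib S"] that by simp
  note T = tc_smooth[OF V u]
  have "has_nth_derivative (\<lambda>t. ?T (t, p)) (lie_fib p) 0"
    using time_derivative[OF smooth_on_differentiable[OF T p0]] T_tc[OF V u pV] by simp
  then show "has_nth_derivative (\<lambda>t. snd (transform U (\<phi> t) S (\<phi> t p))) (lie_fib p) 0"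
  proof (rule has_nth_derivative_cong[OF _ _ 0])
    show "?T (t, p) = snd (transform U (\<phi> t) S (\<phi> t p))" if "t \<in> {-e<..<e}" for t
      using sl[OF that pV] pt_transform[OF pt[OF that] S p] by (rule trans[OF sym sym])
  qed simp
  have nT: "smooth_on ({-e<..<e} \<times> ?V) (nab tdir ?F l ?T)"
    by (rule smooth_on_nab[OF smooth_on_subset[OF F OV[OF V u]] J T]) (use V in auto)
  have "has_nth_derivative (\<lambda>t. nab tdir ?F l ?T (t, p))
     (partial l lie_fib p - (partial l X p $ 1 *\<^sub>R partial 1 (fib S) p + partial l X p $ 2 *\<^sub>R partial 2 (fib S) p)) 0"
    using time_derivative[OF smooth_on_differentiable[OF nT p0]] T_nab_tc[OF V u pV, of l] by simp
  then show "has_nth_derivative (\<lambda>t. partial l (\<lambda>y. snd (transform U (\<phi> t) S y)) (\<phi> t p))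
     (partial l lie_fib p - (partial l X p $ 1 *\<^sub>R partial 1 (fib S) p + partial l X p $ 2 *\<^sub>R partial 2 (fib S) p)) 0"
  proof (rule has_nth_derivative_cong[OF _ _ 0])
    fix t assume t: "t \<in> {-e<..<e}"
    have "nab pdir (\<lambda>q. ?F (t, q)) l (tcoef pdir (\<phi> t) (fib S)) p = nab tdir ?F l ?T (t, p)"
      by (rule slice_nab[OF V(2,1) t pV])
        (use t p in \<open>auto intro: sl smooth_on_differentiable[OF T]\<close>)
    then show "nab tdir ?F l ?T (t, p) = partial l (\<lambda>y. snd (transform U (\<phi> t) S y)) (\<phi> t p)"
      by (simp add: pt_partial_transform[OF pt[OF t] S p])
  qed simp
qed

end

section \<open>Vector fields with prescribed jets\<close>

text \<open>Members of the isotropy spaces come from vector fields that have a flow. Instead of integrating an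
  arbitrary field, the fields constructed here are straightened by an explicit coordinate change, so
  that their flows are translations.\<close>

lemma has_nth_derivative_iff: "has_nth_derivative c c' t \<longleftrightarrow> (c has_vector_derivative c') (at t)"
proof -
  have "(c has_vector_derivative c') (at t) \<longleftrightarrow>
      (\<forall>i\<in>Basis. ((\<lambda>t. c t \<bullet> i) has_derivative (\<lambda>s. (s *\<^sub>R c') \<bullet> i)) (at t))"
    unfolding has_vector_derivative_def by (rule has_derivative_componentwise_within)
  also have "\<dots> \<longleftrightarrow> has_nth_derivative c c' t"
    by (auto simp: has_nth_derivative_def Basis_vec_def inner_axis has_field_derivative_def mult_commute_abs)
  finally show ?thesis by simp
qed

definition taylor :: "base \<Rightarrow> nat \<Rightarrow> 'b::real_normed_vector coeffs \<Rightarrow> base \<Rightarrow> 'b" where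
  "taylor p n c q = (\<Sum>i\<le>n. \<Sum>j\<le>n. ((q$1 - p$1)^i / fact i * ((q$2 - p$2)^j / fact j)) *\<^sub>R c (i, j))"

text \<open>Under this condition shifting the indices loses no coefficient, so that differentiation stays within
  \<open>taylor p n\<close>.\<close>

definition low :: "nat \<Rightarrow> 'b::zero coeffs \<Rightarrow> bool" where
  "low n c \<longleftrightarrow> (\<forall>i j. n < i \<or> n < j \<longrightarrow> c (i, j) = 0)"

lemma smooth_on_taylor: "smooth_on UNIV (taylor p n c)"
  unfolding taylor_def[abs_def] divide_inverse
  by (intro smooth_on_sum smooth_on_scaleR smooth_on_mult smooth_on_power smooth_on_diff smooth_on_nth
      smooth_on_ident smooth_on_const open_UNIV)

lemma taylor_at: "taylor p n c p = c (0, 0)"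
proof -
  have "taylor p n c p = (\<Sum>i\<le>n. \<Sum>j\<le>n. if i = 0 then (if j = 0 then c (0, 0) else 0) else 0)"
    unfolding taylor_def by (intro sum.cong refl) (auto simp: power_0_left)
  also have "\<dots> = (\<Sum>i\<le>n. if i = 0 then (\<Sum>j\<le>n. if j = 0 then c (0, 0) else 0) else 0)"
    by (intro sum.cong refl) auto
  also have "\<dots> = c (0, 0)" by (simp add: sum.delta)
  finally show ?thesis .
qed

lemma power_over_fact_derivative:
  "((\<lambda>x::real. x ^ Suc i / fact (Suc i)) has_real_derivative x ^ i / fact i) (at x)"
  by (rule DERIV_cong[OF DERIV_cdivide[OF DERIV_pow]]) simp

lemma partial_taylor_aux:
  fixes r :: "base \<Rightarrow> real" and c :: "nat \<Rightarrow> 'b::real_normed_vector"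
  assumes r: "(r has_derivative r') (at q)" and c: "c (Suc n) = 0"
  shows "((\<lambda>q. \<Sum>i\<le>n. (r q ^ i / fact i) *\<^sub>R c i) has_derivative (\<lambda>v. r' v *\<^sub>R (\<Sum>i\<le>n. (r q ^ i / fact i) *\<^sub>R c (Suc i)))) (at q)"
proof -
  have 1: "((\<lambda>q. r q ^ Suc i / fact (Suc i)) has_derivative (\<lambda>v. r' v * (r q ^ i / fact i))) (at q)" for i
    using has_derivative_compose[OF r power_over_fact_derivative[unfolded has_field_derivative_def], of i]
    by (simp add: mult.commute)
  have "((\<lambda>q. (\<Sum>i<n. (r q ^ Suc i / fact (Suc i)) *\<^sub>R c (Suc i)) + c 0) has_derivative
      (\<lambda>v. (\<Sum>i<n. (r' v * (r q ^ i / fact i)) *\<^sub>R c (Suc i)) + 0)) (at q)"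
    by (intro has_derivative_add has_derivative_sum has_derivative_const has_derivative_scaleR_left 1)
  moreover have "(\<Sum>i\<le>n. (r q ^ i / fact i) *\<^sub>R c i) = (\<Sum>i<n. (r q ^ Suc i / fact (Suc i)) *\<^sub>R c (Suc i)) + c 0" for q
    using sum.lessThan_Suc_shift[of "\<lambda>i. (r q ^ i / fact i) *\<^sub>R c i" n] by (simp add: lessThan_Suc_atMost)
  moreover have "(\<Sum>i\<le>n. (r q ^ i / fact i) *\<^sub>R c (Suc i)) = (\<Sum>i<n. (r q ^ i / fact i) *\<^sub>R c (Suc i))"
    using c by (simp flip: lessThan_Suc_atMost)
  ultimately show ?thesis by (simp add: scaleR_sum_right)
qed

lemma partial_taylor:
  assumes "low n c"
  shows "partial 1 (taylor p n c) = taylor p n (\<lambda>(i, j). c (Suc i, j))"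
    "partial 2 (taylor p n c) = taylor p n (\<lambda>(i, j). c (i, Suc j))"
proof -
  have r: "((\<lambda>q::base. q$k - p$k) has_derivative (\<lambda>v. v$k)) (at q)" for q k
    by (auto intro!: derivative_eq_intros bounded_linear_imp_has_derivative bounded_linear_vec_nth)
  have 1: "((\<lambda>q::base. (\<Sum>j\<le>n. ((q$2 - p$2)^j / fact j) *\<^sub>R c (i, j))) has_derivative
      (\<lambda>v. v$2 *\<^sub>R (\<Sum>j\<le>n. ((q$2 - p$2)^j / fact j) *\<^sub>R c (i, Suc j)))) (at q)" for i q
    by (rule partial_taylor_aux[OF r]) (use assms in \<open>simp add: low_def\<close>)
  have 2: "((\<lambda>q::base. (\<Sum>i\<le>n. ((q$1 - p$1)^i / fact i) *\<^sub>R c (i, j))) has_derivative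
      (\<lambda>v. v$1 *\<^sub>R (\<Sum>i\<le>n. ((q$1 - p$1)^i / fact i) *\<^sub>R c (Suc i, j)))) (at q)" for j q
    by (rule partial_taylor_aux[OF r]) (use assms in \<open>simp add: low_def\<close>)
  have b: "((\<lambda>q::base. (q$k - p$k)^i / fact i) has_derivative
      (\<lambda>v. v$k *\<^sub>R (of_nat i * (q$k - p$k)^(i - 1) / fact i))) (at q)" for k :: 2 and i q
    by (auto intro!: derivative_eq_intros bounded_linear_imp_has_derivative[OF bounded_linear_vec_nth])
  show "partial 1 (taylor p n c) = taylor p n (\<lambda>(i, j). c (Suc i, j))"
  proof
    fix q
    have "taylor p n c = (\<lambda>q. \<Sum>j\<le>n. ((q$2 - p$2)^j / fact j) *\<^sub>R (\<Sum>i\<le>n. ((q$1 - p$1)^i / fact i) *\<^sub>R c (i, j)))"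
      unfolding taylor_def[abs_def] by (subst sum.swap) (simp add: scaleR_sum_right mult.commute)
    then have "(taylor p n c has_derivative (\<lambda>v. \<Sum>j\<le>n. ((q$2 - p$2)^j / fact j) *\<^sub>R (v$1 *\<^sub>R (\<Sum>i\<le>n. ((q$1 - p$1)^i / fact i) *\<^sub>R c (Suc i, j)))
        + (v$2 *\<^sub>R (of_nat j * (q$2 - p$2)^(j - 1) / fact j)) *\<^sub>R (\<Sum>i\<le>n. ((q$1 - p$1)^i / fact i) *\<^sub>R c (i, j)))) (at q)"
      by (simp only:) (intro has_derivative_sum has_derivative_scaleR b 2)
    from dird_eq[OF this, of "axis 1 1"]
    have "partial 1 (taylor p n c) q = (\<Sum>j\<le>n. ((q$2 - p$2)^j / fact j) *\<^sub>R (\<Sum>i\<le>n. ((q$1 - p$1)^i / fact i) *\<^sub>R c (Suc i, j)))"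
      by (simp add: partial_dird)
    also have "\<dots> = taylor p n (\<lambda>(i, j). c (Suc i, j)) q"
      unfolding taylor_def by (subst sum.swap) (simp add: scaleR_sum_right mult.commute)
    finally show "partial 1 (taylor p n c) q = taylor p n (\<lambda>(i, j). c (Suc i, j)) q" .
  qed
  show "partial 2 (taylor p n c) = taylor p n (\<lambda>(i, j). c (i, Suc j))"
  proof
    fix q
    have "taylor p n c = (\<lambda>q. \<Sum>i\<le>n. ((q$1 - p$1)^i / fact i) *\<^sub>R (\<Sum>j\<le>n. ((q$2 - p$2)^j / fact j) *\<^sub>R c (i, j)))"
      unfolding taylor_def[abs_def] by (simp add: scaleR_sum_right)
    then have "(taylor p n c has_derivative (\<lambda>v. \<Sum>i\<le>n. ((q$1 - p$1)^i / fact i) *\<^sub>R (v$2 *\<^sub>R (\<Sum>j\<le>n. ((q$2 - p$2)^j / fact j) *\<^sub>R c (i, Suc j)))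
        + (v$1 *\<^sub>R (of_nat i * (q$1 - p$1)^(i - 1) / fact i)) *\<^sub>R (\<Sum>j\<le>n. ((q$2 - p$2)^j / fact j) *\<^sub>R c (i, j)))) (at q)"
      by (simp only:) (intro has_derivative_sum has_derivative_scaleR b 1)
    from dird_eq[OF this, of "axis 2 1"]
    show "partial 2 (taylor p n c) q = taylor p n (\<lambda>(i, j). c (i, Suc j)) q"
      by (simp add: partial_dird taylor_def scaleR_sum_right)
  qed
qed

lemma partial_taylor_at:
  assumes "low n c"
  shows "partial 1 (taylor p n (\<lambda>(i, j). c (a + i, b + j))) = taylor p n (\<lambda>(i, j). c (Suc a + i, b + j))"
    "partial 2 (taylor p n (\<lambda>(i, j). c (a + i, b + j))) = taylor p n (\<lambda>(i, j). c (a + i, Suc b + j))"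
    "taylor p n (\<lambda>(i, j). c (a + i, b + j)) p = c (a, b)"
proof -
  have low: "low n (\<lambda>(i, j). c (a + i, b + j))" using assms by (auto simp: low_def)
  show "partial 1 (taylor p n (\<lambda>(i, j). c (a + i, b + j))) = taylor p n (\<lambda>(i, j). c (Suc a + i, b + j))"
    "partial 2 (taylor p n (\<lambda>(i, j). c (a + i, b + j))) = taylor p n (\<lambda>(i, j). c (a + i, Suc b + j))"
    unfolding partial_taylor[OF low] by simp_all
qed (simp add: taylor_at)

text \<open>The operator \<open>\<partial>\<^sub>v\<close> on families of Taylor coefficients is onto: its equation is solved for the coefficient
  whose index is raised in a direction in which \<open>v\<close> does not vanish.\<close>

lemma solve_direction:
  fixes v :: base and a :: "nat \<times> nat \<Rightarrow> 'b::real_vector"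
  assumes "v \<noteq> 0"
  obtains c where "\<And>i j. v$1 *\<^sub>R c (Suc i, j) + v$2 *\<^sub>R c (i, Suc j) = a (i, j)"
proof (cases "v $ 1 = 0")
  case False
  define c where "c = rec_nat (\<lambda>j. 0) (\<lambda>i ci j. inverse (v$1) *\<^sub>R (a (i, j) - v$2 *\<^sub>R ci (Suc j)))"
  have "v$1 *\<^sub>R c (Suc i) j + v$2 *\<^sub>R c i (Suc j) = a (i, j)" for i j
    using False by (simp add: c_def)
  then show ?thesis by (intro that[of "\<lambda>(i, j). c i j"]) simp
next
  case True
  then have v2: "v $ 2 \<noteq> 0" using assms by (simp add: vec2_eq_iff)
  have "v$1 *\<^sub>R (case (Suc i, j) of (i, j) \<Rightarrow> inverse (v$2) *\<^sub>R a (i, j - 1)) +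
      v$2 *\<^sub>R (case (i, Suc j) of (i, j) \<Rightarrow> inverse (v$2) *\<^sub>R a (i, j - 1)) = a (i, j)" for i j
    using v2 True by simp
  then show ?thesis by (rule that)
qed

definition has_flow_at :: "base set \<Rightarrow> (base \<Rightarrow> base) \<Rightarrow> base \<Rightarrow> bool" where
  "has_flow_at D X p \<longleftrightarrow> (\<exists>e U \<phi>. p \<in> U \<and> local_flow D X e U \<phi>)"

text \<open>In the coordinates \<open>g\<close> the flow is translation by \<open>t v\<close>. Its domain is the preimage of a ball of half the
  available radius, which leaves room for short translations.\<close>

lemma straightened_flow:
  assumes pt: "point_transformation V g" and p: "p \<in> V"
  shows "has_flow_at V (\<lambda>q. dird v (inv_into V g) (g q)) p"
proof -
  let ?h = "inv_into V g"
  note g = pt_smooth[OF pt] and hg = pt_inv[OF pt]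
  have W: "open (g ` V)" by (rule smooth_on_open[OF g(2)])
  obtain r where r: "r > 0" "ball (g p) (2 * r) \<subseteq> g ` V"
  proof -
    obtain r where "r > 0" "ball (g p) r \<subseteq> g ` V" using W p by (meson imageI openE)
    then show ?thesis using that[of "r/2"] by simp
  qed
  define U where "U = V \<inter> g -` ball (g p) r"
  define e where "e = r / (norm v + 1)"
  have nv: "norm v + 1 > 0" using norm_ge_zero[of v] by linarith
  have e: "e > 0" using r nv by (simp add: e_def)
  have U: "open U" unfolding U_def by (rule continuous_open_preimage[OF smooth_on_continuous[OF g(1)] g(3)]) simp
  have UV: "U \<subseteq> V" by (auto simp: U_def)
  have gU: "smooth_on U g" by (rule smooth_on_subset[OF g(1) U UV])
  have inW: "g q + t *\<^sub>R v \<in> g ` V" if "t \<in> {-e<..<e}" "q \<in> U" for t q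
  proof -
    have "norm (t *\<^sub>R v) \<le> e * norm v" using that by (auto intro!: mult_right_mono)
    also have "\<dots> < e * (norm v + 1)" using e by simp
    also have "\<dots> = r" using nv by (simp add: e_def)
    finally have "dist (g p) (g q + t *\<^sub>R v) < 2 * r"
      using that(2) dist_triangle[of "g p" "g q + t *\<^sub>R v" "g q"] by (simp add: U_def dist_norm norm_minus_commute)
    then show ?thesis using r by auto
  qed
  define \<phi> where "\<phi> t q = ?h (g q + t *\<^sub>R v)" for t q
  have g\<phi>: "g (\<phi> t q) = g q + t *\<^sub>R v" "\<phi> t q \<in> V" if "t \<in> {-e<..<e}" "q \<in> U" for t q
    using inW[OF that] by (simp_all add: \<phi>_def f_inv_into_f inv_into_into)
  have "local_flow V (\<lambda>q. dird v ?h (g q)) e U \<phi>"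
    unfolding local_flow_def
  proof (intro conjI ballI e)
    have O: "open ({-e<..<e} \<times> U)" by (intro open_Times U) simp
    have "smooth_on ({-e<..<e} \<times> U) (\<lambda>x. g (snd x))"
      by (rule smooth_on_compose[OF smooth_on_bounded_linear[OF bounded_linear_snd O] gU]) auto
    then have "smooth_on ({-e<..<e} \<times> U) (\<lambda>x. g (snd x) + fst x *\<^sub>R v)"
      by (rule smooth_on_add) (intro smooth_on_scaleR smooth_on_const O smooth_on_bounded_linear bounded_linear_fst)
    then have "smooth_on ({-e<..<e} \<times> U) (\<lambda>x. ?h (g (snd x) + fst x *\<^sub>R v))"
      by (rule smooth_on_compose[OF _ g(2)]) (use inW in auto)
    then show "smooth_on ({-e<..<e} \<times> U) (\<lambda>(t, q). \<phi> t q)" by (simp add: \<phi>_def case_prod_unfold)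
    show "\<phi> 0 q = q" if "q \<in> U" for q using that UV by (auto simp: \<phi>_def hg)
    fix t assume t: "t \<in> {-e<..<e}"
    show "\<phi> t q \<in> V" if "q \<in> U" for q using g\<phi>(2)[OF t that] .
    show "((\<lambda>s. \<phi> s q) has_vector_derivative dird v ?h (g (\<phi> t q))) (at t)" if q: "q \<in> U" for q
    proof -
      have d: "?h differentiable (at (g q + t *\<^sub>R v))" by (rule smooth_on_differentiable[OF g(2) inW[OF t q]])
      have "((\<lambda>s. ?h (g q + s *\<^sub>R v)) has_derivative (\<lambda>s. dird (s *\<^sub>R v) ?h (g q + t *\<^sub>R v))) (at t)"
        by (rule has_derivative_compose[of "\<lambda>s. g q + s *\<^sub>R v" "\<lambda>s. s *\<^sub>R v", OF _ has_derivative_dird[OF d]])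
          (auto intro!: derivative_eq_intros)
      then show ?thesis
        unfolding has_vector_derivative_def g\<phi>(1)[OF t q]
        by (simp add: \<phi>_def linear_scale[OF dird_lin[OF d]])
    qed
    show "point_transformation U (\<phi> t)"
      unfolding point_transformation_def
    proof (intro conjI)
      show "smooth_on U (\<phi> t)"
        unfolding \<phi>_def[abs_def]
        by (rule smooth_on_compose[OF _ g(2)], intro smooth_on_add gU smooth_on_const U) (use inW t in auto)
      show inj: "inj_on (\<phi> t) U"
      proof (rule inj_onI)
        fix x y assume xy: "x \<in> U" "y \<in> U" "\<phi> t x = \<phi> t y"
        then have "g x = g y" using g\<phi>(1)[OF t xy(1)] g\<phi>(1)[OF t xy(2)] by simp
        then show "x = y" using hg xy UV by (metis subsetD)
      qed
      have im: "\<phi> t ` U = V \<inter> (\<lambda>y. g y - t *\<^sub>R v) -` (g ` U)"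
      proof (intro equalityI subsetI)
        fix y assume "y \<in> V \<inter> (\<lambda>y. g y - t *\<^sub>R v) -` (g ` U)"
        then obtain q where q: "y \<in> V" "q \<in> U" "g y = g q + t *\<^sub>R v" by (auto simp: algebra_simps)
        then have "\<phi> t q = y" unfolding \<phi>_def using hg[OF q(1)] by simp
        then show "y \<in> \<phi> t ` U" using q(2) by auto
      qed (use g\<phi>[OF t] in auto)
      have oim: "open (\<phi> t ` U)" unfolding im
        by (rule continuous_open_preimage[OF _ g(3) pt_image_open[OF pt UV U]])
          (intro continuous_intros smooth_on_continuous g)
      have "smooth_on (\<phi> t ` U) (\<lambda>y. ?h (g y - t *\<^sub>R v))"
      proof (rule smooth_on_compose[OF _ g(2)])
        show "smooth_on (\<phi> t ` U) (\<lambda>y. g y - t *\<^sub>R v)"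
          by (intro smooth_on_diff smooth_on_const oim smooth_on_subset[OF g(1) oim]) (auto simp: im)
      qed (use UV in \<open>auto simp: im\<close>)
      then show "smooth_on (\<phi> t ` U) (inv_into U (\<phi> t))"
      proof (rule smooth_on_cong)
        fix y assume "y \<in> \<phi> t ` U"
        then obtain q where q: "q \<in> U" "y = \<phi> t q" by auto
        then show "?h (g y - t *\<^sub>R v) = inv_into U (\<phi> t) y"
          using g\<phi>(1)[OF t q(1)] hg[of q] UV by (auto simp: inv_into_f_f[OF inj])
      qed
    qed
  qed
  moreover have "p \<in> U" using p r by (simp add: U_def)
  ultimately show ?thesis unfolding has_flow_at_def by blast
qed

lemma partial_cong:
  "open S \<Longrightarrow> x \<in> S \<Longrightarrow> (\<And>y. y \<in> S \<Longrightarrow> f y = g y) \<Longrightarrow> partial i f x = partial i g x"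
  unfolding partial_dird by (rule dird_cong)

text \<open>The right-hand sides have \<open>\<partial>\<^sub>1\<close> outside of \<open>\<partial>\<^sub>2\<close>, which is the order used in \<open>mderiv\<close>.\<close>

lemma partial_commute:
  fixes h :: "base \<Rightarrow> real^'n"
  assumes h: "smooth_on D h"
  shows "q \<in> D \<Longrightarrow> partial 2 (partial 1 h) q = partial 1 (partial 2 h) q"
    "q \<in> D \<Longrightarrow> partial 2 (partial 1 (partial 1 h)) q = partial 1 (partial 1 (partial 2 h)) q"
    "q \<in> D \<Longrightarrow> partial 2 (partial 1 (partial 2 h)) q = partial 1 (partial 2 (partial 2 h)) q"
proof -
  have c: "partial 2 (partial 1 h) q = partial 1 (partial 2 h) q" if "smooth_on D h" "q \<in> D" for h :: "base \<Rightarrow> real^'n" and q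
    unfolding partial_dird by (rule dird_commute_vec[OF that])
  show "q \<in> D \<Longrightarrow> partial 2 (partial 1 h) q = partial 1 (partial 2 h) q" by (rule c[OF h])
  assume q: "q \<in> D"
  have "partial 2 (partial 1 (partial 1 h)) q = partial 1 (partial 2 (partial 1 h)) q"
    by (rule c[OF smooth_on_partial[OF h] q])
  also have "\<dots> = partial 1 (partial 1 (partial 2 h)) q"
    by (rule partial_cong[OF smooth_on_open[OF h] q c[OF h]])
  finally show "partial 2 (partial 1 (partial 1 h)) q = partial 1 (partial 1 (partial 2 h)) q" .
  show "partial 2 (partial 1 (partial 2 h)) q = partial 1 (partial 2 (partial 2 h)) q"
    by (rule c[OF smooth_on_partial[OF h] q])
qed

text \<open>The product rule for \<open>\<partial>\<^sub>X h\<close>. Both a straightened field, which satisfies \<open>X = v - \<partial>\<^sub>X h\<close>, and the Lie bracket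
  \<open>\<partial>\<^sub>X Y - \<partial>\<^sub>Y X\<close> are of this form.\<close>

lemma directional_leibniz:
  fixes X h :: "base \<Rightarrow> base"
  assumes X: "smooth_on V X" and h: "smooth_on V h" and R: "\<And>q. q \<in> V \<Longrightarrow> R q = X q $ 1 *\<^sub>R partial 1 h q + X q $ 2 *\<^sub>R partial 2 h q"
  shows "smooth_on V R"
    and "\<And>i q. q \<in> V \<Longrightarrow> partial i R q = X q $ 1 *\<^sub>R partial i (partial 1 h) q + partial i X q $ 1 *\<^sub>R partial 1 h q
      + (X q $ 2 *\<^sub>R partial i (partial 2 h) q + partial i X q $ 2 *\<^sub>R partial 2 h q)"
    and "\<And>i j q. q \<in> V \<Longrightarrow> partial j (partial i R) q = X q $ 1 *\<^sub>R partial j (partial i (partial 1 h)) q + partial j X q $ 1 *\<^sub>R partial i (partial 1 h) q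
      + (partial i X q $ 1 *\<^sub>R partial j (partial 1 h) q + partial j (partial i X) q $ 1 *\<^sub>R partial 1 h q)
      + (X q $ 2 *\<^sub>R partial j (partial i (partial 2 h)) q + partial j X q $ 2 *\<^sub>R partial i (partial 2 h) q
      + (partial i X q $ 2 *\<^sub>R partial j (partial 2 h) q + partial j (partial i X) q $ 2 *\<^sub>R partial 2 h q))"
    and "\<And>i j k q. q \<in> V \<Longrightarrow> partial k (partial j (partial i R)) q = X q $ 1 *\<^sub>R partial k (partial j (partial i (partial 1 h))) q + partial k X q $ 1 *\<^sub>R partial j (partial i (partial 1 h)) q
      + (partial j X q $ 1 *\<^sub>R partial k (partial i (partial 1 h)) q + partial k (partial j X) q $ 1 *\<^sub>R partial i (partial 1 h) q)
      + (partial i X q $ 1 *\<^sub>R partial k (partial j (partial 1 h)) q + partial k (partial i X) q $ 1 *\<^sub>R partial j (partial 1 h) q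
      + (partial j (partial i X) q $ 1 *\<^sub>R partial k (partial 1 h) q + partial k (partial j (partial i X)) q $ 1 *\<^sub>R partial 1 h q))
      + (X q $ 2 *\<^sub>R partial k (partial j (partial i (partial 2 h))) q + partial k X q $ 2 *\<^sub>R partial j (partial i (partial 2 h)) q
      + (partial j X q $ 2 *\<^sub>R partial k (partial i (partial 2 h)) q + partial k (partial j X) q $ 2 *\<^sub>R partial i (partial 2 h) q)
      + (partial i X q $ 2 *\<^sub>R partial k (partial j (partial 2 h)) q + partial k (partial i X) q $ 2 *\<^sub>R partial j (partial 2 h) q
      + (partial j (partial i X) q $ 2 *\<^sub>R partial k (partial 2 h) q + partial k (partial j (partial i X)) q $ 2 *\<^sub>R partial 2 h q)))"
proof -
  have V: "open V" using X smooth_on_open by blast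
  have add: "partial i (\<lambda>q. f q + k q) q = partial i f q + partial i k q"
    if "smooth_on V f" "smooth_on V k" "q \<in> V" for f k :: "base \<Rightarrow> base" and i q
    unfolding partial_dird by (rule dird_add) (use that smooth_on_differentiable in auto)
  have nth: "partial i (\<lambda>q. f q $ n) q = partial i f q $ n" if "smooth_on V f" "q \<in> V" for f :: "base \<Rightarrow> base" and i q n
    by (rule partial_nth[OF smooth_on_differentiable[OF that]])
  have sc: "partial i (\<lambda>q. f q $ n *\<^sub>R k q) q = f q $ n *\<^sub>R partial i k q + partial i f q $ n *\<^sub>R k q"
    if "smooth_on V f" "smooth_on V k" "q \<in> V" for f k :: "base \<Rightarrow> base" and i q n
    using dird_bilinear[OF bounded_bilinear_scaleR smooth_on_differentiable[OF smooth_on_nth[OF that(1)] that(3)]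
        smooth_on_differentiable[OF that(2,3)], of "axis i 1" n] nth[OF that(1,3), of i n] by (simp add: partial_dird)
  note sm = smooth_on_partial X h smooth_on_nth smooth_on_add smooth_on_scaleR
  show Rs: "smooth_on V R"
    by (rule smooth_on_cong[of _ "\<lambda>q. X q $ 1 *\<^sub>R partial 1 h q + X q $ 2 *\<^sub>R partial 2 h q"])
      (simp_all add: sm R)
  show R1: "partial i R q = X q $ 1 *\<^sub>R partial i (partial 1 h) q + partial i X q $ 1 *\<^sub>R partial 1 h q
      + (X q $ 2 *\<^sub>R partial i (partial 2 h) q + partial i X q $ 2 *\<^sub>R partial 2 h q)" if "q \<in> V" for i q
    by (subst partial_cong[OF V that R]) (use that in \<open>simp_all add: add sc sm\<close>)
  show R2: "partial j (partial i R) q = X q $ 1 *\<^sub>R partial j (partial i (partial 1 h)) q + partial j X q $ 1 *\<^sub>R partial i (partial 1 h) q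
      + (partial i X q $ 1 *\<^sub>R partial j (partial 1 h) q + partial j (partial i X) q $ 1 *\<^sub>R partial 1 h q)
      + (X q $ 2 *\<^sub>R partial j (partial i (partial 2 h)) q + partial j X q $ 2 *\<^sub>R partial i (partial 2 h) q
      + (partial i X q $ 2 *\<^sub>R partial j (partial 2 h) q + partial j (partial i X) q $ 2 *\<^sub>R partial 2 h q))" if "q \<in> V" for i j q
    by (subst partial_cong[OF V that R1]) (use that in \<open>simp_all add: add sc sm\<close>)
  show "partial k (partial j (partial i R)) q = X q $ 1 *\<^sub>R partial k (partial j (partial i (partial 1 h))) q + partial k X q $ 1 *\<^sub>R partial j (partial i (partial 1 h)) q
      + (partial j X q $ 1 *\<^sub>R partial k (partial i (partial 1 h)) q + partial k (partial j X) q $ 1 *\<^sub>R partial i (partial 1 h) q)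
      + (partial i X q $ 1 *\<^sub>R partial k (partial j (partial 1 h)) q + partial k (partial i X) q $ 1 *\<^sub>R partial j (partial 1 h) q
      + (partial j (partial i X) q $ 1 *\<^sub>R partial k (partial 1 h) q + partial k (partial j (partial i X)) q $ 1 *\<^sub>R partial 1 h q))
      + (X q $ 2 *\<^sub>R partial k (partial j (partial i (partial 2 h))) q + partial k X q $ 2 *\<^sub>R partial j (partial i (partial 2 h)) q
      + (partial j X q $ 2 *\<^sub>R partial k (partial i (partial 2 h)) q + partial k (partial j X) q $ 2 *\<^sub>R partial i (partial 2 h) q)
      + (partial i X q $ 2 *\<^sub>R partial k (partial j (partial 2 h)) q + partial k (partial i X) q $ 2 *\<^sub>R partial j (partial 2 h) q
      + (partial j (partial i X) q $ 2 *\<^sub>R partial k (partial 2 h) q + partial k (partial j (partial i X)) q $ 2 *\<^sub>R partial 2 h q)))"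
    if "q \<in> V" for i j k q
    by (subst partial_cong[OF V that R2]) (use that in \<open>simp_all add: add sc sm\<close>)
qed

text \<open>The field is straightened by \<open>g = id + h\<close>, where \<open>h\<close> has no terms of order below three. Then
  \<open>X = v - \<partial>\<^sub>X h\<close>, and up to order three its jet at \<open>p\<close> agrees with that of \<open>v - \<partial>\<^sub>v h\<close>, which can be prescribed since \<open>v \<noteq> 0\<close>.\<close>

lemma field_with_flow:
  fixes a :: "base coeffs"
  assumes "a (0, 0) \<noteq> 0" "a (1, 0) = 0" "a (0, 1) = 0"
  obtains D X where "p \<in> D" "smooth_on D X" "has_flow_at D X p"
    "\<And>i j. i + j \<le> 3 \<Longrightarrow> mderiv (i, j) X p = a (i, j)"
proof -
  define v where "v = a (0, 0)"
  obtain c' :: "base coeffs" where c': "\<And>i j. v$1 *\<^sub>R c' (Suc i, j) + v$2 *\<^sub>R c' (i, Suc j) = - a (i, j)"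
    using solve_direction[of v "\<lambda>I. - a I"] assms(1) unfolding v_def by metis
  \<comment> \<open>orders \<open>3\<close> and \<open>4\<close> suffice: \<open>\<partial>\<^sub>v\<close> lowers the order by one, and orders \<open>2\<close> and \<open>3\<close> are to be prescribed\<close>
  define c where "c = (\<lambda>(i, j). if 3 \<le> i + j \<and> i + j \<le> 4 then c' (i, j) else 0)"
  define h where "h = taylor p 4 c"
  define g where "g q = q + h q" for q
  have low: "low 4 c" by (auto simp: low_def c_def)
  have hs: "smooth_on UNIV h" unfolding h_def by (rule smooth_on_taylor)
  have gs: "smooth_on UNIV g" unfolding g_def[abs_def] by (intro smooth_on_add hs smooth_on_ident open_UNIV)
  have dg: "dird w g q = w + dird w h q" for w q
    unfolding g_def[abs_def]
    using dird_add[of "\<lambda>q. q" q h w] smooth_on_differentiable[OF hs, of q] dird_eq[OF has_derivative_ident, of w q] by simp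
  define T where "T a b = taylor p 4 (\<lambda>(i, j). c (a + i, b + j))" for a b
  have T: "partial 1 (T a b) = T (Suc a) b" "partial 2 (T a b) = T a (Suc b)" "T a b p = c (a, b)" for a b
    unfolding T_def by (rule partial_taylor_at[OF low])+
  have hT: "h = T 0 0" by (simp add: h_def T_def)
  have h0: "h p = 0" "partial i h p = 0" "partial i (partial j h) p = 0" for i j
    using exhaust_2[of i] exhaust_2[of j] unfolding hT by (auto simp: T c_def)
  have cv: "c (i, j) = c' (i, j)" if "i + j = 3 \<or> i + j = 4" for i j using that by (auto simp: c_def)
  have h3: "v$1 *\<^sub>R partial 1 (partial 1 (partial 1 h)) p + v$2 *\<^sub>R partial 1 (partial 1 (partial 2 h)) p = - a (2, 0)"
    "v$1 *\<^sub>R partial 1 (partial 2 (partial 1 h)) p + v$2 *\<^sub>R partial 1 (partial 2 (partial 2 h)) p = - a (1, 1)"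
    "v$1 *\<^sub>R partial 2 (partial 2 (partial 1 h)) p + v$2 *\<^sub>R partial 2 (partial 2 (partial 2 h)) p = - a (0, 2)"
    unfolding hT T using c'[of 2 0] c'[of 1 1] c'[of 0 2] by (simp_all add: cv eval_nat_numeral)
  have h4: "v$1 *\<^sub>R partial 1 (partial 1 (partial 1 (partial 1 h))) p + v$2 *\<^sub>R partial 1 (partial 1 (partial 1 (partial 2 h))) p = - a (3, 0)"
    "v$1 *\<^sub>R partial 1 (partial 1 (partial 2 (partial 1 h))) p + v$2 *\<^sub>R partial 1 (partial 1 (partial 2 (partial 2 h))) p = - a (2, 1)"
    "v$1 *\<^sub>R partial 1 (partial 2 (partial 2 (partial 1 h))) p + v$2 *\<^sub>R partial 1 (partial 2 (partial 2 (partial 2 h))) p = - a (1, 2)"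
    "v$1 *\<^sub>R partial 2 (partial 2 (partial 2 (partial 1 h))) p + v$2 *\<^sub>R partial 2 (partial 2 (partial 2 (partial 2 h))) p = - a (0, 3)"
    unfolding hT T using c'[of 3 0] c'[of 2 1] c'[of 1 2] c'[of 0 3] by (simp_all add: cv eval_nat_numeral)
  have "jac g p = 1" unfolding jac_def partial_dird dg using h0(2) by (simp add: partial_dird)
  then obtain V where V: "p \<in> V" "open V" "point_transformation V g"
    using local_point_transformation[OF gs, of p] by (metis UNIV_I zero_neq_one)
  define X where "X q = dird v (inv_into V g) (g q)" for q
  have fl: "has_flow_at V X p" unfolding X_def[abs_def] by (rule straightened_flow[OF V(3,1)])
  have Xs: "smooth_on V X" unfolding X_def[abs_def]
    by (rule smooth_on_compose[OF pt_smooth(1)[OF V(3)] smooth_on_dird[OF pt_smooth(2)[OF V(3)]]]) auto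
  have X: "X q = v - (X q $ 1 *\<^sub>R partial 1 h q + X q $ 2 *\<^sub>R partial 2 h q)" if "q \<in> V" for q
  proof -
    have "X q + dird (X q) h q = v" using pt_dird_inv[OF V(3) that, of v] unfolding X_def dg .
    then show ?thesis using dird_base[OF smooth_on_differentiable[OF hs UNIV_I], of "X q" q] by (simp add: algebra_simps)
  qed
  have hV: "smooth_on V h" by (rule smooth_on_subset[OF hs V(2)]) simp
  define R where "R q = X q $ 1 *\<^sub>R partial 1 h q + X q $ 2 *\<^sub>R partial 2 h q" for q
  note L = directional_leibniz[OF Xs hV R_def]
  have Rs: "smooth_on V R" by (rule L(1))
  have XR: "X q = v - R q" if "q \<in> V" for q using X[OF that] by (simp add: R_def)
  have X1: "partial i X q = - partial i R q" if "q \<in> V" for i q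
  proof -
    have "partial i X q = dird (axis i 1) (\<lambda>q. v - R q) q" unfolding partial_dird by (rule dird_cong[OF V(2) that XR])
    then show ?thesis using smooth_on_differentiable[OF Rs that] by (simp add: partial_dird dird_diff)
  qed
  have neg: "partial j (\<lambda>q. - f q) q = - partial j f q" if "smooth_on V f" "q \<in> V" for f :: "base \<Rightarrow> base" and j q
    unfolding partial_dird by (rule dird_minus[OF smooth_on_differentiable[OF that]])
  have X2: "partial j (partial i X) q = - partial j (partial i R) q" if "q \<in> V" for i j q
    using partial_cong[OF V(2) that X1, where i = j] neg[OF smooth_on_partial[OF Rs] that] by simp
  have X3: "partial k (partial j (partial i X)) q = - partial k (partial j (partial i R)) q" if "q \<in> V" for i j k q
    using partial_cong[OF V(2) that X2, where i = k] neg[OF smooth_on_partial[OF smooth_on_partial[OF Rs]] that] by simp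
  have Xp: "X p = v" using XR[OF V(1)] h0 by (simp add: R_def)
  have X1p: "partial i X p = 0" for i using X1[OF V(1)] L(2)[OF V(1)] h0 by simp
  have X2p: "partial j (partial i X) p = - (v $ 1 *\<^sub>R partial j (partial i (partial 1 h)) p + v $ 2 *\<^sub>R partial j (partial i (partial 2 h)) p)" for i j
    by (subst X2[OF V(1)], subst L(3)[OF V(1)]) (simp add: h0 Xp X1p)
  have X3p: "partial k (partial j (partial i X)) p = - (v $ 1 *\<^sub>R partial k (partial j (partial i (partial 1 h))) p
      + v $ 2 *\<^sub>R partial k (partial j (partial i (partial 2 h))) p)" for i j k
    by (subst X3[OF V(1)], subst L(4)[OF V(1)]) (simp add: h0 Xp X1p)
  have "mderiv (i, j) X p = a (i, j)" if ij: "i + j \<le> 3" for i j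
  proof -
    have "i = 0 \<or> i = 1 \<or> i = 2 \<or> i = 3" "j = 0 \<or> j = 1 \<or> j = 2 \<or> j = 3" using ij by linarith+
    then consider "i = 0" "j = 0" | "i = 1" "j = 0" | "i = 0" "j = 1" | "i = 2" "j = 0" | "i = 1" "j = 1" | "i = 0" "j = 2"
      | "i = 3" "j = 0" | "i = 2" "j = 1" | "i = 1" "j = 2" | "i = 0" "j = 3" using ij by linarith
    then show ?thesis
    proof cases
      case 1 then show ?thesis by (simp add: mderiv_simps Xp v_def)
    next
      case 2 then show ?thesis using assms by (simp add: mderiv_simps X1p)
    next
      case 3 then show ?thesis using assms by (simp add: mderiv_simps X1p)
    next
      case 4 then show ?thesis using h3(1) by (simp add: mderiv_simps X2p)
    next
      case 5 then show ?thesis using h3(2) by (simp add: mderiv_simps X2p)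
    next
      case 6 then show ?thesis using h3(3) by (simp add: mderiv_simps X2p)
    next
      case 7 then show ?thesis using h4(1) by (simp add: mderiv_simps X3p)
    next
      case 8 then show ?thesis using h4(2) by (simp add: mderiv_simps X3p)
    next
      case 9 then show ?thesis using h4(3) by (simp add: mderiv_simps X3p)
    next
      case 10 then show ?thesis using h4(4) by (simp add: mderiv_simps X3p)
    qed
  qed
  then show ?thesis using that V(1) Xs fl by blast
qed

section \<open>Isotropy spaces\<close>

lemma coeff_eqI: "(\<And>i j. a (i, j) = b (i, j)) \<Longrightarrow> a = (b :: nat \<times> nat \<Rightarrow> 'b)"
  by (simp add: fun_eq_iff)

lemma has_velocity_unique:
  assumes "has_velocity c w" "has_velocity c w'"
  shows "w = w'"
proof (rule prod_eqI)
  show "fst w = fst w'" using assms unfolding has_velocity_def by (meson vector_derivative_unique_at)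
  show "snd w = snd w'"
  proof
    fix I
    have "((\<lambda>t. snd (c t) I) has_vector_derivative snd w I) (at 0)" "((\<lambda>t. snd (c t) I) has_vector_derivative snd w' I) (at 0)"
      using assms unfolding has_velocity_def by blast+
    then show "snd w I = snd w' I" by (rule vector_derivative_unique_at)
  qed
qed

lemma fst_jet [simp]: "fst (jet k S p) = p"
  by (simp add: jet_def)

lemma jet_proj_jet: "r \<le> k \<Longrightarrow> jet_proj r (jet k S p) = jet r S p"
  by (auto simp: jet_proj_def jet_def trunc_def mjet_def fun_eq_iff)

lemma mjet_eqD: "mjet k h p = mjet k h' p \<Longrightarrow> i + j \<le> k \<Longrightarrow> mderiv (i, j) h p = mderiv (i, j) h' p"
  by (drule fun_cong[of _ _ "(i, j)"]) (simp add: mjet_def)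

lemma jet_eqD: "jet k S p = jet k S' p \<Longrightarrow> i + j \<le> k \<Longrightarrow>
    mderiv (i, j) (\<lambda>q. snd (S q)) p = mderiv (i, j) (\<lambda>q. snd (S' q)) p"
  using mjet_eqD by (force simp: jet_def)

text \<open>In \<open>infl\<close> the coordinates \<open>u\<close> multiply only the first derivatives \<open>a, b\<close> of the field. Where these vanish, the
  derivatives of \<open>u\<close> drop out.\<close>

lemma infl_partial:
  assumes sm: "smooth_on V u" "smooth_on V a" "smooth_on V b" "smooth_on V k" "smooth_on V l" "smooth_on V m"
    and p: "p \<in> V" and 0: "a p = 0" "b p = 0"
  shows "partial i (\<lambda>q. infl (u q) (a q) (b q) (k q) (l q) (m q)) p
    = infl (u p) (partial i a p) (partial i b p) (partial i k p) (partial i l p) (partial i m p)"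
proof -
  have V: "open V" using sm(1) smooth_on_open by blast
  have dn: "(\<lambda>q. f q $ n) differentiable (at p)" if "smooth_on V f" for f :: "base \<Rightarrow> real^'n" and n
    by (rule smooth_on_differentiable[OF smooth_on_nth[OF that] p])
  note d = sm[THEN dn]
  have pn: "dird v f p $ n = dird v (\<lambda>q. f q $ n) p" if "smooth_on V f" for f :: "base \<Rightarrow> real^'n" and n v
    by (rule dird_nth[symmetric]) (rule smooth_on_differentiable[OF that p])
  have "smooth_on V (\<lambda>q. infl (u q) (a q) (b q) (k q) (l q) (m q))"
    unfolding infl_def
    by (intro smooth_on_vec4 smooth_on_add smooth_on_diff smooth_on_minus smooth_on_mult smooth_on_nth smooth_on_const V sm)
  note I = pn[OF this]
  note dr = dird_add dird_diff dird_minus dird_mult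
  show ?thesis
    unfolding vec4_eq_iff partial_dird I
    unfolding infl_def vec4_nth sm[THEN pn]
    by (intro conjI) (simp_all add: dr d 0)
qed

context
  fixes D D' U :: "base set" and X :: "base \<Rightarrow> base" and e :: real and \<phi> :: "real \<Rightarrow> base \<Rightarrow> base"
    and S :: "base \<Rightarrow> total" and p :: base
  assumes lf: "local_flow D X e U \<phi>" and S: "local_section D' S" and p: "p \<in> U" "p \<in> D'"
begin

lemma flow_point_velocity: "((\<lambda>t. \<phi> t p) has_vector_derivative X p) (at 0)"
proof -
  have "0 < e" "\<phi> 0 p = p" using lf p unfolding local_flow_def by auto
  moreover have "\<forall>t\<in>{-e<..<e}. \<forall>q\<in>U. ((\<lambda>s. \<phi> s q) has_vector_derivative X (\<phi> t q)) (at t)"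
    using lf unfolding local_flow_def by blast
  ultimately show ?thesis using p(1) by (metis greaterThanLessThan_iff neg_less_0_iff_less)
qed

text \<open>The lift to jets is defined by a chosen representative, common to all times, and the velocities below
  depend only on its jet.\<close>

lemma lift_representative:
  obtains S' D'' where "local_section D'' S'" "p \<in> D''" "jet k S' p = jet k S p"
    "\<And>t. lift k U (\<phi> t) (jet k S p) = jet k (transform U (\<phi> t) S') (\<phi> t p)"
proof -
  define S' where "S' = (SOME S'. \<exists>D. local_section D S' \<and> p \<in> D \<and> jet k S' p = jet k S p)"
  have "\<exists>D. local_section D S' \<and> p \<in> D \<and> jet k S' p = jet k S p"
    unfolding S'_def
    by (rule someI[of "\<lambda>S'. \<exists>D. local_section D S' \<and> p \<in> D \<and> jet k S' p = jet k S p" S]) (use S p in blast)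
  then show ?thesis using that unfolding lift_def S'_def Let_def fst_jet by blast
qed

lemma lift_velocity0:
  "has_velocity (\<lambda>t. lift 0 U (\<phi> t) (jet 0 S p))
    (X p, \<lambda>I. if I = (0, 0) then infl (snd (S p)) (mderiv (1, 0) X p) (mderiv (0, 1) X p) (mderiv (2, 0) X p)
      (mderiv (1, 1) X p) (mderiv (0, 2) X p) else 0)"
proof -
  obtain S' D'' where S': "local_section D'' S'" "p \<in> D''" "jet 0 S' p = jet 0 S p"
    "\<And>t. lift 0 U (\<phi> t) (jet 0 S p) = jet 0 (transform U (\<phi> t) S') (\<phi> t p)"
    using lift_representative by metis
  have u: "snd (S' p) = snd (S p)" using jet_eqD[OF S'(3), of 0 0] by (simp add: mderiv_simps)
  show ?thesis
    unfolding has_velocity_def S'(4)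
    using flow_velocity(1)[OF lf S'(1) p(1) S'(2)] flow_point_velocity u
    by (auto simp: jet_def mjet_def mderiv_simps has_nth_derivative_iff)
qed

lemma lift_velocity1:
  assumes X: "smooth_on D X" "mderiv (1, 0) X p = 0" "mderiv (0, 1) X p = 0"
  shows "has_velocity (\<lambda>t. lift 1 U (\<phi> t) (jet 1 S p))
    (X p, \<lambda>I. if I = (0, 0) then infl (snd (S p)) 0 0 (mderiv (2, 0) X p) (mderiv (1, 1) X p) (mderiv (0, 2) X p)
      else if I = (1, 0) then infl (snd (S p)) (mderiv (2, 0) X p) (mderiv (1, 1) X p)
        (mderiv (3, 0) X p) (mderiv (2, 1) X p) (mderiv (1, 2) X p)
      else if I = (0, 1) then infl (snd (S p)) (mderiv (1, 1) X p) (mderiv (0, 2) X p)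
        (mderiv (2, 1) X p) (mderiv (1, 2) X p) (mderiv (0, 3) X p) else 0)" (is "has_velocity _ (X p, ?w)")
proof -
  obtain S' D'' where S': "local_section D'' S'" "p \<in> D''" "jet 1 S' p = jet 1 S p"
    "\<And>t. lift 1 U (\<phi> t) (jet 1 S p) = jet 1 (transform U (\<phi> t) S') (\<phi> t p)"
    using lift_representative by metis
  have u: "snd (S' p) = snd (S p)" using jet_eqD[OF S'(3), of 0 0] by (simp add: mderiv_simps)
  have pD: "p \<in> D"
  proof -
    have "0 < e" "\<phi> 0 p = p" using lf p unfolding local_flow_def by auto
    moreover have "\<forall>t\<in>{-e<..<e}. \<forall>q\<in>U. \<phi> t q \<in> D" using lf unfolding local_flow_def by blast
    ultimately show ?thesis using p(1) by (metis greaterThanLessThan_iff neg_less_0_iff_less)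
  qed
  have X1: "partial i X p = 0" for i using exhaust_2[of i] X(2,3) by (auto simp: mderiv_simps)
  let ?O = "D \<inter> D''"
  have O: "open ?O" using smooth_on_open[OF X(1)] smooth_on_open[OF section_smooth[OF S'(1)]] by blast
  have XO: "smooth_on ?O X" by (rule smooth_on_subset[OF X(1) O]) simp
  have uO: "smooth_on ?O (\<lambda>q. snd (S' q))" by (rule smooth_on_subset[OF section_smooth[OF S'(1)] O]) simp
  have pO: "p \<in> ?O" using pD S'(2) by simp
  have I: "partial i (\<lambda>q. infl (snd (S' q)) (partial 1 X q) (partial 2 X q) (partial 1 (partial 1 X) q)
    (partial 1 (partial 2 X) q) (partial 2 (partial 2 X) q)) p = infl (snd (S p)) (partial i (partial 1 X) p) (partial i (partial 2 X) p)
      (partial i (partial 1 (partial 1 X)) p) (partial i (partial 1 (partial 2 X)) p) (partial i (partial 2 (partial 2 X)) p)" for i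
    using infl_partial[of ?O "\<lambda>q. snd (S' q)" "partial 1 X" "partial 2 X" "partial 1 (partial 1 X)" "partial 1 (partial 2 X)" "partial 2 (partial 2 X)" p i]
      uO XO pO X1 u by (simp add: smooth_on_partial)
  note V = flow_velocity[OF lf S'(1) p(1) S'(2), unfolded has_nth_derivative_iff I X1 u zero_index scaleR_zero_left]
  note c = partial_commute[OF X(1) pD]
  have "((\<lambda>t. mjet 1 (\<lambda>y. snd (transform U (\<phi> t) S' y)) (\<phi> t p) (i, j)) has_vector_derivative ?w (i, j)) (at 0)" for i j
  proof -
    consider "i = 0" "j = 0" | "i = 1" "j = 0" | "i = 0" "j = 1" | "i + j > 1" by linarith
    then show ?thesis
    proof cases
      case 1 then show ?thesis using V(1) by (simp add: mjet_def mderiv_simps)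
    next
      case 2 then show ?thesis using V(2)[of 1] by (simp add: mjet_def mderiv_simps)
    next
      case 3 then show ?thesis using V(2)[of 2] by (simp add: mjet_def mderiv_simps c)
    next
      case 4 then show ?thesis by (auto simp: mjet_def)
    qed
  qed
  then show ?thesis
    unfolding has_velocity_def S'(4) using flow_point_velocity by (simp add: jet_def split_paired_all)
qed

end

lemma jet_differential_simps:
  assumes "local_section D S" "p \<in> D"
  shows "fst (jet_differential k S p v) = v"
    "i + j \<le> k \<Longrightarrow> snd (jet_differential k S p v) (i, j) =
      v$1 *\<^sub>R partial 1 (mderiv (i, j) (\<lambda>q. snd (S q))) p + v$2 *\<^sub>R partial 2 (mderiv (i, j) (\<lambda>q. snd (S q))) p"
    "\<not> i + j \<le> k \<Longrightarrow> snd (jet_differential k S p v) (i, j) = 0"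
proof -
  have pw: "smooth_on D ((partial i ^^ n) h)" if "smooth_on D h" for h :: "base \<Rightarrow> fibre" and i n
    using that by (induction n) (auto intro: smooth_on_partial)
  have sm: "smooth_on D (mderiv (i, j) (\<lambda>q. snd (S q)))" for i j
    unfolding mderiv_def by (intro pw section_smooth[OF assms(1)])
  show "fst (jet_differential k S p v) = v" by (simp add: jet_differential_def)
  show "snd (jet_differential k S p v) (i, j) =
      v$1 *\<^sub>R partial 1 (mderiv (i, j) (\<lambda>q. snd (S q))) p + v$2 *\<^sub>R partial 2 (mderiv (i, j) (\<lambda>q. snd (S q))) p" if "i + j \<le> k"
    using dird_base[OF smooth_on_differentiable[OF sm assms(2)], of v i j] that
    by (simp add: jet_differential_def jet_def mjet_def dird_def)
  show "snd (jet_differential k S p v) (i, j) = 0" if "\<not> i + j \<le> k"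
    using that by (simp add: jet_differential_def jet_def mjet_def)
qed

text \<open>Straightening needs a nonzero value at \<open>p\<close>, so the zero field is treated apart.\<close>

lemma zero_field_flow: "has_flow_at UNIV (\<lambda>_. 0) p"
  unfolding has_flow_at_def
proof (intro exI conjI)
  show "p \<in> UNIV" by simp
  show "local_flow UNIV (\<lambda>_. 0) 1 UNIV (\<lambda>t q. q)"
    unfolding local_flow_def point_transformation_def
    by (auto simp: case_prod_unfold smooth_on_ident inv_equality
        intro!: smooth_on_bounded_linear bounded_linear_snd open_Times smooth_on_cong[OF smooth_on_ident])
qed

text \<open>The jets to be realized by fields with a flow: the field is constant to first order, and if its value
  is zero, then it is the zero jet.\<close>

definition constant_start :: "nat \<Rightarrow> base coeffs \<Rightarrow> bool" where
  "constant_start k a \<longleftrightarrow> a (1, 0) = 0 \<and> a (0, 1) = 0 \<and> (\<forall>i j. k < i + j \<longrightarrow> a (i, j) = 0) \<and> (a (0, 0) = 0 \<longrightarrow> a = 0)"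

lemma constant_start_field:
  assumes "constant_start k a" "k \<le> 3"
  obtains D X where "p \<in> D" "smooth_on D X" "has_flow_at D X p" "mjet k X p = a"
proof (cases "a (0, 0) = 0")
  case True
  have "(partial i ^^ n) (\<lambda>_. 0 :: base) = (\<lambda>_. 0)" for i n
    by (induction n) (auto simp: partial_dird)
  moreover have "a = 0" using True assms by (simp add: constant_start_def)
  ultimately have "mjet k (\<lambda>_. 0) p = a" by (intro coeff_eqI) (simp add: mjet_def mderiv_def)
  then show ?thesis using that[of UNIV "\<lambda>_. 0"] zero_field_flow by (simp add: smooth_on_const)
next
  case False
  obtain D X where DX: "p \<in> D" "smooth_on D X" "has_flow_at D X p" "\<And>i j. i + j \<le> 3 \<Longrightarrow> mderiv (i, j) X p = a (i, j)"
    using field_with_flow[of a p] False assms unfolding constant_start_def by metis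
  have "mjet k X p = a"
    by (rule coeff_eqI) (use assms DX(4) in \<open>auto simp: mjet_def constant_start_def\<close>)
  then show ?thesis using that DX by blast
qed

lemma vjets_support: "a \<in> vjets k p \<Longrightarrow> k < i + j \<Longrightarrow> a (i, j) = 0"
  by (auto simp: vjets_def mjet_def)

lemma isotropy_iff:
  "a \<in> isotropy 0 (jet 1 S p) \<longleftrightarrow> (\<exists>D X w. a = mjet 2 X p \<and> p \<in> D \<and> smooth_on D X \<and>
    has_lift 0 D X (jet 0 S p) w \<and> w \<in> contact_plane 0 (jet 1 S p))"
  "a \<in> isotropy 1 (jet 2 S p) \<longleftrightarrow> (\<exists>D X w. a = mjet 3 X p \<and> p \<in> D \<and> smooth_on D X \<and>
    has_lift 1 D X (jet 1 S p) w \<and> w \<in> contact_plane 1 (jet 2 S p))"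
  unfolding isotropy_def fst_jet by (simp_all add: jet_proj_jet numeral_3_eq_3 numeral_2_eq_2)

lemma contact_plane_iff:
  "w \<in> contact_plane 0 (jet 1 S p) \<longleftrightarrow>
    (\<exists>D S' v. w = jet_differential 0 S' p v \<and> local_section D S' \<and> p \<in> D \<and> jet 1 S' p = jet 1 S p)"
  "w \<in> contact_plane 1 (jet 2 S p) \<longleftrightarrow>
    (\<exists>D S' v. w = jet_differential 1 S' p v \<and> local_section D S' \<and> p \<in> D \<and> jet 2 S' p = jet 2 S p)"
  unfolding contact_plane_def fst_jet by (simp_all add: numeral_2_eq_2)

context
  fixes D :: "base set" and S :: "base \<Rightarrow> total" and p :: base
  assumes S: "local_section D S" and p: "p \<in> D"
begin

text \<open>Membership provides some field, with some flow, and some section with the given jet. The velocity of the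
  lifted flow and the tangent plane are determined by the jets, so that the comparison of
  coordinates yields an equation between jets.\<close>

lemma isotropy0_D:
  assumes "a \<in> isotropy 0 (jet 1 S p)"
  shows "infl (fib S p) (a (1, 0)) (a (0, 1)) (a (2, 0)) (a (1, 1)) (a (0, 2)) = a (0, 0) $ 1 *\<^sub>R partial 1 (fib S) p + a (0, 0) $ 2 *\<^sub>R partial 2 (fib S) p"
proof -
  obtain D1 X w where X: "a = mjet 2 X p" "p \<in> D1" "smooth_on D1 X" "has_lift 0 D1 X (jet 0 S p) w" "w \<in> contact_plane 0 (jet 1 S p)"
    using assms unfolding isotropy_iff by blast
  obtain e U \<phi> where f: "p \<in> U" "local_flow D1 X e U \<phi>" "has_velocity (\<lambda>t. lift 0 U (\<phi> t) (jet 0 S p)) w"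
    using X(4) unfolding has_lift_def by auto
  note w = has_velocity_unique[OF f(3) lift_velocity0[OF f(2) S f(1) p]]
  obtain D2 S2 v where S2: "w = jet_differential 0 S2 p v" "local_section D2 S2" "p \<in> D2" "jet 1 S2 p = jet 1 S p"
    using X(5) unfolding contact_plane_iff by blast
  note jd = jet_differential_simps[OF S2(2,3), where k = 0 and v = v, folded S2(1)]
  have "v = X p" using jd(1) w by simp
  moreover have "partial 1 (\<lambda>q. snd (S2 q)) p = partial 1 (fib S) p" "partial 2 (\<lambda>q. snd (S2 q)) p = partial 2 (fib S) p"
    using jet_eqD[OF S2(4), of 1 0] jet_eqD[OF S2(4), of 0 1] by (simp_all add: mderiv_simps)
  ultimately show ?thesis
    using jd(2)[of 0 0] w X(1) by (simp add: mjet_def mderiv_simps)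
qed

text \<open>The two equations are those of order zero, differentiated along the two axes.\<close>

lemma isotropy1_D:
  assumes a: "a \<in> isotropy 1 (jet 2 S p)" "a (1, 0) = 0" "a (0, 1) = 0"
  shows "infl (fib S p) (a (2, 0)) (a (1, 1)) (a (3, 0)) (a (2, 1)) (a (1, 2)) = a (0, 0) $ 1 *\<^sub>R partial 1 (partial 1 (fib S)) p + a (0, 0) $ 2 *\<^sub>R partial 1 (partial 2 (fib S)) p"
    "infl (fib S p) (a (1, 1)) (a (0, 2)) (a (2, 1)) (a (1, 2)) (a (0, 3)) = a (0, 0) $ 1 *\<^sub>R partial 1 (partial 2 (fib S)) p + a (0, 0) $ 2 *\<^sub>R partial 2 (partial 2 (fib S)) p"
proof -
  obtain D1 X w where X: "a = mjet 3 X p" "p \<in> D1" "smooth_on D1 X" "has_lift 1 D1 X (jet 1 S p) w" "w \<in> contact_plane 1 (jet 2 S p)"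
    using a(1) unfolding isotropy_iff by blast
  obtain e U \<phi> where f: "p \<in> U" "local_flow D1 X e U \<phi>" "has_velocity (\<lambda>t. lift 1 U (\<phi> t) (jet 1 S p)) w"
    using X(4) unfolding has_lift_def by auto
  have X0: "mderiv (1, 0) X p = 0" "mderiv (0, 1) X p = 0" using a(2,3) X(1) by (simp_all add: mjet_def)
  note w = has_velocity_unique[OF f(3) lift_velocity1[OF f(2) S f(1) p X(3) X0]]
  obtain D2 S2 v where S2: "w = jet_differential 1 S2 p v" "local_section D2 S2" "p \<in> D2" "jet 2 S2 p = jet 2 S p"
    using X(5) unfolding contact_plane_iff by blast
  note jd = jet_differential_simps[OF S2(2,3), where k = 1 and v = v, folded S2(1)]
  have v: "v = X p" using jd(1) w by simp
  have e: "partial 1 (partial 1 (\<lambda>q. snd (S2 q))) p = partial 1 (partial 1 (fib S)) p" "partial 1 (partial 2 (\<lambda>q. snd (S2 q))) p = partial 1 (partial 2 (fib S)) p"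
      "partial 2 (partial 2 (\<lambda>q. snd (S2 q))) p = partial 2 (partial 2 (fib S)) p"
    using jet_eqD[OF S2(4), of 2 0] jet_eqD[OF S2(4), of 1 1] jet_eqD[OF S2(4), of 0 2] by (simp_all add: mderiv_simps)
  note c = partial_commute(1)[OF section_smooth[OF S2(2)] S2(3)]
  show "infl (fib S p) (a (2, 0)) (a (1, 1)) (a (3, 0)) (a (2, 1)) (a (1, 2)) = a (0, 0) $ 1 *\<^sub>R partial 1 (partial 1 (fib S)) p + a (0, 0) $ 2 *\<^sub>R partial 1 (partial 2 (fib S)) p"
    using jd(2)[of 1 0] w X(1) by (simp add: mjet_def mderiv_simps v e c)
  show "infl (fib S p) (a (1, 1)) (a (0, 2)) (a (2, 1)) (a (1, 2)) (a (0, 3)) = a (0, 0) $ 1 *\<^sub>R partial 1 (partial 2 (fib S)) p + a (0, 0) $ 2 *\<^sub>R partial 2 (partial 2 (fib S)) p"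
    using jd(2)[of 0 1] w X(1) by (simp add: mjet_def mderiv_simps v e c)
qed

text \<open>The tangent vector of \<open>j\<^sub>0S\<close> in the direction of the value of the field serves as witness.\<close>

lemma isotropy0_I:
  assumes a: "constant_start 2 a"
    and eq: "infl (fib S p) 0 0 (a (2, 0)) (a (1, 1)) (a (0, 2)) = a (0, 0) $ 1 *\<^sub>R partial 1 (fib S) p + a (0, 0) $ 2 *\<^sub>R partial 2 (fib S) p"
  shows "a \<in> isotropy 0 (jet 1 S p)" "a \<in> vjets 2 p"
proof -
  have le: "(2::nat) \<le> 3" by simp
  obtain D1 X where X: "p \<in> D1" "smooth_on D1 X" "has_flow_at D1 X p" "mjet 2 X p = a"
    by (rule constant_start_field[OF a le])
  show "a \<in> vjets 2 p" using X unfolding vjets_def by blast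
  obtain e U \<phi> where f: "p \<in> U" "local_flow D1 X e U \<phi>" using X(3) unfolding has_flow_at_def by blast
  have av: "a (i, j) = mderiv (i, j) X p" if "i + j \<le> 2" for i j using X(4) that by (auto simp: mjet_def)
  have a1: "a (1, 0) = 0" "a (0, 1) = 0" using a by (auto simp: constant_start_def)
  define w where "w = jet_differential 0 S p (X p)"
  note jd = jet_differential_simps[OF S p, where k = 0 and v = "X p", folded w_def]
  let ?w = "(X p, \<lambda>I. if I = (0, 0) then infl (snd (S p)) (mderiv (1, 0) X p) (mderiv (0, 1) X p) (mderiv (2, 0) X p)
      (mderiv (1, 1) X p) (mderiv (0, 2) X p) else 0)"
  have "w = ?w"
  proof (rule prod_eqI)
    show "snd w = snd ?w"
    proof (rule coeff_eqI)
      show "snd w (i, j) = snd ?w (i, j)" for i j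
        using jd(2)[of i j] jd(3)[of i j] eq a1 by (cases "i = 0 \<and> j = 0") (auto simp: av mderiv_simps)
    qed
  qed (simp add: jd)
  then have "has_lift 0 D1 X (jet 0 S p) w"
    using lift_velocity0[OF f(2) S f(1) p] f unfolding has_lift_def fst_jet by auto
  moreover have "w \<in> contact_plane 0 (jet 1 S p)" unfolding contact_plane_iff w_def using S p by blast
  ultimately show "a \<in> isotropy 0 (jet 1 S p)"
    unfolding isotropy_iff using X by blast
qed

lemma isotropy1_I:
  assumes a: "constant_start 3 a"
    and eq: "infl (fib S p) 0 0 (a (2, 0)) (a (1, 1)) (a (0, 2)) = a (0, 0) $ 1 *\<^sub>R partial 1 (fib S) p + a (0, 0) $ 2 *\<^sub>R partial 2 (fib S) p"
    "infl (fib S p) (a (2, 0)) (a (1, 1)) (a (3, 0)) (a (2, 1)) (a (1, 2)) = a (0, 0) $ 1 *\<^sub>R partial 1 (partial 1 (fib S)) p + a (0, 0) $ 2 *\<^sub>R partial 1 (partial 2 (fib S)) p"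
    "infl (fib S p) (a (1, 1)) (a (0, 2)) (a (2, 1)) (a (1, 2)) (a (0, 3)) = a (0, 0) $ 1 *\<^sub>R partial 1 (partial 2 (fib S)) p + a (0, 0) $ 2 *\<^sub>R partial 2 (partial 2 (fib S)) p"
  shows "a \<in> isotropy 1 (jet 2 S p)" "a \<in> vjets 3 p"
proof -
  obtain D1 X where X: "p \<in> D1" "smooth_on D1 X" "has_flow_at D1 X p" "mjet 3 X p = a"
    by (rule constant_start_field[OF a order_refl])
  show "a \<in> vjets 3 p" using X unfolding vjets_def by blast
  obtain e U \<phi> where f: "p \<in> U" "local_flow D1 X e U \<phi>" using X(3) unfolding has_flow_at_def by blast
  have av: "a (i, j) = mderiv (i, j) X p" if "i + j \<le> 3" for i j using X(4) that by (auto simp: mjet_def)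
  have a1: "a (1, 0) = 0" "a (0, 1) = 0" using a by (auto simp: constant_start_def)
  then have X1: "mderiv (1, 0) X p = 0" "mderiv (0, 1) X p = 0" using av by auto
  define w where "w = jet_differential 1 S p (X p)"
  note jd = jet_differential_simps[OF S p, where k = 1 and v = "X p", folded w_def]
  note c = partial_commute(1)[OF section_smooth[OF S] p]
  let ?w = "(X p, \<lambda>I. if I = (0, 0) then infl (snd (S p)) 0 0 (mderiv (2, 0) X p) (mderiv (1, 1) X p) (mderiv (0, 2) X p)
      else if I = (1, 0) then infl (snd (S p)) (mderiv (2, 0) X p) (mderiv (1, 1) X p)
        (mderiv (3, 0) X p) (mderiv (2, 1) X p) (mderiv (1, 2) X p)
      else if I = (0, 1) then infl (snd (S p)) (mderiv (1, 1) X p) (mderiv (0, 2) X p)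
        (mderiv (2, 1) X p) (mderiv (1, 2) X p) (mderiv (0, 3) X p) else 0)"
  have "w = ?w"
  proof (rule prod_eqI)
    show "snd w = snd ?w"
    proof (rule coeff_eqI)
      fix i j :: nat
      consider "i = 0" "j = 0" | "i = 1" "j = 0" | "i = 0" "j = 1" | "i + j > 1" by linarith
      then show "snd w (i, j) = snd ?w (i, j)"
      proof cases
        case 1 then show ?thesis using jd(2)[of 0 0] eq(1) by (simp add: av mderiv_simps)
      next
        case 2 then show ?thesis using jd(2)[of 1 0] eq(2) by (simp add: av mderiv_simps c)
      next
        case 3 then show ?thesis using jd(2)[of 0 1] eq(3) by (simp add: av mderiv_simps)
      next
        case 4 then show ?thesis using jd(3)[of i j] by auto
      qed
    qed
  qed (simp add: jd)
  then have "has_lift 1 D1 X (jet 1 S p) w"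
    using lift_velocity1[OF f(2) S f(1) p X(2) X1] f unfolding has_lift_def fst_jet by auto
  moreover have "w \<in> contact_plane 1 (jet 2 S p)" unfolding contact_plane_iff w_def using S p by blast
  ultimately show "a \<in> isotropy 1 (jet 2 S p)"
    unfolding isotropy_iff using X by blast
qed

end

section \<open>Horizontal spaces and the curvature form\<close>

definition vec2 :: "real \<Rightarrow> real \<Rightarrow> base" where
  "vec2 a b = (\<chi> i. if i = 1 then a else b)"

lemma vec2_nth [simp]: "vec2 a b $ 1 = a" "vec2 a b $ 2 = b"
  by (simp_all add: vec2_def)

text \<open>In both prolongation steps there are four unknown derivatives \<open>k, l, m, n\<close> of a field, eight
  unknown components in all, and the symbol is prescribed on \<open>(k, l, m)\<close> and on \<open>(l, m, n)\<close>, which are eight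
  equations. The functions below invert this system.\<close>

definition sol_k :: "real^4 \<Rightarrow> real^4 \<Rightarrow> base" where "sol_k c d = vec2 (2 * d$0 - c$1) (c$0)"
definition sol_l :: "real^4 \<Rightarrow> real^4 \<Rightarrow> base" where "sol_l c d = vec2 ((d$1 - 2 * c$2) / 3) (d$0)"
definition sol_m :: "real^4 \<Rightarrow> real^4 \<Rightarrow> base" where "sol_m c d = vec2 (- c$3) (c$2 + 2 * ((d$1 - 2 * c$2) / 3))"
definition sol_n :: "real^4 \<Rightarrow> real^4 \<Rightarrow> base" where "sol_n c d = vec2 (- d$3) (d$2 - 2 * c$3)"

lemmas sol_defs = sol_k_def sol_l_def sol_m_def sol_n_def

lemma symbol_system:
  "infl w 0 0 k l m = c \<and> infl w 0 0 l m n = d \<longleftrightarrow> k = sol_k c d \<and> l = sol_l c d \<and> m = sol_m c d \<and> n = sol_n c d"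
proof -
  have "m $ 2 - 2 * l $ 1 = c $ 2 \<and> 2 * m $ 2 - l $ 1 = d $ 1 \<longleftrightarrow>
      l $ 1 = (d $ 1 - 2 * c $ 2) / 3 \<and> m $ 2 = c $ 2 + 2 * ((d $ 1 - 2 * c $ 2) / 3)"
    by (auto simp: field_simps)
  then show ?thesis
    unfolding vec4_eq_iff vec2_eq_iff infl_def vec4_nth sol_defs vec2_nth zero_index by auto
qed

lemma infl_split: "infl w a b k l m = infl w a b 0 0 0 + infl w 0 0 k l m"
  unfolding vec4_eq_iff infl_def by simp

lemma sol_linear:
  "sol_k (c + c') (d + d') = sol_k c d + sol_k c' d'" "sol_k (r *\<^sub>R c) (r *\<^sub>R d) = r *\<^sub>R sol_k c d"
  "sol_l (c + c') (d + d') = sol_l c d + sol_l c' d'" "sol_l (r *\<^sub>R c) (r *\<^sub>R d) = r *\<^sub>R sol_l c d"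
  "sol_m (c + c') (d + d') = sol_m c d + sol_m c' d'" "sol_m (r *\<^sub>R c) (r *\<^sub>R d) = r *\<^sub>R sol_m c d"
  "sol_n (c + c') (d + d') = sol_n c d + sol_n c' d'" "sol_n (r *\<^sub>R c) (r *\<^sub>R d) = r *\<^sub>R sol_n c d"
  by (simp_all add: sol_defs vec2_eq_iff field_simps)

lemma infl_linear:
  "infl w (a + a') (b + b') 0 0 0 = infl w a b 0 0 0 + infl w a' b' 0 0 0"
  "infl w (r *\<^sub>R a) (r *\<^sub>R b) 0 0 0 = r *\<^sub>R infl w a b 0 0 0"
  by (simp_all add: infl_def vec4_eq_iff algebra_simps)

text \<open>The second and third order jets that span the horizontal spaces, in terms of the value \<open>u\<close> and the
  derivatives \<open>u1, u2, u11, u12, u22\<close> of a section. The auxiliary \<open>row1\<close>, \<open>row2\<close> collect the known terms of the two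
  equations for the third derivatives.\<close>

definition hjet2 :: "real^4 \<Rightarrow> real^4 \<Rightarrow> base \<Rightarrow> base coeffs" where
  "hjet2 u1 u2 v = (\<lambda>I. if I = (0, 0) then v
     else if I = (2, 0) then v$1 *\<^sub>R sol_k u1 u2 + v$2 *\<^sub>R sol_l u1 u2
     else if I = (1, 1) then v$1 *\<^sub>R sol_l u1 u2 + v$2 *\<^sub>R sol_m u1 u2
     else if I = (0, 2) then v$1 *\<^sub>R sol_m u1 u2 + v$2 *\<^sub>R sol_n u1 u2 else 0)"

definition row1 :: "real^4 \<Rightarrow> real^4 \<Rightarrow> real^4 \<Rightarrow> real^4 \<Rightarrow> real^4 \<Rightarrow> base \<Rightarrow> real^4" where
  "row1 u u1 u2 u11 u12 v = v$1 *\<^sub>R u11 + v$2 *\<^sub>R u12 - infl u (hjet2 u1 u2 v (2, 0)) (hjet2 u1 u2 v (1, 1)) 0 0 0"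

definition row2 :: "real^4 \<Rightarrow> real^4 \<Rightarrow> real^4 \<Rightarrow> real^4 \<Rightarrow> real^4 \<Rightarrow> base \<Rightarrow> real^4" where
  "row2 u u1 u2 u12 u22 v = v$1 *\<^sub>R u12 + v$2 *\<^sub>R u22 - infl u (hjet2 u1 u2 v (1, 1)) (hjet2 u1 u2 v (0, 2)) 0 0 0"

definition hjet3 :: "real^4 \<Rightarrow> real^4 \<Rightarrow> real^4 \<Rightarrow> real^4 \<Rightarrow> real^4 \<Rightarrow> real^4 \<Rightarrow> base \<Rightarrow> base coeffs" where
  "hjet3 u u1 u2 u11 u12 u22 v = (\<lambda>I. let c = row1 u u1 u2 u11 u12 v; d = row2 u u1 u2 u12 u22 v in
     if I = (3, 0) then sol_k c d else if I = (2, 1) then sol_l c d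
     else if I = (1, 2) then sol_m c d else if I = (0, 3) then sol_n c d else hjet2 u1 u2 v I)"

lemma linear_hjet2: "linear (hjet2 u1 u2)"
  by (rule linearI; rule coeff_eqI) (auto simp: hjet2_def scaleR_fun_def algebra_simps)

lemma linear_row: "linear (row1 u u1 u2 u11 u12)" "linear (row2 u u1 u2 u12 u22)"
  by (rule linearI; simp add: row1_def row2_def linear_add[OF linear_hjet2] linear_scale[OF linear_hjet2]
      scaleR_fun_def infl_linear algebra_simps)+

lemma linear_hjet3: "linear (hjet3 u u1 u2 u11 u12 u22)"
proof (rule linearI; rule coeff_eqI)
  fix v w and r :: real and i j :: nat
  let ?h = "hjet3 u u1 u2 u11 u12 u22"
  show "?h (v + w) (i, j) = (?h v + ?h w) (i, j)"
    unfolding hjet3_def Let_def linear_row[THEN linear_add] sol_linear linear_add[OF linear_hjet2] by simp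
  show "?h (r *\<^sub>R v) (i, j) = (r *\<^sub>R ?h v) (i, j)"
    unfolding hjet3_def Let_def linear_row[THEN linear_scale] sol_linear linear_scale[OF linear_hjet2] scaleR_fun_def by simp
qed

text \<open>A horizontal space is the graph of a linear map \<open>L\<close> from the tangent space of the base to jets.\<close>

lemma linear_base_expand:
  fixes L :: "base \<Rightarrow> 'b::real_vector"
  assumes "linear L"
  shows "L v = v$1 *\<^sub>R L (axis 1 1) + v$2 *\<^sub>R L (axis 2 1)"
proof -
  have "L v = L (v$1 *\<^sub>R axis 1 1 + v$2 *\<^sub>R axis 2 1)" using base_expand[of v] by simp
  then show ?thesis by (simp add: linear_add[OF assms] linear_scale[OF assms])
qed

context
  fixes L :: "base \<Rightarrow> base coeffs"
  assumes L: "linear L" "\<And>v. L v (0, 0) = v"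
begin

lemma graph_independent: "independent {L (axis 1 1), L (axis 2 1)}" "L (axis 1 1) \<noteq> L (axis 2 1)"
proof -
  have ne: "axis 1 1 \<noteq> r *\<^sub>R (axis 2 1 :: base)" "axis 2 1 \<noteq> (0::base)" for r by (simp_all add: vec2_eq_iff)
  show neq: "L (axis 1 1) \<noteq> L (axis 2 1)" using L(2) ne(1)[of 1] by (metis scaleR_one)
  have "L (axis 1 1) \<notin> span {L (axis 2 1)}"
  proof
    assume "L (axis 1 1) \<in> span {L (axis 2 1)}"
    then obtain r where "L (axis 1 1) = r *\<^sub>R L (axis 2 1)" by (auto simp: span_singleton)
    then have "L (axis 1 1) (0, 0) = r *\<^sub>R L (axis 2 1) (0, 0)" by (simp add: scaleR_fun_def)
    then show False using L(2) ne(1) by simp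
  qed
  moreover have "L (axis 2 1) \<noteq> 0" using L(2)[of "axis 2 1"] ne(2) by auto
  ultimately show "independent {L (axis 1 1), L (axis 2 1)}"
    by (simp add: independent_insert neq)
qed

lemma graph_span: "range L = span {L (axis 1 1), L (axis 2 1)}"
proof
  show "range L \<subseteq> span {L (axis 1 1), L (axis 2 1)}"
  proof (rule image_subsetI)
    fix v
    show "L v \<in> span {L (axis 1 1), L (axis 2 1)}"
      unfolding linear_base_expand[OF L(1), of v] by (intro span_add span_scale span_base) auto
  qed
  show "span {L (axis 1 1), L (axis 2 1)} \<subseteq> range L"
    by (rule span_minimal) (auto intro: linear_subspace_image[OF L(1)] subspace_UNIV)
qed

lemma graph_horizontal:
  assumes "range L \<subseteq> vjets k p"
  shows "horizontal k p (range L)"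
  unfolding horizontal_def
proof (intro conjI assms)
  show "subspace (range L)" by (rule linear_subspace_image[OF L(1) subspace_UNIV])
  show "dim (range L) = 2"
    unfolding graph_span using dim_span_eq_card_independent[OF graph_independent(1)] graph_independent(2) by simp
  show "rho ` range L = UNIV" by (auto simp: rho_def L(2) image_image)
qed

lemma graph_inv_into: "inv_into (range L) rho v = L v"
proof (rule inv_into_f_eq)
  show "inj_on rho (range L)" by (rule inj_onI) (auto simp: rho_def L(2))
qed (auto simp: rho_def L(2))

text \<open>The condition on brackets that defines \<open>H1\<close> speaks of the chosen lifts of vectors only. It determines the
  lifts of the two axes, and the dimension does the rest.\<close>

lemma graph_unique:
  assumes H: "subspace H" "dim H = 2" and h: "L (axis 1 1) \<in> H" "L (axis 2 1) \<in> H"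
  shows "H = range L"
proof
  show "range L \<subseteq> H" unfolding graph_span by (rule span_minimal) (use assms in auto)
  obtain C where C: "C \<subseteq> H" "independent C" "H \<subseteq> span C" "card C = dim H" using basis_exists by blast
  have fC: "finite C" using C(4) H(2) card.infinite by fastforce
  show "H \<subseteq> range L"
  proof
    fix x assume x: "x \<in> H"
    show "x \<in> range L"
    proof (rule ccontr)
      assume nx: "x \<notin> range L"
      then have ns: "x \<notin> span {L (axis 1 1), L (axis 2 1)}" by (simp add: graph_span)
      have ind: "independent (insert x {L (axis 1 1), L (axis 2 1)})"
        using ns graph_independent(1) by (simp add: independent_insertI)
      have "card (insert x {L (axis 1 1), L (axis 2 1)}) \<le> card C"
        using independent_span_bound[OF fC ind] x h C(3) by auto
      moreover have "card (insert x {L (axis 1 1), L (axis 2 1)}) = 3"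
      proof -
        have "x \<noteq> L (axis 1 1)" "x \<noteq> L (axis 2 1)" using nx by blast+
        then show ?thesis using graph_independent(2) by simp
      qed
      ultimately show False using C(4) H(2) by simp
    qed
  qed
qed

end

text \<open>In the product rule for \<open>\<partial>\<^sub>X Y - \<partial>\<^sub>Y X\<close> every term with a first derivative at \<open>p\<close> drops out.\<close>

lemma lie_bracket_jets:
  assumes X: "smooth_on V X" and Y: "smooth_on V Y" and p: "p \<in> V"
    and X0: "\<And>i. partial i X p = 0" and Y0: "\<And>i. partial i Y p = 0"
  shows "lie_bracket X Y p = 0"
    "partial i (lie_bracket X Y) p = X p $ 1 *\<^sub>R partial i (partial 1 Y) p + X p $ 2 *\<^sub>R partial i (partial 2 Y) p
       - (Y p $ 1 *\<^sub>R partial i (partial 1 X) p + Y p $ 2 *\<^sub>R partial i (partial 2 X) p)"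
    "partial j (partial i (lie_bracket X Y)) p = X p $ 1 *\<^sub>R partial j (partial i (partial 1 Y)) p + X p $ 2 *\<^sub>R partial j (partial i (partial 2 Y)) p
       - (Y p $ 1 *\<^sub>R partial j (partial i (partial 1 X)) p + Y p $ 2 *\<^sub>R partial j (partial i (partial 2 X)) p)"
proof -
  have V: "open V" using X smooth_on_open by blast
  define R where "R q = X q $ 1 *\<^sub>R partial 1 Y q + X q $ 2 *\<^sub>R partial 2 Y q" for q
  define R' where "R' q = Y q $ 1 *\<^sub>R partial 1 X q + Y q $ 2 *\<^sub>R partial 2 X q" for q
  have LB: "lie_bracket X Y q = R q - R' q" if "q \<in> V" for q
    using dird_base[OF smooth_on_differentiable[OF Y that], of "X q"] dird_base[OF smooth_on_differentiable[OF X that], of "Y q"]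
    by (simp add: lie_bracket_def R_def R'_def dird_def)
  note L = directional_leibniz[OF X Y R_def] and L' = directional_leibniz[OF Y X R'_def]
  note Rs = L(1) L'(1)
  have diff: "partial i (\<lambda>q. f q - g q) q = partial i f q - partial i g q" if "smooth_on V f" "smooth_on V g" "q \<in> V" for f g :: "base \<Rightarrow> base" and i q
    unfolding partial_dird by (rule dird_diff) (use that smooth_on_differentiable in auto)
  have L1: "partial i (lie_bracket X Y) q = partial i R q - partial i R' q" if "q \<in> V" for i q
    using partial_cong[OF V that LB, where i = i] diff[OF Rs that] by simp
  have L2: "partial j (partial i (lie_bracket X Y)) q = partial j (partial i R) q - partial j (partial i R') q" if "q \<in> V" for i j q
    using partial_cong[OF V that L1, where i = j] diff[OF Rs[THEN smooth_on_partial] that] by simp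
  show "lie_bracket X Y p = 0" using LB[OF p] by (simp add: R_def R'_def X0 Y0)
  show "partial i (lie_bracket X Y) p = X p $ 1 *\<^sub>R partial i (partial 1 Y) p + X p $ 2 *\<^sub>R partial i (partial 2 Y) p
       - (Y p $ 1 *\<^sub>R partial i (partial 1 X) p + Y p $ 2 *\<^sub>R partial i (partial 2 X) p)"
    unfolding L1[OF p] L(2)[OF p] L'(2)[OF p] by (simp add: X0 Y0)
  show "partial j (partial i (lie_bracket X Y)) p = X p $ 1 *\<^sub>R partial j (partial i (partial 1 Y)) p + X p $ 2 *\<^sub>R partial j (partial i (partial 2 Y)) p
       - (Y p $ 1 *\<^sub>R partial j (partial i (partial 1 X)) p + Y p $ 2 *\<^sub>R partial j (partial i (partial 2 X)) p)"
    unfolding L2[OF p] L(3)[OF p] L'(3)[OF p] by (simp add: X0 Y0)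
qed

lemma jet_rep_exists:
  assumes "a \<in> vjets k p"
  obtains D where "p \<in> D" "smooth_on D (jet_rep k p a)" "mjet k (jet_rep k p a) p = a"
proof -
  have "\<exists>h D. p \<in> D \<and> smooth_on D h \<and> mjet k h p = a" using assms by (auto simp: vjets_def)
  from someI_ex[OF this] show ?thesis using that unfolding jet_rep_def by blast
qed

text \<open>The bracket of two fields whose first derivatives vanish at \<open>p\<close>, in the orders one and two.\<close>

definition brk :: "base coeffs \<Rightarrow> base coeffs \<Rightarrow> nat \<Rightarrow> nat \<Rightarrow> base" where
  "brk a b i j = a (0, 0) $ 1 *\<^sub>R b (Suc i, j) + a (0, 0) $ 2 *\<^sub>R b (i, Suc j)
     - (b (0, 0) $ 1 *\<^sub>R a (Suc i, j) + b (0, 0) $ 2 *\<^sub>R a (i, Suc j))"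

lemma jet_bracket_brk:
  assumes a: "a \<in> vjets k p" "a (1, 0) = 0" "a (0, 1) = 0" and b: "b \<in> vjets k p" "b (1, 0) = 0" "b (0, 1) = 0"
    and k: "k = 2 \<or> k = 3" and ij: "i + j < k"
  shows "jet_bracket k p a b (i, j) = (if i = 0 \<and> j = 0 then 0 else brk a b i j)"
proof -
  define X where "X = jet_rep k p a"
  define Y where "Y = jet_rep k p b"
  obtain D1 where D1: "p \<in> D1" "smooth_on D1 X" "mjet k X p = a" unfolding X_def by (rule jet_rep_exists[OF a(1)])
  obtain D2 where D2: "p \<in> D2" "smooth_on D2 Y" "mjet k Y p = b" unfolding Y_def by (rule jet_rep_exists[OF b(1)])
  have O: "open (D1 \<inter> D2)" using D1(2) D2(2) smooth_on_open by blast
  have Xs: "smooth_on (D1 \<inter> D2) X" by (rule smooth_on_subset[OF D1(2) O]) simp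
  have Ys: "smooth_on (D1 \<inter> D2) Y" by (rule smooth_on_subset[OF D2(2) O]) simp
  have p: "p \<in> D1 \<inter> D2" using D1 D2 by simp
  have aX: "a (i, j) = mderiv (i, j) X p" if "i + j \<le> k" for i j using fun_cong[OF D1(3), of "(i, j)"] that by (simp add: mjet_def)
  have bY: "b (i, j) = mderiv (i, j) Y p" if "i + j \<le> k" for i j using fun_cong[OF D2(3), of "(i, j)"] that by (simp add: mjet_def)
  have X0: "partial n X p = 0" for n using exhaust_2[of n] a(2,3) aX[of 1 0] aX[of 0 1] k by (auto simp: mderiv_simps)
  have Y0: "partial n Y p = 0" for n using exhaust_2[of n] b(2,3) bY[of 1 0] bY[of 0 1] k by (auto simp: mderiv_simps)
  note L = lie_bracket_jets[OF Xs Ys p X0 Y0]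
  note cX = partial_commute[OF Xs p] and cY = partial_commute[OF Ys p]
  have jb: "jet_bracket k p a b (i, j) = mderiv (i, j) (lie_bracket X Y) p" using ij by (simp add: jet_bracket_def mjet_def X_def Y_def)
  have c4: "partial n (partial 2 (partial 1 X)) p = partial n (partial 1 (partial 2 X)) p"
    "partial n (partial 2 (partial 1 Y)) p = partial n (partial 1 (partial 2 Y)) p" for n
    by (rule partial_cong[OF O p partial_commute(1)[OF Xs]], assumption)
      (rule partial_cong[OF O p partial_commute(1)[OF Ys]], assumption)
  note av = aX[of "Suc i" j] aX[of i "Suc j"] aX[of 0 0] and bv = bY[of "Suc i" j] bY[of i "Suc j"] bY[of 0 0]
  consider "i = 0" "j = 0" | "i = 1" "j = 0" | "i = 0" "j = 1" | "k = 3" "i = 2" "j = 0" | "k = 3" "i = 1" "j = 1" | "k = 3" "i = 0" "j = 2"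
    using ij k by linarith
  then show ?thesis
  proof cases
    case 1 then show ?thesis unfolding jb by (simp add: mderiv_simps L)
  next
    case 2 then show ?thesis unfolding jb using k av bv
      by (auto simp: brk_def mderiv_simps mderiv_simps(4-6)[unfolded numeral_2_eq_2] L cX cY)
  next
    case 3 then show ?thesis unfolding jb using k av bv
      by (auto simp: brk_def mderiv_simps mderiv_simps(4-6)[unfolded numeral_2_eq_2] L cX cY)
  next
    case 4 then show ?thesis unfolding jb using av bv
      by (simp add: brk_def mderiv_simps mderiv_simps(4-10)[unfolded numeral_2_eq_2 numeral_3_eq_3] L cX cY c4 eval_nat_numeral)
  next
    case 5 then show ?thesis unfolding jb using av bv
      by (simp add: brk_def mderiv_simps mderiv_simps(4-10)[unfolded numeral_2_eq_2 numeral_3_eq_3] L cX cY c4 eval_nat_numeral)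
  next
    case 6 then show ?thesis unfolding jb using av bv
      by (simp add: brk_def mderiv_simps mderiv_simps(4-10)[unfolded numeral_2_eq_2 numeral_3_eq_3] L cX cY c4 eval_nat_numeral)
  qed
qed

lemma jet_bracket_high: "k - 1 < i + j \<Longrightarrow> jet_bracket k p a b (i, j) = 0"
  by (simp add: jet_bracket_def mjet_def)

text \<open>The classical Liouville expressions, as polynomials in the second order jet of a section.\<close>

definition liouville1 :: "real^4 \<Rightarrow> real^4 \<Rightarrow> real^4 \<Rightarrow> real^4 \<Rightarrow> real^4 \<Rightarrow> real^4 \<Rightarrow> real" where
  "liouville1 u u1 u2 u11 u12 u22 =
     u22$0 - 2/3 * u12$1 + 1/3 * u11$2 + u$3 * u1$0 + 2 * u$0 * u1$3 - u$0 * u2$2 - u$2 * u2$0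
      + 2/3 * u$1 * u2$1 - 1/3 * u$1 * u1$2"

definition liouville2 :: "real^4 \<Rightarrow> real^4 \<Rightarrow> real^4 \<Rightarrow> real^4 \<Rightarrow> real^4 \<Rightarrow> real^4 \<Rightarrow> real" where
  "liouville2 u u1 u2 u11 u12 u22 =
     u11$3 - 2/3 * u12$2 + 1/3 * u22$1 - u$0 * u2$3 - 2 * u$3 * u2$0 + u$3 * u1$1 + u$1 * u1$3
      - 2/3 * u$2 * u1$2 + 1/3 * u$2 * u2$1"

abbreviation liou1 :: "(base \<Rightarrow> real^4) \<Rightarrow> base \<Rightarrow> real" where
  "liou1 u p \<equiv> liouville1 (u p) (partial 1 u p) (partial 2 u p)
    (partial 1 (partial 1 u) p) (partial 1 (partial 2 u) p) (partial 2 (partial 2 u) p)"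

abbreviation liou2 :: "(base \<Rightarrow> real^4) \<Rightarrow> base \<Rightarrow> real" where
  "liou2 u p \<equiv> liouville2 (u p) (partial 1 u p) (partial 2 u p)
    (partial 1 (partial 1 u) p) (partial 1 (partial 2 u) p) (partial 2 (partial 2 u) p)"

text \<open>The six components depend on two numbers only; in other words, the bracket satisfies the linear equations
  that define the space \<open>g\<close>.\<close>

lemma brk_hjet3:
  fixes u u1 u2 u11 u12 u22 :: "real^4"
  defines "h \<equiv> hjet3 u u1 u2 u11 u12 u22"
  shows "brk (h (axis 1 1)) (h (axis 2 1)) 2 0 = vec2 (2 * liouville1 u u1 u2 u11 u12 u22) 0"
    "brk (h (axis 1 1)) (h (axis 2 1)) 1 1 = vec2 (liouville2 u u1 u2 u11 u12 u22) (liouville1 u u1 u2 u11 u12 u22)"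
    "brk (h (axis 1 1)) (h (axis 2 1)) 0 2 = vec2 0 (2 * liouville2 u u1 u2 u11 u12 u22)"
proof -
  let ?K = "sol_k u1 u2" and ?L = "sol_l u1 u2" and ?M = "sol_m u1 u2" and ?N = "sol_n u1 u2"
  let ?c1 = "u11 - infl u ?K ?L 0 0 0" and ?d1 = "u12 - infl u ?L ?M 0 0 0"
  let ?c2 = "u12 - infl u ?L ?M 0 0 0" and ?d2 = "u22 - infl u ?M ?N 0 0 0"
  have r: "row1 u u1 u2 u11 u12 (axis 1 1) = ?c1" "row2 u u1 u2 u12 u22 (axis 1 1) = ?d1"
    "row1 u u1 u2 u11 u12 (axis 2 1) = ?c2" "row2 u u1 u2 u12 u22 (axis 2 1) = ?d2"
    by (simp_all add: row1_def row2_def hjet2_def)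
  have v: "h (axis 1 1) (0, 0) = axis 1 1" "h (axis 2 1) (0, 0) = axis 2 1"
    "h (axis 1 1) (2, 1) = sol_l ?c1 ?d1" "h (axis 1 1) (1, 2) = sol_m ?c1 ?d1" "h (axis 1 1) (0, 3) = sol_n ?c1 ?d1"
    "h (axis 2 1) (3, 0) = sol_k ?c2 ?d2" "h (axis 2 1) (2, 1) = sol_l ?c2 ?d2" "h (axis 2 1) (1, 2) = sol_m ?c2 ?d2"
    unfolding h_def hjet3_def Let_def r by (simp_all add: hjet2_def)
  have b: "brk (h (axis 1 1)) (h (axis 2 1)) 2 0 = sol_k ?c2 ?d2 - sol_l ?c1 ?d1"
    "brk (h (axis 1 1)) (h (axis 2 1)) 1 1 = sol_l ?c2 ?d2 - sol_m ?c1 ?d1"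
    "brk (h (axis 1 1)) (h (axis 2 1)) 0 2 = sol_m ?c2 ?d2 - sol_n ?c1 ?d1"
    using v by (simp_all add: brk_def eval_nat_numeral)
  note simps = vec2_eq_iff sol_defs infl_def liouville1_def liouville2_def vector_minus_component vec2_nth vec4_nth zero_index
  show "brk (h (axis 1 1)) (h (axis 2 1)) 2 0 = vec2 (2 * liouville1 u u1 u2 u11 u12 u22) 0"
    unfolding b simps by (simp add: field_simps)
  show "brk (h (axis 1 1)) (h (axis 2 1)) 1 1 = vec2 (liouville2 u u1 u2 u11 u12 u22) (liouville1 u u1 u2 u11 u12 u22)"
    unfolding b simps by (simp add: field_simps)
  show "brk (h (axis 1 1)) (h (axis 2 1)) 0 2 = vec2 0 (2 * liouville2 u u1 u2 u11 u12 u22)"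
    unfolding b simps by (simp add: field_simps)
qed

context
  fixes D :: "base set" and S :: "base \<Rightarrow> total" and p :: base
  assumes S: "local_section D S" and p: "p \<in> D"
begin

abbreviation "j2 \<equiv> hjet2 (partial 1 (fib S) p) (partial 2 (fib S) p)"

abbreviation "j3 \<equiv> hjet3 (fib S p) (partial 1 (fib S) p) (partial 2 (fib S) p)
  (partial 1 (partial 1 (fib S)) p) (partial 1 (partial 2 (fib S)) p) (partial 2 (partial 2 (fib S)) p)"

lemma hjet2_simps: "hjet2 c d v (0, 0) = v" "hjet2 c d v (1, 0) = 0" "hjet2 c d v (0, 1) = 0"
  "hjet2 c d v (2, 0) = v$1 *\<^sub>R sol_k c d + v$2 *\<^sub>R sol_l c d"
  "hjet2 c d v (1, 1) = v$1 *\<^sub>R sol_l c d + v$2 *\<^sub>R sol_m c d"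
  "hjet2 c d v (0, 2) = v$1 *\<^sub>R sol_m c d + v$2 *\<^sub>R sol_n c d"
  "2 < i + j \<Longrightarrow> hjet2 c d v (i, j) = 0"
  by (auto simp: hjet2_def)

lemma hjet3_low: "i + j \<le> 2 \<Longrightarrow> hjet3 u u1 u2 u11 u12 u22 v (i, j) = hjet2 u1 u2 v (i, j)"
  by (auto simp: hjet3_def Let_def)

lemma hjet3_high: "3 < i + j \<Longrightarrow> hjet3 u u1 u2 u11 u12 u22 v (i, j) = 0"
  by (auto simp: hjet3_def Let_def hjet2_simps)

lemma symbol_hjet2: "infl w 0 0 (hjet2 c d v (2, 0)) (hjet2 c d v (1, 1)) (hjet2 c d v (0, 2)) = v$1 *\<^sub>R c + v$2 *\<^sub>R d"
  unfolding hjet2_simps sol_defs infl_def by (simp add: vec4_eq_iff field_simps)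

lemma constant_start_hjet: "constant_start 2 (hjet2 c d v)" "constant_start 3 (hjet3 u u1 u2 u11 u12 u22 v)"
proof -
  show "constant_start 2 (hjet2 c d v)"
    using linear_0[OF linear_hjet2] by (auto simp: constant_start_def hjet2_simps simp del: One_nat_def)
  show "constant_start 3 (hjet3 u u1 u2 u11 u12 u22 v)"
    using linear_0[OF linear_hjet3]
    by (auto simp: constant_start_def hjet3_low hjet3_high hjet2_simps simp del: One_nat_def)
qed

lemma hjet2_isotropy: "j2 v \<in> isotropy 0 (jet 1 S p)" "j2 v \<in> vjets 2 p"
proof -
  have "infl (fib S p) 0 0 (j2 v (2, 0)) (j2 v (1, 1)) (j2 v (0, 2)) =
      j2 v (0, 0) $ 1 *\<^sub>R partial 1 (fib S) p + j2 v (0, 0) $ 2 *\<^sub>R partial 2 (fib S) p"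
    unfolding symbol_hjet2 hjet2_simps(1) ..
  from isotropy0_I[OF S p constant_start_hjet(1) this]
  show "j2 v \<in> isotropy 0 (jet 1 S p)" "j2 v \<in> vjets 2 p" by blast+
qed

lemma hjet3_rows:
  "infl u (hjet2 u1 u2 v (2, 0)) (hjet2 u1 u2 v (1, 1)) (hjet3 u u1 u2 u11 u12 u22 v (3, 0))
      (hjet3 u u1 u2 u11 u12 u22 v (2, 1)) (hjet3 u u1 u2 u11 u12 u22 v (1, 2)) = v$1 *\<^sub>R u11 + v$2 *\<^sub>R u12"
  "infl u (hjet2 u1 u2 v (1, 1)) (hjet2 u1 u2 v (0, 2)) (hjet3 u u1 u2 u11 u12 u22 v (2, 1))
      (hjet3 u u1 u2 u11 u12 u22 v (1, 2)) (hjet3 u u1 u2 u11 u12 u22 v (0, 3)) = v$1 *\<^sub>R u12 + v$2 *\<^sub>R u22"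
proof -
  let ?c = "row1 u u1 u2 u11 u12 v" and ?d = "row2 u u1 u2 u12 u22 v"
  have h: "hjet3 u u1 u2 u11 u12 u22 v (3, 0) = sol_k ?c ?d" "hjet3 u u1 u2 u11 u12 u22 v (2, 1) = sol_l ?c ?d"
    "hjet3 u u1 u2 u11 u12 u22 v (1, 2) = sol_m ?c ?d" "hjet3 u u1 u2 u11 u12 u22 v (0, 3) = sol_n ?c ?d"
    by (simp_all add: hjet3_def Let_def)
  have "infl u 0 0 (sol_k ?c ?d) (sol_l ?c ?d) (sol_m ?c ?d) = ?c" "infl u 0 0 (sol_l ?c ?d) (sol_m ?c ?d) (sol_n ?c ?d) = ?d"
    using symbol_system[of u "sol_k ?c ?d" "sol_l ?c ?d" "sol_m ?c ?d" ?c "sol_n ?c ?d" ?d] by simp_all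
  then show "infl u (hjet2 u1 u2 v (2, 0)) (hjet2 u1 u2 v (1, 1)) (hjet3 u u1 u2 u11 u12 u22 v (3, 0))
      (hjet3 u u1 u2 u11 u12 u22 v (2, 1)) (hjet3 u u1 u2 u11 u12 u22 v (1, 2)) = v$1 *\<^sub>R u11 + v$2 *\<^sub>R u12"
  "infl u (hjet2 u1 u2 v (1, 1)) (hjet2 u1 u2 v (0, 2)) (hjet3 u u1 u2 u11 u12 u22 v (2, 1))
      (hjet3 u u1 u2 u11 u12 u22 v (1, 2)) (hjet3 u u1 u2 u11 u12 u22 v (0, 3)) = v$1 *\<^sub>R u12 + v$2 *\<^sub>R u22"
    unfolding h by (subst infl_split, simp add: row1_def row2_def)+
qed

lemma hjet3_isotropy: "j3 v \<in> isotropy 1 (jet 2 S p)" "j3 v \<in> vjets 3 p"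
proof -
  have l: "j3 v (2, 0) = j2 v (2, 0)" "j3 v (1, 1) = j2 v (1, 1)" "j3 v (0, 2) = j2 v (0, 2)" "j3 v (0, 0) = v"
    by (simp_all only: hjet3_low add.right_neutral add_0 one_add_one order_refl zero_le hjet2_simps)
  show "j3 v \<in> isotropy 1 (jet 2 S p)" "j3 v \<in> vjets 3 p"
    by (rule isotropy1_I[OF S p constant_start_hjet(2)]; simp only: l symbol_hjet2 hjet3_rows)+
qed

lemma H_const_D:
  assumes "a \<in> H_const p"
  shows "a (1, 0) = 0" "a (0, 1) = 0"
  using assms by (auto simp: H_const_def mjet_def mderiv_simps partial_dird)

text \<open>Let \<open>A, B\<close> be the lifts of the axes. Vanishing of their bracket means \<open>B\<^sub>2\<^sub>0 = A\<^sub>1\<^sub>1\<close> and \<open>B\<^sub>1\<^sub>1 = A\<^sub>0\<^sub>2\<close>, so that the isotropy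
  conditions for both become one instance of \<open>symbol_system\<close>, with right-hand sides \<open>\<partial>\<^sub>1u\<close> and \<open>\<partial>\<^sub>2u\<close>.\<close>

lemma H1_eq: "H1 (jet 1 S p) = range j2"
  unfolding H1_def fst_jet
proof (rule the_equality)
  let ?P = "\<lambda>H. horizontal 2 p H \<and> H \<subseteq> isotropy 0 (jet 1 S p) \<and> trunc 1 ` H = H_const p \<and>
      (\<forall>v w. jet_bracket 2 p (inv_into H rho v) (inv_into H rho w) = 0)"
  note L = linear_hjet2 hjet2_simps(1)
  have tr: "trunc 1 (j2 v) = mjet 1 (\<lambda>_. v) p" for v
  proof (rule coeff_eqI)
    fix i j :: nat
    consider "i = 0" "j = 0" | "i = 1" "j = 0" | "i = 0" "j = 1" | "i + j > 1" by linarith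
    then show "trunc 1 (j2 v) (i, j) = mjet 1 (\<lambda>_. v) p (i, j)"
      by cases (auto simp: trunc_def mjet_def hjet2_def mderiv_simps partial_dird)
  qed
  show "?P (range j2)"
  proof (intro conjI allI)
    show "horizontal 2 p (range j2)" by (rule graph_horizontal[OF L]) (use hjet2_isotropy in auto)
    show "range j2 \<subseteq> isotropy 0 (jet 1 S p)" using hjet2_isotropy by auto
    show "trunc 1 ` range j2 = H_const p" unfolding H_const_def image_image tr by auto
    fix v w
    note br = jet_bracket_brk[OF hjet2_isotropy(2) hjet2_simps(2,3) hjet2_isotropy(2) hjet2_simps(2,3), of _ _ v w]
    have b: "brk (j2 v) (j2 w) 1 0 = 0" "brk (j2 v) (j2 w) 0 1 = 0"
      by (simp_all add: brk_def hjet2_def algebra_simps)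
    have "jet_bracket 2 p (j2 v) (j2 w) = 0"
    proof (rule coeff_eqI)
      fix i j :: nat
      consider "i = 0" "j = 0" | "i = 1" "j = 0" | "i = 0" "j = 1" | "i + j > 1" by linarith
      then show "jet_bracket 2 p (j2 v) (j2 w) (i, j) = 0 (i, j)"
      proof cases
        case 4 then show ?thesis by (simp add: jet_bracket_high)
      next
        case 1 then show ?thesis using br[of 0 0] by simp
      next
        case 2 then show ?thesis using br[of 1 0] b by simp
      next
        case 3 then show ?thesis using br[of 0 1] b by simp
      qed
    qed
    then show "jet_bracket 2 p (inv_into (range j2) rho v) (inv_into (range j2) rho w) = 0"
      by (simp only: graph_inv_into[OF L])
  qed
  fix H assume H: "?P H"
  then have hor: "subspace H" "dim H = 2" "rho ` H = UNIV" "H \<subseteq> vjets 2 p" by (auto simp: horizontal_def)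
  define A where "A = inv_into H rho (axis 1 1)"
  define B where "B = inv_into H rho (axis 2 1)"
  have AH: "A \<in> H" "B \<in> H" unfolding A_def B_def using hor(3) by (auto intro!: inv_into_into)
  have r: "A (0, 0) = axis 1 1" "B (0, 0) = axis 2 1"
    using f_inv_into_f[of "axis 1 1" rho H] f_inv_into_f[of "axis 2 1" rho H] hor(3) unfolding A_def B_def rho_def by auto
  have c: "a (1, 0) = 0" "a (0, 1) = 0" if "a \<in> H" for a
  proof -
    have "trunc 1 a \<in> H_const p" using H that by auto
    from H_const_D[OF this] show "a (1, 0) = 0" "a (0, 1) = 0" by (simp_all add: trunc_def)
  qed
  have v: "A \<in> vjets 2 p" "B \<in> vjets 2 p" using AH hor(4) by auto
  have "jet_bracket 2 p A B = 0" using H unfolding A_def B_def by blast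
  then have "brk A B 1 0 = 0" "brk A B 0 1 = 0"
    using jet_bracket_brk[OF v(1) c[OF AH(1)] v(2) c[OF AH(2)], of 1 0] jet_bracket_brk[OF v(1) c[OF AH(1)] v(2) c[OF AH(2)], of 0 1]
    by simp_all
  then have sym: "B (2, 0) = A (1, 1)" "B (1, 1) = A (0, 2)" by (simp_all add: brk_def r numeral_2_eq_2)
  have iso: "A \<in> isotropy 0 (jet 1 S p)" "B \<in> isotropy 0 (jet 1 S p)" using AH H by auto
  have "infl (fib S p) 0 0 (A (2, 0)) (A (1, 1)) (A (0, 2)) = partial 1 (fib S) p \<and>
      infl (fib S p) 0 0 (A (1, 1)) (A (0, 2)) (B (0, 2)) = partial 2 (fib S) p"
    using isotropy0_D[OF S p iso(1)] isotropy0_D[OF S p iso(2)] c[OF AH(1)] c[OF AH(2)] r sym by simp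
  from this[unfolded symbol_system]
  have s: "A (2, 0) = j2 (axis 1 1) (2, 0)" "A (1, 1) = j2 (axis 1 1) (1, 1)" "A (0, 2) = j2 (axis 1 1) (0, 2)"
     "B (2, 0) = j2 (axis 2 1) (2, 0)" "B (1, 1) = j2 (axis 2 1) (1, 1)" "B (0, 2) = j2 (axis 2 1) (0, 2)"
    unfolding hjet2_simps sym by simp_all
  have eqI: "a = b" if "a (0, 0) = b (0, 0)" "a (1, 0) = b (1, 0)" "a (0, 1) = b (0, 1)" "a (2, 0) = b (2, 0)" "a (1, 1) = b (1, 1)" "a (0, 2) = b (0, 2)"
      "a \<in> vjets 2 p" "b \<in> vjets 2 p" for a b :: "base coeffs"
  proof (rule coeff_eqI)
    fix i j :: nat
    consider "i = 0" "j = 0" | "i = 1" "j = 0" | "i = 0" "j = 1" | "i = 2" "j = 0" | "i = 1" "j = 1" | "i = 0" "j = 2" | "2 < i + j" by linarith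
    then show "a (i, j) = b (i, j)"
      using that(1-6) vjets_support[OF that(7), of i j] vjets_support[OF that(8), of i j] by cases auto
  qed
  have "A = j2 (axis 1 1)" "B = j2 (axis 2 1)"
    by (rule eqI; simp only: r s c[OF AH(1)] c[OF AH(2)] hjet2_simps v hjet2_isotropy)+
  then show "H = range j2" using graph_unique[OF L hor(1,2)] AH by simp
qed

text \<open>Above a known second order jet the two isotropy conditions determine the third derivatives of a single
  element by \<open>symbol_system\<close>.\<close>

lemma H2_eq: "H2 (jet 2 S p) = range j3"
proof -
  have pr: "jet_proj 1 (jet 2 S p) = jet 1 S p" by (rule jet_proj_jet) simp
  note L = linear_hjet3
  have L0: "j3 v (0, 0) = v" for v by (simp add: hjet3_low hjet2_simps)
  have tr: "trunc 2 (j3 v) = j2 v" for v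
    by (rule coeff_eqI) (auto simp: trunc_def hjet3_low hjet2_simps)
  have uniq: "a = j3 (rho a)" if a: "a \<in> vjets 3 p" "a \<in> isotropy 1 (jet 2 S p)" "trunc 2 a \<in> range j2" for a
  proof -
    obtain v where v: "trunc 2 a = j2 v" using a(3) by auto
    have low: "a (i, j) = j2 v (i, j)" if "i + j \<le> 2" for i j
      using fun_cong[OF v, of "(i, j)"] that by (simp add: trunc_def)
    have rv: "rho a = v" using low[of 0 0] by (simp add: rho_def hjet2_simps)
    have a1: "a (1, 0) = 0" "a (0, 1) = 0" using low[of 1 0] low[of 0 1] unfolding hjet2_simps by simp_all
    have a2: "a (2, 0) = j2 v (2, 0)" "a (1, 1) = j2 v (1, 1)" "a (0, 2) = j2 v (0, 2)" "a (0, 0) = v"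
      using low[of 2 0] low[of 1 1] low[of 0 2] rv by (simp_all add: rho_def)
    let ?c = "row1 (fib S p) (partial 1 (fib S) p) (partial 2 (fib S) p) (partial 1 (partial 1 (fib S)) p) (partial 1 (partial 2 (fib S)) p) v"
    let ?d = "row2 (fib S p) (partial 1 (fib S) p) (partial 2 (fib S) p) (partial 1 (partial 2 (fib S)) p) (partial 2 (partial 2 (fib S)) p) v"
    have "infl (fib S p) 0 0 (a (3, 0)) (a (2, 1)) (a (1, 2)) = ?c \<and> infl (fib S p) 0 0 (a (2, 1)) (a (1, 2)) (a (0, 3)) = ?d"
    proof
      show "infl (fib S p) 0 0 (a (3, 0)) (a (2, 1)) (a (1, 2)) = ?c"
        using isotropy1_D(1)[OF S p a(2) a1] unfolding a2 row1_def
        by (subst (asm) infl_split) (simp add: eq_diff_eq add.commute)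
      show "infl (fib S p) 0 0 (a (2, 1)) (a (1, 2)) (a (0, 3)) = ?d"
        using isotropy1_D(2)[OF S p a(2) a1] unfolding a2 row2_def
        by (subst (asm) infl_split) (simp add: eq_diff_eq add.commute)
    qed
    from this[unfolded symbol_system]
    have a3: "a (3, 0) = j3 v (3, 0)" "a (2, 1) = j3 v (2, 1)" "a (1, 2) = j3 v (1, 2)" "a (0, 3) = j3 v (0, 3)"
      by (simp_all add: hjet3_def Let_def)
    show "a = j3 (rho a)"
      unfolding rv
    proof (rule coeff_eqI)
      fix i j :: nat
      consider "i + j \<le> 2" | "i = 3" "j = 0" | "i = 2" "j = 1" | "i = 1" "j = 2" | "i = 0" "j = 3" | "3 < i + j" by linarith
      then show "a (i, j) = j3 v (i, j)"
        using a3 vjets_support[OF a(1), of i j] by cases (auto simp: low hjet3_low hjet3_high)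
    qed
  qed
  show ?thesis
    unfolding H2_def fst_jet pr H1_eq
  proof (rule the_equality)
    show "horizontal 3 p (range j3) \<and> range j3 \<subseteq> isotropy 1 (jet 2 S p) \<and> trunc 2 ` range j3 = range j2"
    proof (intro conjI)
      show "horizontal 3 p (range j3)" by (rule graph_horizontal[OF L L0]) (use hjet3_isotropy in auto)
      show "range j3 \<subseteq> isotropy 1 (jet 2 S p)" using hjet3_isotropy by auto
      show "trunc 2 ` range j3 = range j2" unfolding image_image tr ..
    qed
    fix H assume H: "horizontal 3 p H \<and> H \<subseteq> isotropy 1 (jet 2 S p) \<and> trunc 2 ` H = range j2"
    then have v: "H \<subseteq> vjets 3 p" "rho ` H = UNIV" by (auto simp: horizontal_def)
    have u: "a = j3 (rho a)" if "a \<in> H" for a by (rule uniq) (use H v that in auto)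
    show "H = range j3"
    proof (intro equalityI subsetI)
      show "a \<in> range j3" if "a \<in> H" for a using u[OF that] by blast
      fix a assume "a \<in> range j3"
      then obtain w where w: "a = j3 w" by auto
      obtain b where b: "b \<in> H" "rho b = w" using v(2) by (metis UNIV_I imageE)
      show "a \<in> H" using u[OF b(1)] b w by simp
    qed
  qed
qed

text \<open>The bracket of two horizontal jets has no terms of order below two, since the first order parts vanish and
  the second order parts are symmetric. The terms of order two are alternating in the two vectors, hence determined by their
  value on the axes.\<close>

theorem omega_zero_iff:
  "(\<forall>v w. omega2_pullback S p v w = 0) \<longleftrightarrow> liou1 (fib S) p = 0 \<and> liou2 (fib S) p = 0"
proof -
  have L0: "j3 v (0, 0) = v" "j3 v (1, 0) = 0" "j3 v (0, 1) = 0" for v by (simp_all add: hjet3_low hjet2_def)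
  have om: "omega2_pullback S p v w = jet_bracket 3 p (j3 v) (j3 w)" for v w
    by (simp only: omega2_pullback_def omega2_def omega_def fst_jet H2_eq graph_inv_into[OF linear_hjet3 L0(1)]
        jet_differential_simps[OF S p])
  note br = jet_bracket_brk[OF hjet3_isotropy(2) L0(2,3) hjet3_isotropy(2) L0(2,3)]
  have bil: "brk (j3 v) (j3 w) i j = (v$1 * w$2 - v$2 * w$1) *\<^sub>R brk (j3 (axis 1 1)) (j3 (axis 2 1)) i j" for v w i j
  proof -
    have ex: "j3 v I = v$1 *\<^sub>R j3 (axis 1 1) I + v$2 *\<^sub>R j3 (axis 2 1) I" for v I
    proof -
      have "j3 v = v$1 *\<^sub>R j3 (axis 1 1) + v$2 *\<^sub>R j3 (axis 2 1)" by (rule linear_base_expand[OF linear_hjet3])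
      then show ?thesis unfolding fun_eq_iff scaleR_fun_def plus_fun_def by blast
    qed
    show ?thesis
      unfolding brk_def L0 by (simp add: ex[of v] ex[of w] algebra_simps)
  qed
  show ?thesis
    unfolding om
  proof (intro iffI allI)
    assume 0: "\<forall>v w. jet_bracket 3 p (j3 v) (j3 w) = 0"
    have "brk (j3 (axis 1 1)) (j3 (axis 2 1)) 1 1 = 0"
      using fun_cong[OF 0[rule_format, of "axis 1 1" "axis 2 1"], of "(1, 1)"] br[of 1 1 "axis 1 1" "axis 2 1"] by simp
    then show "liou1 (fib S) p = 0 \<and> liou2 (fib S) p = 0" unfolding brk_hjet3 vec2_eq_iff by simp
  next
    assume 0: "liou1 (fib S) p = 0 \<and> liou2 (fib S) p = 0"
    fix v w
    have b2: "brk (j3 v) (j3 w) i j = 0" if "i + j = 2" for i j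
    proof -
      consider "i = 2" "j = 0" | "i = 1" "j = 1" | "i = 0" "j = 2" using \<open>i + j = 2\<close> by linarith
      then show ?thesis unfolding bil[of v w] by cases (simp_all only: brk_hjet3, simp_all add: 0 vec2_eq_iff)
    qed
    have b1: "brk (j3 (axis 1 1)) (j3 (axis 2 1)) i j = 0" if "i + j = 1" for i j
    proof -
      consider "i = 1" "j = 0" | "i = 0" "j = 1" using \<open>i + j = 1\<close> by linarith
      then show ?thesis by cases (simp_all add: brk_def hjet3_low hjet2_def)
    qed
    show "jet_bracket 3 p (j3 v) (j3 w) = 0"
    proof (rule coeff_eqI)
      fix i j :: nat
      consider "i + j = 0" | "i + j = 1" | "i + j = 2" | "i + j > 2" by linarith
      then show "jet_bracket 3 p (j3 v) (j3 w) (i, j) = 0 (i, j)"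
      proof cases
        case 1 then show ?thesis using br[of i j v w] by simp
      next
        case 2 then show ?thesis using br[of i j v w] b1[of i j] bil[of v w i j] by simp
      next
        case 3 then show ?thesis using br[of i j v w] b2[of i j] by simp
      next
        case 4 then show ?thesis by (simp add: jet_bracket_high)
      qed
    qed
  qed
qed

end

section \<open>The flat connection of a point transformation\<close>

lemma cubic_zero_iff:
  fixes c0 c1 c2 c3 :: real
  shows "(\<forall>x y. c0 * x^3 + c1 * x^2 * y + c2 * x * y^2 + c3 * y^3 = 0) \<longleftrightarrow> c0 = 0 \<and> c1 = 0 \<and> c2 = 0 \<and> c3 = 0"
proof
  assume a: "\<forall>x y. c0 * x^3 + c1 * x^2 * y + c2 * x * y^2 + c3 * y^3 = 0"
  \<comment> \<open>a binary cubic form is determined by its values in four directions\<close>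
  show "c0 = 0 \<and> c1 = 0 \<and> c2 = 0 \<and> c3 = 0"
    using a[rule_format, of 1 0] a[rule_format, of 0 1] a[rule_format, of 1 1] a[rule_format, of 1 "-1"] by auto
qed simp

text \<open>The Christoffel symbols, in the given coordinates, of the flat connection pulled back by \<open>f\<close>.\<close>

definition chris :: "(base \<Rightarrow> base) \<Rightarrow> 2 \<Rightarrow> 2 \<Rightarrow> base \<Rightarrow> base" where
  "chris f i j q = partial i (partial j f) q $ 1 *\<^sub>R ginv pdir f 1 q + partial i (partial j f) q $ 2 *\<^sub>R ginv pdir f 2 q"

lemma ginv_components:
  "ginv pdir f 1 q = vec2 (partial 2 f q $ 2 / jac f q) (- (partial 1 f q $ 2 / jac f q))"
  "ginv pdir f 2 q = vec2 (- (partial 2 f q $ 1 / jac f q)) (partial 1 f q $ 1 / jac f q)"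
  by (simp_all add: ginv_def vec2_eq_iff jacd_pdir partial_dird divide_inverse mult.commute)

lemma ginv_inverse:
  assumes "jac f q \<noteq> 0"
  shows "(v$1 *\<^sub>R ginv pdir f 1 q + v$2 *\<^sub>R ginv pdir f 2 q) $ 1 *\<^sub>R partial 1 f q
      + (v$1 *\<^sub>R ginv pdir f 1 q + v$2 *\<^sub>R ginv pdir f 2 q) $ 2 *\<^sub>R partial 2 f q = v"
    "(x *\<^sub>R partial 1 f q + y *\<^sub>R partial 2 f q) $ 1 *\<^sub>R ginv pdir f 1 q
      + (x *\<^sub>R partial 1 f q + y *\<^sub>R partial 2 f q) $ 2 *\<^sub>R ginv pdir f 2 q = vec2 x y"
proof -
  let ?J = "jac f q"
  have J: "x * (partial 1 f q $ 1 * partial 2 f q $ 2 - partial 2 f q $ 1 * partial 1 f q $ 2) / ?J = x" for x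
    using assms by (simp add: jac_def)
  show "(v$1 *\<^sub>R ginv pdir f 1 q + v$2 *\<^sub>R ginv pdir f 2 q) $ 1 *\<^sub>R partial 1 f q
      + (v$1 *\<^sub>R ginv pdir f 1 q + v$2 *\<^sub>R ginv pdir f 2 q) $ 2 *\<^sub>R partial 2 f q = v"
    using J[of "v$1"] J[of "v$2"] unfolding ginv_components vec2_eq_iff
    by (simp add: diff_divide_distrib add_divide_distrib algebra_simps)
  show "(x *\<^sub>R partial 1 f q + y *\<^sub>R partial 2 f q) $ 1 *\<^sub>R ginv pdir f 1 q
      + (x *\<^sub>R partial 1 f q + y *\<^sub>R partial 2 f q) $ 2 *\<^sub>R ginv pdir f 2 q = vec2 x y"
    using J[of x] J[of y] unfolding ginv_components vec2_eq_iff
    by (simp add: diff_divide_distrib add_divide_distrib algebra_simps)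
qed

lemma chris_eqI:
  assumes "jac f q \<noteq> 0" "partial i (partial j f) q = x *\<^sub>R partial 1 f q + y *\<^sub>R partial 2 f q"
  shows "chris f i j q = vec2 x y"
  unfolding chris_def assms(2) by (rule ginv_inverse(2)[OF assms(1)])

lemma chris_expand:
  assumes "jac f q \<noteq> 0"
  shows "partial i (partial j f) q = chris f i j q $ 1 *\<^sub>R partial 1 f q + chris f i j q $ 2 *\<^sub>R partial 2 f q"
  unfolding chris_def by (rule ginv_inverse(1)[OF assms, symmetric])

lemma smooth_on_chris:
  assumes "smooth_on U f" "\<And>q. q \<in> U \<Longrightarrow> jac f q \<noteq> 0"
  shows "smooth_on U (chris f i j)"
  unfolding chris_def[abs_def]
  by (intro smooth_on_add smooth_on_scaleR smooth_on_nth smooth_on_partial assms smooth_on_ginv)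
    (use assms in \<open>auto simp: jacd_pdir\<close>)

context
  fixes U :: "base set" and f :: "base \<Rightarrow> base"
  assumes pt: "point_transformation U f"
begin

text \<open>Differentiation of \<open>Dg Df = id\<close>, where \<open>g\<close> is the inverse of \<open>f\<close>: the Christoffel symbols are formed with second
  derivatives of \<open>f\<close>, the transformation law with those of \<open>g\<close>.\<close>

lemma chris_second_derivative_inverse:
  assumes q: "q \<in> U"
  defines "K \<equiv> nab pdir f 1 (ginv pdir f 1) q" and "L \<equiv> nab pdir f 1 (ginv pdir f 2) q" and "M \<equiv> nab pdir f 2 (ginv pdir f 2) q"
  shows "chris f k i q = - ((partial i f q $ 1 * partial k f q $ 1) *\<^sub>R K
     + (partial i f q $ 1 * partial k f q $ 2 + partial i f q $ 2 * partial k f q $ 1) *\<^sub>R L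
     + (partial i f q $ 2 * partial k f q $ 2) *\<^sub>R M)"
proof -
  let ?g = "\<lambda>l. ginv pdir f l"
  note sm = pt_smooth[OF pt]
  have J: "jac f q \<noteq> 0" if "q \<in> U" for q by (rule pt_jac[OF pt that])
  have gs: "smooth_on U (?g l)" for l by (rule smooth_on_ginv[OF sm(1)]) (simp add: jacd_pdir J)
  have L': "nab pdir f 2 (?g 1) q = L"
    using pt_partial2_inv[OF pt q, of 2 1] pt_partial2_inv[OF pt q, of 1 2] partial_commute(1)[OF sm(2), of "f q"] q
    by (simp add: L_def)
  have id: "partial i f q $ 1 *\<^sub>R ?g 1 q + partial i f q $ 2 *\<^sub>R ?g 2 q = axis i 1" if "q \<in> U" for q i
    using ginv_inverse(2)[OF J[OF that], of 1 0] ginv_inverse(2)[OF J[OF that], of 0 1] exhaust_2[of i]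
    by (auto simp: vec2_eq_iff)
  have ch: "partial k (?g l) q = partial k f q $ 1 *\<^sub>R nab pdir f 1 (?g l) q + partial k f q $ 2 *\<^sub>R nab pdir f 2 (?g l) q" for l
  proof -
    have "partial k f q $ 1 *\<^sub>R nab pdir f 1 (?g l) q + partial k f q $ 2 *\<^sub>R nab pdir f 2 (?g l) q
      = (partial k f q $ 1 *\<^sub>R ?g 1 q + partial k f q $ 2 *\<^sub>R ?g 2 q) $ 1 *\<^sub>R partial 1 (?g l) q
        + (partial k f q $ 1 *\<^sub>R ?g 1 q + partial k f q $ 2 *\<^sub>R ?g 2 q) $ 2 *\<^sub>R partial 2 (?g l) q"
      unfolding nab_def partial_dird by (simp add: algebra_simps)
    also have "\<dots> = partial k (?g l) q" unfolding id[OF q] using exhaust_2[of k] by auto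
    finally show ?thesis ..
  qed
  have pr: "partial k (\<lambda>q. partial i f q $ n *\<^sub>R ?g l q) q = partial i f q $ n *\<^sub>R partial k (?g l) q + partial k (partial i f) q $ n *\<^sub>R ?g l q" for n l
    using dird_bilinear[OF bounded_bilinear_scaleR smooth_on_differentiable[OF smooth_on_nth[OF smooth_on_partial[OF sm(1)]] q]
        smooth_on_differentiable[OF gs q], of "axis k 1" i n l] partial_nth[OF smooth_on_differentiable[OF smooth_on_partial[OF sm(1)] q], of k i n]
    by (simp add: partial_dird)
  have "partial k (\<lambda>q. partial i f q $ 1 *\<^sub>R ?g 1 q + partial i f q $ 2 *\<^sub>R ?g 2 q) q = partial k (\<lambda>q. axis i 1 :: base) q"
    by (rule partial_cong[OF sm(3) q id])
  then have "partial k (\<lambda>q. partial i f q $ 1 *\<^sub>R ?g 1 q + partial i f q $ 2 *\<^sub>R ?g 2 q) q = 0" by (simp add: partial_dird)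
  moreover have "partial k (\<lambda>q. partial i f q $ 1 *\<^sub>R ?g 1 q + partial i f q $ 2 *\<^sub>R ?g 2 q) q
     = partial k (\<lambda>q. partial i f q $ 1 *\<^sub>R ?g 1 q) q + partial k (\<lambda>q. partial i f q $ 2 *\<^sub>R ?g 2 q) q"
    unfolding partial_dird[of k]
    by (rule dird_add) (intro smooth_on_differentiable[OF _ q] smooth_on_scaleR smooth_on_nth smooth_on_partial sm(1) gs)+
  ultimately have "chris f k i q + (partial i f q $ 1 *\<^sub>R partial k (?g 1) q + partial i f q $ 2 *\<^sub>R partial k (?g 2) q) = 0"
    unfolding pr chris_def by (simp add: algebra_simps)
  then have "chris f k i q = - (partial i f q $ 1 *\<^sub>R partial k (?g 1) q + partial i f q $ 2 *\<^sub>R partial k (?g 2) q)"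
    by (rule eq_neg_iff_add_eq_0[THEN iffD2])
  then show ?thesis unfolding ch L' K_def[symmetric] L_def[symmetric] M_def[symmetric] by (simp add: algebra_simps)
qed

text \<open>An equation is carried to \<open>Y'' = 0\<close> exactly if it is the equation of the unparametrized geodesics
  of the pulled back flat connection. The numerators of the transformed coefficients are the
  coefficients of a binary cubic form in the direction \<open>\<xi>\<close>, and the substitution of \<open>Df \<eta>\<close> for \<open>\<xi>\<close>
  turns it into the form on the right-hand side.\<close>

lemma lift0_zero_iff:
  assumes q: "q \<in> U"
  shows "lift0 U f (q, u) = zero_section (f q) \<longleftrightarrow>
    u$0 = - chris f 1 1 q $ 2 \<and> u$1 = chris f 1 1 q $ 1 - 2 * chris f 1 2 q $ 2 \<and>
    u$2 = 2 * chris f 1 2 q $ 1 - chris f 2 2 q $ 2 \<and> u$3 = chris f 2 2 q $ 1"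
proof -
  define P where "P = ginv pdir f 1 q"
  define Q where "Q = ginv pdir f 2 q"
  define K where "K = nab pdir f 1 (ginv pdir f 1) q"
  define L where "L = nab pdir f 1 (ginv pdir f 2) q"
  define M where "M = nab pdir f 2 (ginv pdir f 2) q"
  define a where "a = partial 1 f q"
  define b where "b = partial 2 f q"
  have J: "jac f q \<noteq> 0" by (rule pt_jac[OF pt q])
  have det: "inverse (P$1 * Q$2 - Q$1 * P$2) \<noteq> 0"
    using ginv_det[of pdir f q] J by (simp add: P_def Q_def jacd_pdir)
  define n0 where "n0 = u$0 * P$1^3 + u$1 * P$1^2 * P$2 + u$2 * P$1 * P$2^2 + u$3 * P$2^3 - P$1 * K$2 + P$2 * K$1"
  define n1 where "n1 = 3 * u$0 * P$1^2 * Q$1 + u$1 * (2 * P$1 * Q$1 * P$2 + P$1^2 * Q$2) + u$2 * (Q$1 * P$2^2 + 2 * P$1 * P$2 * Q$2)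
      + 3 * u$3 * P$2^2 * Q$2 - 2 * P$1 * L$2 - Q$1 * K$2 + 2 * P$2 * L$1 + Q$2 * K$1"
  define n2 where "n2 = 3 * u$0 * P$1 * Q$1^2 + u$1 * (Q$1^2 * P$2 + 2 * P$1 * Q$1 * Q$2) + u$2 * (2 * Q$1 * P$2 * Q$2 + P$1 * Q$2^2)
      + 3 * u$3 * P$2 * Q$2^2 - P$1 * M$2 - 2 * Q$1 * L$2 + P$2 * M$1 + 2 * Q$2 * L$1"
  define n3 where "n3 = u$0 * Q$1^3 + u$1 * Q$1^2 * Q$2 + u$2 * Q$1 * Q$2^2 + u$3 * Q$2^3 - Q$1 * M$2 + Q$2 * M$1"
  have "lift0 U f (q, u) = zero_section (f q) \<longleftrightarrow> lcoef u P Q K L M = 0"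
    using pt_lift0[OF pt q, of "\<lambda>_. u"]
    by (simp add: tcoef_def zero_section_def P_def Q_def K_def L_def M_def)
  also have "\<dots> \<longleftrightarrow> n0 = 0 \<and> n1 = 0 \<and> n2 = 0 \<and> n3 = 0"
    unfolding lcoef_def vec4_eq_iff n0_def n1_def n2_def n3_def using det by simp
  also have "\<dots> \<longleftrightarrow> (\<forall>x y. n0 * x^3 + n1 * x^2 * y + n2 * x * y^2 + n3 * y^3 = 0)" by (rule cubic_zero_iff[symmetric])
  also have "\<dots> \<longleftrightarrow> (\<forall>s t. (u$0 + chris f 1 1 q $ 2) * s^3 + (u$1 + 2 * chris f 1 2 q $ 2 - chris f 1 1 q $ 1) * s^2 * t
      + (u$2 + chris f 2 2 q $ 2 - 2 * chris f 1 2 q $ 1) * s * t^2 + (u$3 - chris f 2 2 q $ 1) * t^3 = 0)"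
  proof -
    define N where "N x y = n0 * x^3 + n1 * x^2 * y + n2 * x * y^2 + n3 * y^3" for x y
    have N: "N x y = u$0 * e1^3 + u$1 * e1^2 * e2 + u$2 * e1 * e2^2 + u$3 * e2^3
        - (e1 * (x^2 * K$2 + 2 * x * y * L$2 + y^2 * M$2) - e2 * (x^2 * K$1 + 2 * x * y * L$1 + y^2 * M$1))"
      if "e1 = x * P$1 + y * Q$1" "e2 = x * P$2 + y * Q$2" for x y e1 e2
      unfolding that N_def n0_def n1_def n2_def n3_def by (simp add: algebra_simps power2_eq_square power3_eq_cube)
    have sub: "N (s * a$1 + t * b$1) (s * a$2 + t * b$2) = (u$0 + chris f 1 1 q $ 2) * s^3 + (u$1 + 2 * chris f 1 2 q $ 2 - chris f 1 1 q $ 1) * s^2 * t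
      + (u$2 + chris f 2 2 q $ 2 - 2 * chris f 1 2 q $ 1) * s * t^2 + (u$3 - chris f 2 2 q $ 1) * t^3" for s t
    proof -
      have "vec2 s t = (s * a$1 + t * b$1) *\<^sub>R P + (s * a$2 + t * b$2) *\<^sub>R Q"
        using ginv_inverse(2)[OF J, of s t] by (simp add: P_def Q_def a_def b_def)
      then have e: "s = (s * a$1 + t * b$1) * P$1 + (s * a$2 + t * b$2) * Q$1" "t = (s * a$1 + t * b$1) * P$2 + (s * a$2 + t * b$2) * Q$2"
        by (simp_all add: vec2_eq_iff)
      note c = chris_second_derivative_inverse[OF q, folded K_def L_def M_def]
      show ?thesis
        unfolding N[OF e] c a_def[symmetric] b_def[symmetric]
        by (simp add: algebra_simps power2_eq_square power3_eq_cube)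
    qed
    have onto: "\<exists>s t. x = s * a$1 + t * b$1 \<and> y = s * a$2 + t * b$2" for x y
    proof -
      obtain c :: base where c: "c$1 *\<^sub>R a + c$2 *\<^sub>R b = vec2 x y"
        using ginv_inverse(1)[OF J, of "vec2 x y"] unfolding a_def b_def by blast
      then show ?thesis by (intro exI[of _ "c$1"] exI[of _ "c$2"]) (simp add: vec2_eq_iff)
    qed
    have "(\<forall>x y. N x y = 0) \<longleftrightarrow> (\<forall>s t. N (s * a$1 + t * b$1) (s * a$2 + t * b$2) = 0)"
    proof (intro iffI allI)
      fix x y assume 0: "\<forall>s t. N (s * a$1 + t * b$1) (s * a$2 + t * b$2) = 0"
      obtain s t where "x = s * a$1 + t * b$1" "y = s * a$2 + t * b$2" using onto by blast
      then show "N x y = 0" using 0 by simp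
    qed simp
    then show ?thesis unfolding sub unfolding N_def .
  qed
  also have "\<dots> \<longleftrightarrow> u$0 = - chris f 1 1 q $ 2 \<and> u$1 = chris f 1 1 q $ 1 - 2 * chris f 1 2 q $ 2 \<and>
    u$2 = 2 * chris f 1 2 q $ 1 - chris f 2 2 q $ 2 \<and> u$3 = chris f 2 2 q $ 1"
    unfolding cubic_zero_iff by auto
  finally show ?thesis .
qed

end

lemma partial_fib_nth:
  fixes u :: "base \<Rightarrow> real^4"
  assumes "open U" "q \<in> U" "smooth_on U u" "\<forall>q\<in>U. u q $ \<alpha> = h q"
  shows "partial i u q $ \<alpha> = partial i h q" "partial j (partial i u) q $ \<alpha> = partial j (partial i h) q"
proof -
  have eq: "u q $ \<alpha> = h q" if "q \<in> U" for q using assms(4) that by blast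
  have 1: "partial i u q $ \<alpha> = partial i h q" if "q \<in> U" for q i
    using partial_nth[OF smooth_on_differentiable[OF assms(3) that], of i \<alpha>] partial_cong[OF assms(1) that eq, where i = i] by simp
  show "partial i u q $ \<alpha> = partial i h q" by (rule 1[OF assms(2)])
  show "partial j (partial i u) q $ \<alpha> = partial j (partial i h) q"
    using partial_nth[OF smooth_on_differentiable[OF smooth_on_partial[OF assms(3)] assms(2)], of j i \<alpha>]
      partial_cong[OF assms(1,2) 1, where i = j] by simp
qed

text \<open>The letters stand for the Christoffel symbols \<open>\<Gamma>\<^sup>1\<^sub>1\<^sub>1, \<Gamma>\<^sup>1\<^sub>1\<^sub>2, \<Gamma>\<^sup>1\<^sub>2\<^sub>2, \<Gamma>\<^sup>2\<^sub>1\<^sub>1, \<Gamma>\<^sup>2\<^sub>1\<^sub>2, \<Gamma>\<^sup>2\<^sub>2\<^sub>2\<close> of a symmetric connection, in this order,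
  \<open>u\<close> is the equation of its unparametrized geodesics, and the equations \<open>R\<close> say that the curvature vanishes. The Liouville
  expressions of \<open>u\<close> are linear combinations of the curvature components and of their first derivatives.\<close>

lemma flat_liouville:
  fixes A B C E F H :: "base \<Rightarrow> real" and u :: "base \<Rightarrow> real^4"
  assumes U: "open U" and p: "p \<in> U" and us: "smooth_on U u"
    and sm: "smooth_on U A" "smooth_on U B" "smooth_on U C" "smooth_on U E" "smooth_on U F" "smooth_on U H"
    and u: "\<And>q. q \<in> U \<Longrightarrow> u q $ 0 = - E q" "\<And>q. q \<in> U \<Longrightarrow> u q $ 1 = A q - 2 * F q"
      "\<And>q. q \<in> U \<Longrightarrow> u q $ 2 = 2 * B q - H q" "\<And>q. q \<in> U \<Longrightarrow> u q $ 3 = C q"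
    and R: "\<And>q. q \<in> U \<Longrightarrow> partial 1 B q + F q * B q = partial 2 A q + E q * C q"
      "\<And>q. q \<in> U \<Longrightarrow> partial 1 F q + (B q * E q + F q * F q) = partial 2 E q + (A q * F q + E q * H q)"
      "\<And>q. q \<in> U \<Longrightarrow> partial 1 C q + (C q * A q + H q * B q) = partial 2 B q + (B q * B q + F q * C q)"
      "\<And>q. q \<in> U \<Longrightarrow> partial 1 H q + C q * E q = partial 2 F q + B q * F q"
  shows "liou1 u p = 0"
    "liou2 u p = 0"
proof -
  have add: "partial i (\<lambda>q. f q + g q) q = partial i f q + partial i g q"
    and diff: "partial i (\<lambda>q. f q - g q) q = partial i f q - partial i g q"
    and mul: "partial i (\<lambda>q. f q * g q) q = f q * partial i g q + partial i f q * g q"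
    if "smooth_on U f" "smooth_on U g" "q \<in> U" for f g :: "base \<Rightarrow> real" and i q
    unfolding partial_dird using that
    by (auto intro!: dird_add dird_diff dird_mult smooth_on_differentiable)
  have neg: "partial i (\<lambda>q. - f q) q = - partial i f q" if "smooth_on U f" "q \<in> U" for f :: "base \<Rightarrow> real" and i q
    unfolding partial_dird using that by (auto intro!: dird_minus smooth_on_differentiable)
  have con: "partial i (\<lambda>q. c) q = 0" for c :: real and i q by (simp add: partial_dird)
  note sms = sm smooth_on_partial smooth_on_add smooth_on_diff smooth_on_mult smooth_on_minus smooth_on_const[OF U]
  note d = add diff mul neg con sms
  have R1: "partial i (\<lambda>q. partial 1 B q + F q * B q) p = partial i (\<lambda>q. partial 2 A q + E q * C q) p"
    "partial i (\<lambda>q. partial 1 F q + (B q * E q + F q * F q)) p = partial i (\<lambda>q. partial 2 E q + (A q * F q + E q * H q)) p"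
    "partial i (\<lambda>q. partial 1 C q + (C q * A q + H q * B q)) p = partial i (\<lambda>q. partial 2 B q + (B q * B q + F q * C q)) p"
    "partial i (\<lambda>q. partial 1 H q + C q * E q) p = partial i (\<lambda>q. partial 2 F q + B q * F q) p" for i
    by (rule partial_cong[OF U p R(1)] partial_cong[OF U p R(2)] partial_cong[OF U p R(3)] partial_cong[OF U p R(4)], assumption)+
  have com: "partial 2 (partial 1 f) p = partial 1 (partial 2 f) p" if "smooth_on U f" for f :: "base \<Rightarrow> real"
    unfolding partial_dird by (rule dird_commute[OF that p])
  note coms = com[OF sm(1)] com[OF sm(2)] com[OF sm(3)] com[OF sm(4)] com[OF sm(5)] com[OF sm(6)]
  note R1' = R1[simplified d p coms]
  have e1: "partial i (\<lambda>q. - E q) q = - partial i E q" "partial i (\<lambda>q. A q - 2 * F q) q = partial i A q - 2 * partial i F q"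
    "partial i (\<lambda>q. 2 * B q - H q) q = 2 * partial i B q - partial i H q" if "q \<in> U" for i q
    using that by (simp_all add: d)
  have e2: "partial j (partial i (\<lambda>q. - E q)) p = - partial j (partial i E) p" "partial j (partial i (\<lambda>q. A q - 2 * F q)) p = partial j (partial i A) p - 2 * partial j (partial i F) p"
    "partial j (partial i (\<lambda>q. 2 * B q - H q)) p = 2 * partial j (partial i B) p - partial j (partial i H) p" for i j
    using partial_cong[OF U p e1(1), where i = j] partial_cong[OF U p e1(2), where i = j] partial_cong[OF U p e1(3), where i = j] p
    by (simp_all add: d)
  have "\<forall>q\<in>U. u q $ 0 = - E q" "\<forall>q\<in>U. u q $ 1 = A q - 2 * F q" "\<forall>q\<in>U. u q $ 2 = 2 * B q - H q" "\<forall>q\<in>U. u q $ 3 = C q"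
    using u by auto
  note pf = this[THEN partial_fib_nth(1)[OF U p us]] this[THEN partial_fib_nth(2)[OF U p us]]
  have E22: "partial 2 (partial 2 E) p = partial 1 (partial 2 F) p + B p*partial 2 E p + partial 2 B p*E p + 2*F p*partial 2 F p - A p*partial 2 F p - partial 2 A p*F p - E p*partial 2 H p - partial 2 E p*H p"
    using R1'(2)[of 2] by (simp add: algebra_simps coms)
  have B11: "partial 1 (partial 1 B) p = partial 1 (partial 2 A) p + E p*partial 1 C p + partial 1 E p*C p - F p*partial 1 B p - partial 1 F p*B p"
    using R1'(1)[of 1] by (simp add: algebra_simps coms)
  have H11: "partial 1 (partial 1 H) p = partial 1 (partial 2 F) p + B p*partial 1 F p + partial 1 B p*F p - C p*partial 1 E p - partial 1 C p*E p"
    using R1'(4)[of 1] by (simp add: algebra_simps coms)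
  have C11: "partial 1 (partial 1 C) p = partial 1 (partial 2 B) p + 2*B p*partial 1 B p + F p*partial 1 C p + partial 1 F p*C p - C p*partial 1 A p - partial 1 C p*A p - H p*partial 1 B p - partial 1 H p*B p"
    using R1'(3)[of 1] by (simp add: algebra_simps coms)
  have B12: "partial 1 (partial 2 B) p = partial 2 (partial 2 A) p + E p*partial 2 C p + partial 2 E p*C p - F p*partial 2 B p - partial 2 F p*B p"
    using R1'(1)[of 2] by (simp add: algebra_simps coms)
  have H12: "partial 1 (partial 2 H) p = partial 2 (partial 2 F) p + B p*partial 2 F p + partial 2 B p*F p - C p*partial 2 E p - partial 2 C p*E p"
    using R1'(4)[of 2] by (simp add: algebra_simps coms)
  have B1: "partial 1 B p = partial 2 A p + E p*C p - F p*B p"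
    using R(1)[OF p] by (simp add: algebra_simps)
  have F1: "partial 1 F p = partial 2 E p + A p*F p + E p*H p - B p*E p - F p*F p"
    using R(2)[OF p] by (simp add: algebra_simps)
  have C1: "partial 1 C p = partial 2 B p + B p*B p + F p*C p - C p*A p - H p*B p"
    using R(3)[OF p] by (simp add: algebra_simps)
  have H1: "partial 1 H p = partial 2 F p + B p*F p - C p*E p"
    using R(4)[OF p] by (simp add: algebra_simps)
  show "liou1 u p = 0"
    unfolding liouville1_def pf u[OF p] e1[OF p] e2 E22 B11 H11 unfolding B1 F1 C1 H1
    by (simp add: field_simps)
  show "liou2 u p = 0"
    unfolding liouville2_def pf u[OF p] e1[OF p] e2 C11 B12 H12 unfolding B1 F1 C1 H1
    by (simp add: field_simps)
qed

lemma independent_partials: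
  assumes "jac f q \<noteq> 0" "x *\<^sub>R partial 1 f q + y *\<^sub>R partial 2 f q = x' *\<^sub>R partial 1 f q + y' *\<^sub>R partial 2 f q"
  shows "x = x'" "y = y'"
  using ginv_inverse(2)[OF assms(1), of x y] ginv_inverse(2)[OF assms(1), of x' y'] assms(2)
  by (simp_all add: vec2_eq_iff)

text \<open>That third partial derivatives of \<open>f\<close> commute means that the connection pulled back by \<open>f\<close> is flat.\<close>

lemma transformable_liouville:
  assumes pt: "point_transformation U f" and us: "smooth_on U u" and p: "p \<in> U"
    and 0: "\<And>q. q \<in> U \<Longrightarrow> lift0 U f (q, u q) = zero_section (f q)"
  shows "liou1 u p = 0"
    "liou2 u p = 0"
proof -
  note sm = pt_smooth[OF pt]
  have J: "jac f q \<noteq> 0" if "q \<in> U" for q by (rule pt_jac[OF pt that])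
  note cs = smooth_on_chris[OF sm(1) J]
  let ?c = "chris f"
  have uc: "u q $ 0 = - ?c 1 1 q $ 2" "u q $ 1 = ?c 1 1 q $ 1 - 2 * ?c 1 2 q $ 2"
    "u q $ 2 = 2 * ?c 1 2 q $ 1 - ?c 2 2 q $ 2" "u q $ 3 = ?c 2 2 q $ 1" if "q \<in> U" for q
    using 0[OF that] lift0_zero_iff[OF pt that] by auto
  have third: "partial k (partial i (partial j f)) q =
      (partial k (\<lambda>q. ?c i j q $ 1) q + ?c i j q $ 1 * ?c k 1 q $ 1 + ?c i j q $ 2 * ?c k 2 q $ 1) *\<^sub>R partial 1 f q
    + (partial k (\<lambda>q. ?c i j q $ 2) q + ?c i j q $ 1 * ?c k 1 q $ 2 + ?c i j q $ 2 * ?c k 2 q $ 2) *\<^sub>R partial 2 f q"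
    if q: "q \<in> U" for i j k q
  proof -
    have sc: "partial k (\<lambda>q. ?c i j q $ n *\<^sub>R partial m f q) q = ?c i j q $ n *\<^sub>R partial k (partial m f) q
        + partial k (\<lambda>q. ?c i j q $ n) q *\<^sub>R partial m f q" for n m
      unfolding partial_dird[of k]
      by (intro dird_bilinear[OF bounded_bilinear_scaleR] smooth_on_differentiable[OF _ q] smooth_on_nth cs smooth_on_partial sm(1))
    have "partial k (partial i (partial j f)) q = partial k (\<lambda>q. ?c i j q $ 1 *\<^sub>R partial 1 f q + ?c i j q $ 2 *\<^sub>R partial 2 f q) q"
      by (rule partial_cong[OF sm(3) q chris_expand[OF J]])
    also have "\<dots> = partial k (\<lambda>q. ?c i j q $ 1 *\<^sub>R partial 1 f q) q + partial k (\<lambda>q. ?c i j q $ 2 *\<^sub>R partial 2 f q) q"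
      unfolding partial_dird[of k]
      by (rule dird_add; intro smooth_on_differentiable[OF _ q] smooth_on_scaleR smooth_on_nth cs smooth_on_partial sm(1))
    finally show ?thesis
      unfolding sc chris_expand[OF J[OF q], of k 1] chris_expand[OF J[OF q], of k 2] by (simp add: algebra_simps)
  qed
  have sym: "?c 2 1 q = ?c 1 2 q" if "q \<in> U" for q
    unfolding chris_def using partial_commute(1)[OF sm(1) that] by simp
  have symp: "partial 1 (\<lambda>q. ?c 2 1 q $ n) q = partial 1 (\<lambda>q. ?c 1 2 q $ n) q" if "q \<in> U" for q n
    by (rule partial_cong[OF sm(3) that]) (simp add: sym)
  have com: "partial 1 (partial 2 (partial j f)) q = partial 2 (partial 1 (partial j f)) q" if "q \<in> U" for j q
    by (rule partial_commute(1)[OF smooth_on_partial[OF sm(1)] that, symmetric])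
  have c: "(partial 1 (\<lambda>q. ?c 2 j q $ 1) q + ?c 2 j q $ 1 * ?c 1 1 q $ 1 + ?c 2 j q $ 2 * ?c 1 2 q $ 1) *\<^sub>R partial 1 f q
      + (partial 1 (\<lambda>q. ?c 2 j q $ 2) q + ?c 2 j q $ 1 * ?c 1 1 q $ 2 + ?c 2 j q $ 2 * ?c 1 2 q $ 2) *\<^sub>R partial 2 f q
     = (partial 2 (\<lambda>q. ?c 1 j q $ 1) q + ?c 1 j q $ 1 * ?c 2 1 q $ 1 + ?c 1 j q $ 2 * ?c 2 2 q $ 1) *\<^sub>R partial 1 f q
      + (partial 2 (\<lambda>q. ?c 1 j q $ 2) q + ?c 1 j q $ 1 * ?c 2 1 q $ 2 + ?c 1 j q $ 2 * ?c 2 2 q $ 2) *\<^sub>R partial 2 f q" if q: "q \<in> U" for j q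
      using com[OF q, of j] unfolding third[OF q] .
  have fl: "partial 1 (\<lambda>q. ?c 1 2 q $ 1) q + ?c 1 2 q $ 2 * ?c 1 2 q $ 1 = partial 2 (\<lambda>q. ?c 1 1 q $ 1) q + ?c 1 1 q $ 2 * ?c 2 2 q $ 1"
    "partial 1 (\<lambda>q. ?c 1 2 q $ 2) q + (?c 1 2 q $ 1 * ?c 1 1 q $ 2 + ?c 1 2 q $ 2 * ?c 1 2 q $ 2)
      = partial 2 (\<lambda>q. ?c 1 1 q $ 2) q + (?c 1 1 q $ 1 * ?c 1 2 q $ 2 + ?c 1 1 q $ 2 * ?c 2 2 q $ 2)"
    "partial 1 (\<lambda>q. ?c 2 2 q $ 1) q + (?c 2 2 q $ 1 * ?c 1 1 q $ 1 + ?c 2 2 q $ 2 * ?c 1 2 q $ 1)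
      = partial 2 (\<lambda>q. ?c 1 2 q $ 1) q + (?c 1 2 q $ 1 * ?c 1 2 q $ 1 + ?c 1 2 q $ 2 * ?c 2 2 q $ 1)"
    "partial 1 (\<lambda>q. ?c 2 2 q $ 2) q + ?c 2 2 q $ 1 * ?c 1 1 q $ 2 = partial 2 (\<lambda>q. ?c 1 2 q $ 2) q + ?c 1 2 q $ 1 * ?c 1 2 q $ 2"
    if q: "q \<in> U" for q
    using independent_partials[OF J[OF q] c[OF q, of 1]] independent_partials[OF J[OF q] c[OF q, of 2]]
    unfolding symp[OF q] sym[OF q] by (simp_all add: algebra_simps)
  note fin = flat_liouville[OF sm(3) p us cs[THEN smooth_on_nth, of 1 1 1] cs[THEN smooth_on_nth, of 1 2 1] cs[THEN smooth_on_nth, of 2 2 1]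
      cs[THEN smooth_on_nth, of 1 1 2] cs[THEN smooth_on_nth, of 1 2 2] cs[THEN smooth_on_nth, of 2 2 2]]
  show "liou1 u p = 0"
    by (rule fin(1)) (use uc fl in blast)+
  show "liou2 u p = 0"
    by (rule fin(2)) (use uc fl in blast)+
qed

section \<open>Solving the Liouville equations\<close>

definition unit3 :: "3 \<Rightarrow> 3 \<Rightarrow> ((real^3) \<Rightarrow>\<^sub>L (real^3))" where
  "unit3 i j = Blinfun (\<lambda>w. w $ j *\<^sub>R axis i 1)"

lemma unit3_apply [simp]: "blinfun_apply (unit3 i j) w = w $ j *\<^sub>R axis i 1"
proof -
  have "bounded_linear (\<lambda>w::real^3. w $ j *\<^sub>R (axis i 1 :: real^3))"
    by (rule bounded_linear_compose[OF bounded_linear_scaleR_left bounded_linear_vec_nth])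
  then show ?thesis by (simp add: unit3_def bounded_linear_Blinfun_apply)
qed

text \<open>The coefficient matrix of one half of a second order system for a function, whose first derivatives are
  the second and third unknowns: the first row says which of them the derivative in question is, and \<open>a\<close> and \<open>b\<close>
  are the rows for its second derivatives.\<close>

definition jetsys :: "3 \<Rightarrow> (3 \<Rightarrow> base \<Rightarrow> real) \<Rightarrow> (3 \<Rightarrow> base \<Rightarrow> real) \<Rightarrow> base \<Rightarrow> ((real^3) \<Rightarrow>\<^sub>L (real^3))" where
  "jetsys n a b q = unit3 1 n + (\<Sum>j\<in>UNIV. a j q *\<^sub>R unit3 2 j) + (\<Sum>j\<in>UNIV. b j q *\<^sub>R unit3 3 j)"

lemma axis3_nth [simp]: "axis 1 c $ (1::3) = c" "axis 1 c $ (2::3) = 0" "axis 1 c $ (3::3) = 0"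
  "axis 2 c $ (1::3) = 0" "axis 2 c $ (2::3) = c" "axis 2 c $ (3::3) = 0"
  "axis 3 c $ (1::3) = 0" "axis 3 c $ (2::3) = 0" "axis 3 c $ (3::3) = c"
  by (simp_all add: axis_def)

lemma jetsys_apply:
  "blinfun_apply (jetsys n a b q) w $ 1 = w $ n"
  "blinfun_apply (jetsys n a b q) w $ 2 = a 1 q * w $ 1 + a 2 q * w $ 2 + a 3 q * w $ 3"
  "blinfun_apply (jetsys n a b q) w $ 3 = b 1 q * w $ 1 + b 2 q * w $ 2 + b 3 q * w $ 3"
  by (simp_all add: jetsys_def sum_3 blinfun.add_left blinfun.scaleR_left)

lemma smooth_on_jetsys:
  assumes "open D" "\<And>j. smooth_on D (a j)" "\<And>j. smooth_on D (b j)"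
  shows "smooth_on D (jetsys n a b)"
  unfolding jetsys_def[abs_def] by (intro smooth_on_add smooth_on_sum smooth_on_scaleR smooth_on_const assms)

lemma partial_jetsys:
  assumes "\<And>j. a j differentiable (at q)" "\<And>j. b j differentiable (at q)"
  shows "blinfun_apply (partial i (jetsys n a b) q) w $ 1 = 0"
    "blinfun_apply (partial i (jetsys n a b) q) w $ 2 = partial i (a 1) q * w $ 1 + partial i (a 2) q * w $ 2 + partial i (a 3) q * w $ 3"
    "blinfun_apply (partial i (jetsys n a b) q) w $ 3 = partial i (b 1) q * w $ 1 + partial i (b 2) q * w $ 2 + partial i (b 3) q * w $ 3"
proof -
  have "(jetsys n a b has_derivative (\<lambda>v. 0 + (\<Sum>j\<in>UNIV. dird v (a j) q *\<^sub>R unit3 2 j) + (\<Sum>j\<in>UNIV. dird v (b j) q *\<^sub>R unit3 3 j))) (at q)"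
    unfolding jetsys_def[abs_def]
    by (intro has_derivative_add has_derivative_const has_derivative_sum has_derivative_scaleR_left has_derivative_dird assms)
  from dird_eq[OF this, of "axis i 1"]
  have "partial i (jetsys n a b) q = (\<Sum>j\<in>UNIV. partial i (a j) q *\<^sub>R unit3 2 j) + (\<Sum>j\<in>UNIV. partial i (b j) q *\<^sub>R unit3 3 j)"
    by (simp add: partial_dird)
  then show "blinfun_apply (partial i (jetsys n a b) q) w $ 1 = 0"
    "blinfun_apply (partial i (jetsys n a b) q) w $ 2 = partial i (a 1) q * w $ 1 + partial i (a 2) q * w $ 2 + partial i (a 3) q * w $ 3"
    "blinfun_apply (partial i (jetsys n a b) q) w $ 3 = partial i (b 1) q * w $ 1 + partial i (b 2) q * w $ 2 + partial i (b 3) q * w $ 3"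
    by (simp_all add: sum_3 blinfun.add_left blinfun.scaleR_left)
qed

definition cases3 :: "'b \<Rightarrow> 'b \<Rightarrow> 'b \<Rightarrow> 3 \<Rightarrow> 'b" where
  "cases3 a b c j = (if j = 1 then a else if j = 2 then b else c)"

lemma cases3_simps [simp]: "cases3 a b c 1 = a" "cases3 a b c 2 = b" "cases3 a b c 3 = c"
  by (simp_all add: cases3_def)

lemma cases3_all: "P a \<Longrightarrow> P b \<Longrightarrow> P c \<Longrightarrow> P (cases3 a b c j)"
  by (simp add: cases3_def)

text \<open>The Ricci tensor of the trace-free connection \<open>\<Pi>\<close> of an equation, which has
  \<open>\<Pi>\<^sup>1\<^sub>1\<^sub>1 = - \<Pi>\<^sup>2\<^sub>1\<^sub>2 = u\<^sup>1/3\<close>, \<open>\<Pi>\<^sup>1\<^sub>1\<^sub>2 = - \<Pi>\<^sup>2\<^sub>2\<^sub>2 = u\<^sup>2/3\<close>, \<open>\<Pi>\<^sup>2\<^sub>1\<^sub>1 = - u\<^sup>0\<close> and \<open>\<Pi>\<^sup>1\<^sub>2\<^sub>2 = u\<^sup>3\<close>.\<close>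

definition ric11 :: "(base \<Rightarrow> real^4) \<Rightarrow> base \<Rightarrow> real" where
  "ric11 u q = 1/3 * partial 1 u q $ 1 - partial 2 u q $ 0 + 2/3 * (u q $ 0 * u q $ 2) - 2/9 * (u q $ 1 * u q $ 1)"

definition ric12 :: "(base \<Rightarrow> real^4) \<Rightarrow> base \<Rightarrow> real" where
  "ric12 u q = 1/3 * partial 1 u q $ 2 - 1/3 * partial 2 u q $ 1 + u q $ 0 * u q $ 3 - 1/9 * (u q $ 1 * u q $ 2)"

definition ric22 :: "(base \<Rightarrow> real^4) \<Rightarrow> base \<Rightarrow> real" where
  "ric22 u q = partial 1 u q $ 3 - 1/3 * partial 2 u q $ 2 + 2/3 * (u q $ 1 * u q $ 3) - 2/9 * (u q $ 2 * u q $ 2)"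

text \<open>The equations \<open>\<partial>\<^sub>a\<partial>\<^sub>b\<sigma> = \<Pi>\<^sup>c\<^sub>a\<^sub>b \<partial>\<^sub>c\<sigma> - P\<^sub>a\<^sub>b \<sigma>\<close> for \<open>W = (\<sigma>, \<partial>\<^sub>1\<sigma>, \<partial>\<^sub>2\<sigma>)\<close>, where \<open>P\<close> is the Ricci tensor of \<open>\<Pi>\<close>.\<close>

definition density_eqs :: "(base \<Rightarrow> real^4) \<Rightarrow> (base \<Rightarrow> real^3) \<Rightarrow> base \<Rightarrow> bool" where
  "density_eqs u W q \<longleftrightarrow> partial 1 W q $ 1 = W q $ 2 \<and> partial 2 W q $ 1 = W q $ 3 \<and>
     partial 1 W q $ 2 = - ric11 u q * W q $ 1 + u q $ 1 / 3 * W q $ 2 - u q $ 0 * W q $ 3 \<and>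
     partial 2 W q $ 2 = - ric12 u q * W q $ 1 + u q $ 2 / 3 * W q $ 2 - u q $ 1 / 3 * W q $ 3 \<and>
     partial 2 W q $ 3 = - ric22 u q * W q $ 1 + u q $ 3 * W q $ 2 - u q $ 2 / 3 * W q $ 3"

text \<open>The curvature of this system has only two nonzero entries, \<open>- L\<^sub>1\<close> and \<open>- L\<^sub>2\<close>, which multiply \<open>\<sigma>\<close> in the
  two lower rows.\<close>

lemma density_system:
  assumes us: "smooth_on D u" and p: "p \<in> D"
    and L1: "\<And>q. q \<in> D \<Longrightarrow> liou1 u q = 0"
    and L2: "\<And>q. q \<in> D \<Longrightarrow> liou2 u q = 0"
  obtains r where "0 < r" "ball p r \<subseteq> D" "\<And>w0 :: real^3. \<exists>W. smooth_on (ball p r) W \<and> W p = w0 \<and> (\<forall>q\<in>ball p r. density_eqs u W q)"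
proof -
  have D: "open D" using us smooth_on_open by blast
  obtain R where R: "0 < R" "ball p R \<subseteq> D" using D p by (meson openE)
  define a1 where "a1 = cases3 (\<lambda>q. - ric11 u q) (\<lambda>q. u q $ 1 / 3) (\<lambda>q. - u q $ 0)"
  define a2 where "a2 = cases3 (\<lambda>q. - ric12 u q) (\<lambda>q. u q $ 2 / 3) (\<lambda>q. - (u q $ 1 / 3))"
  define a3 where "a3 = cases3 (\<lambda>q. - ric22 u q) (\<lambda>q. u q $ 3) (\<lambda>q. - (u q $ 2 / 3))"
  define A1 where "A1 = jetsys 2 a1 a2"
  define A2 where "A2 = jetsys 3 a2 a3"
  have ric: "smooth_on D (ric11 u)" "smooth_on D (ric12 u)" "smooth_on D (ric22 u)"
    unfolding ric11_def[abs_def] ric12_def[abs_def] ric22_def[abs_def]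
    by (intro smooth_on_add smooth_on_diff smooth_on_mult smooth_on_const D smooth_on_nth smooth_on_partial us)+
  have as: "smooth_on D (a1 j)" "smooth_on D (a2 j)" "smooth_on D (a3 j)" for j
    unfolding a1_def a2_def a3_def divide_inverse
    by (intro cases3_all[of "smooth_on D"] smooth_on_minus smooth_on_mult smooth_on_const D smooth_on_nth ric us)+
  have As: "smooth_on D A1" "smooth_on D A2" unfolding A1_def A2_def by (intro smooth_on_jetsys D as)+
  have flat: "blinfun_apply (partial 1 A2 q) w - blinfun_apply (partial 2 A1 q) w =
      blinfun_apply (A1 q) (blinfun_apply (A2 q) w) - blinfun_apply (A2 q) (blinfun_apply (A1 q) w)"
    if "q \<in> ball p R" for q w
  proof -
    have q: "q \<in> D" using that R by auto
    note pj = partial_jetsys[OF smooth_on_differentiable[OF as(1) q] smooth_on_differentiable[OF as(2) q]]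
      partial_jetsys[OF smooth_on_differentiable[OF as(2) q] smooth_on_differentiable[OF as(3) q]]
    have add: "partial i (\<lambda>q. f q + g q) q = partial i f q + partial i g q"
      and diff: "partial i (\<lambda>q. f q - g q) q = partial i f q - partial i g q"
      and mul: "partial i (\<lambda>q. f q * g q) q = f q * partial i g q + partial i f q * g q"
      and neg: "partial i (\<lambda>q. - f q) q = - partial i f q"
      if "smooth_on D f" "smooth_on D g" for f g :: "base \<Rightarrow> real" and i
      unfolding partial_dird using that q
      by (auto intro!: dird_add dird_diff dird_mult dird_minus smooth_on_differentiable)
    have con: "partial i (\<lambda>q. c) q = 0" for c :: real and i by (simp add: partial_dird)
    have div: "partial i (\<lambda>q. f q / c) q = partial i f q / c" if "smooth_on D f" for f :: "base \<Rightarrow> real" and i c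
      unfolding divide_inverse using mul[OF that smooth_on_const[OF D, of "inverse c"], of i] con by simp
    have nth: "partial i (\<lambda>q. v q $ n) q = partial i v q $ n" if "smooth_on D v" for v :: "base \<Rightarrow> real^4" and i n
      by (rule partial_nth[OF smooth_on_differentiable[OF that q]])
    have sdiv: "smooth_on D (\<lambda>q. f q / c)" if "smooth_on D f" for f :: "base \<Rightarrow> real" and c
      unfolding divide_inverse by (intro smooth_on_mult that smooth_on_const D)
    note sms = sdiv us smooth_on_partial smooth_on_nth smooth_on_add smooth_on_diff smooth_on_mult smooth_on_minus smooth_on_const[OF D] ric
    have dr: "partial i (ric11 u) q = 1/3 * partial i (partial 1 u) q $ 1 - partial i (partial 2 u) q $ 0
        + 2/3 * (u q $ 0 * partial i u q $ 2 + partial i u q $ 0 * u q $ 2) - 4/9 * (u q $ 1 * partial i u q $ 1)"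
      "partial i (ric12 u) q = 1/3 * partial i (partial 1 u) q $ 2 - 1/3 * partial i (partial 2 u) q $ 1
        + (u q $ 0 * partial i u q $ 3 + partial i u q $ 0 * u q $ 3) - 1/9 * (u q $ 1 * partial i u q $ 2 + partial i u q $ 1 * u q $ 2)"
      "partial i (ric22 u) q = partial i (partial 1 u) q $ 3 - 1/3 * partial i (partial 2 u) q $ 2
        + 2/3 * (u q $ 1 * partial i u q $ 3 + partial i u q $ 1 * u q $ 3) - 4/9 * (u q $ 2 * partial i u q $ 2)" for i
      unfolding ric11_def[abs_def] ric12_def[abs_def] ric22_def[abs_def]
      by (simp_all add: add diff mul con nth div sms)
    have da: "partial i (a1 1) q = - partial i (ric11 u) q" "partial i (a1 2) q = partial i u q $ 1 / 3" "partial i (a1 3) q = - partial i u q $ 0"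
      "partial i (a2 1) q = - partial i (ric12 u) q" "partial i (a2 2) q = partial i u q $ 2 / 3" "partial i (a2 3) q = - (partial i u q $ 1 / 3)"
      "partial i (a3 1) q = - partial i (ric22 u) q" "partial i (a3 2) q = partial i u q $ 3" "partial i (a3 3) q = - (partial i u q $ 2 / 3)" for i
      unfolding a1_def a2_def a3_def cases3_simps
      using neg[OF ric(1) ric(1)] neg[OF ric(2) ric(2)] neg[OF ric(3) ric(3)]
      by (simp_all add: div nth sms neg[OF smooth_on_nth[OF us] smooth_on_nth[OF us]]
          neg[OF smooth_on_divide[OF smooth_on_nth[OF us] smooth_on_const[OF D]] smooth_on_nth[OF us]])
    have av: "a1 1 q = - ric11 u q" "a1 2 q = u q $ 1 / 3" "a1 3 q = - u q $ 0"
      "a2 1 q = - ric12 u q" "a2 2 q = u q $ 2 / 3" "a2 3 q = - (u q $ 1 / 3)"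
      "a3 1 q = - ric22 u q" "a3 2 q = u q $ 3" "a3 3 q = - (u q $ 2 / 3)"
      by (simp_all add: a1_def a2_def a3_def)
    note c = partial_commute(1)[OF us q]
    let ?l1 = "liou1 u q"
    let ?l2 = "liou2 u q"
    let ?X = "blinfun_apply (partial 1 A2 q) w - blinfun_apply (partial 2 A1 q) w -
      (blinfun_apply (A1 q) (blinfun_apply (A2 q) w) - blinfun_apply (A2 q) (blinfun_apply (A1 q) w))"
    have "?X $ 1 = 0"
      unfolding A1_def A2_def vector_minus_component pj jetsys_apply by simp
    moreover have "?X $ 2 = - ?l1 * w $ 1"
      unfolding A1_def A2_def vector_minus_component pj jetsys_apply da dr c av ric11_def ric12_def ric22_def liouville1_def
      by (simp add: field_simps)
    moreover have "?X $ 3 = - ?l2 * w $ 1"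
      unfolding A1_def A2_def vector_minus_component pj jetsys_apply da dr c av ric11_def ric12_def ric22_def liouville2_def
      by (simp add: field_simps)
    ultimately have "?X = 0" using L1[OF q] L2[OF q] by (simp add: vec_eq_iff forall_3)
    then show ?thesis by simp
  qed
  obtain r where r: "0 < r" "r \<le> R" and W: "\<And>w0. \<exists>W. smooth_on (ball p r) W \<and> W p = w0 \<and>
      (\<forall>q\<in>ball p r. partial 1 W q = blinfun_apply (A1 q) (W q) \<and> partial 2 W q = blinfun_apply (A2 q) (W q))"
    using flat_linear_system[OF smooth_on_subset[OF As(1) open_ball R(2)] smooth_on_subset[OF As(2) open_ball R(2)] R(1) flat] by metis
  show ?thesis
  proof (rule that[OF r(1)])
    show "ball p r \<subseteq> D" using r R by auto
    fix w0 :: "real^3"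
    obtain W where W: "smooth_on (ball p r) W" "W p = w0"
      "\<forall>q\<in>ball p r. partial 1 W q = blinfun_apply (A1 q) (W q) \<and> partial 2 W q = blinfun_apply (A2 q) (W q)" using W by blast
    then show "\<exists>W. smooth_on (ball p r) W \<and> W p = w0 \<and> (\<forall>q\<in>ball p r. density_eqs u W q)"
      by (intro exI[of _ W]) (simp add: density_eqs_def A1_def A2_def jetsys_apply a1_def a2_def a3_def)
  qed
qed

text \<open>Let \<open>\<sigma>\<close> and the components of \<open>s = \<sigma> f\<close> solve the same second order equation. In the resulting equation for
  \<open>f\<close> the term of order zero cancels, and what is left are the Christoffel symbols \<open>(y, z)\<close> up to a term built
  from the one-form \<open>d\<sigma>/\<sigma>\<close>. Such a term does not change the unparametrized geodesics.\<close>

lemma quotient_chris: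
  assumes V: "open V" "q \<in> V" and sm: "smooth_on V \<sigma>" "smooth_on V f"
    and s': "\<forall>q\<in>V. s q = \<sigma> q *\<^sub>R f q" and n0: "\<sigma> q \<noteq> 0" and J: "jac f q \<noteq> 0"
    and e: "partial i (partial j s) q = x *\<^sub>R s q + y *\<^sub>R partial 1 s q + z *\<^sub>R partial 2 s q"
      "partial i (partial j \<sigma>) q = x * \<sigma> q + y * partial 1 \<sigma> q + z * partial 2 \<sigma> q"
  shows "chris f i j q = vec2 y z - (partial i \<sigma> q / \<sigma> q) *\<^sub>R axis j 1 - (partial j \<sigma> q / \<sigma> q) *\<^sub>R axis i 1"
proof -
  have s: "s q = \<sigma> q *\<^sub>R f q" if "q \<in> V" for q using s' that by blast
  have s1: "partial i s q = \<sigma> q *\<^sub>R partial i f q + partial i \<sigma> q *\<^sub>R f q" if "q \<in> V" for i q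
  proof -
    have "partial i s q = partial i (\<lambda>q. \<sigma> q *\<^sub>R f q) q" by (rule partial_cong[OF V(1) that s])
    also have "\<dots> = \<sigma> q *\<^sub>R partial i f q + partial i \<sigma> q *\<^sub>R f q"
      unfolding partial_dird
      by (rule dird_bilinear[OF bounded_bilinear_scaleR]) (use sm smooth_on_differentiable[OF _ that] in auto)
    finally show ?thesis .
  qed
  have "partial i (partial j s) q = partial i (\<lambda>q. \<sigma> q *\<^sub>R partial j f q + partial j \<sigma> q *\<^sub>R f q) q"
    by (rule partial_cong[OF V s1])
  also have "\<dots> = \<sigma> q *\<^sub>R partial i (partial j f) q + partial i \<sigma> q *\<^sub>R partial j f q
      + (partial j \<sigma> q *\<^sub>R partial i f q + partial i (partial j \<sigma>) q *\<^sub>R f q)"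
  proof -
    have d: "g differentiable (at q)" if "smooth_on V g" for g :: "base \<Rightarrow> 'z::real_normed_vector"
      by (rule smooth_on_differentiable[OF that V(2)])
    have "(\<lambda>q. \<sigma> q *\<^sub>R partial j f q) differentiable (at q)" "(\<lambda>q. partial j \<sigma> q *\<^sub>R f q) differentiable (at q)"
      by (intro smooth_on_differentiable[OF _ V(2)] smooth_on_scaleR smooth_on_partial sm)+
    then show ?thesis
      unfolding partial_dird[of i]
      using dird_bilinear[OF bounded_bilinear_scaleR smooth_on_differentiable[OF sm(1) V(2)] smooth_on_differentiable[OF smooth_on_partial[OF sm(2)] V(2)], of "axis i 1" j]
        dird_bilinear[OF bounded_bilinear_scaleR smooth_on_differentiable[OF smooth_on_partial[OF sm(1)] V(2)] smooth_on_differentiable[OF sm(2) V(2)], of "axis i 1" j]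
      by (simp add: dird_add)
  qed
  finally have "\<sigma> q *\<^sub>R partial i (partial j f) q = \<sigma> q *\<^sub>R (y *\<^sub>R partial 1 f q + z *\<^sub>R partial 2 f q)
      - partial i \<sigma> q *\<^sub>R partial j f q - partial j \<sigma> q *\<^sub>R partial i f q"
    unfolding e s[OF V(2)] s1[OF V(2)] by (simp add: algebra_simps)
  then have "partial i (partial j f) q = inverse (\<sigma> q) *\<^sub>R (\<sigma> q *\<^sub>R (y *\<^sub>R partial 1 f q + z *\<^sub>R partial 2 f q)
      - partial i \<sigma> q *\<^sub>R partial j f q - partial j \<sigma> q *\<^sub>R partial i f q)"
    using n0 by (metis (no_types) scaleR_scaleR left_inverse scaleR_one)
  also have "\<dots> = (vec2 y z - (partial i \<sigma> q / \<sigma> q) *\<^sub>R axis j 1 - (partial j \<sigma> q / \<sigma> q) *\<^sub>R axis i 1) $ 1 *\<^sub>R partial 1 f q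
      + (vec2 y z - (partial i \<sigma> q / \<sigma> q) *\<^sub>R axis j 1 - (partial j \<sigma> q / \<sigma> q) *\<^sub>R axis i 1) $ 2 *\<^sub>R partial 2 f q"
    using exhaust_2[of i] exhaust_2[of j] n0 by (auto simp: algebra_simps divide_inverse)
  finally have "chris f i j q = vec2 ((vec2 y z - (partial i \<sigma> q / \<sigma> q) *\<^sub>R axis j 1 - (partial j \<sigma> q / \<sigma> q) *\<^sub>R axis i 1) $ 1)
      ((vec2 y z - (partial i \<sigma> q / \<sigma> q) *\<^sub>R axis j 1 - (partial j \<sigma> q / \<sigma> q) *\<^sub>R axis i 1) $ 2)"
    by (rule chris_eqI[OF J])
  then show ?thesis by (simp add: vec2_eq_iff)
qed

lemma smooth_on_vec2:
  assumes "smooth_on D a" "smooth_on D b"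
  shows "smooth_on D (\<lambda>q. vec2 (a q) (b q))"
proof (rule smooth_on_vec)
  show "open D" using assms(1) smooth_on_open by blast
  show "smooth_on D (\<lambda>q. vec2 (a q) (b q) $ i)" for i using exhaust_2[of i] assms by auto
qed

text \<open>The quotients of three solutions of the density system are the components of the transformation.\<close>

lemma liouville_transformable:
  assumes us: "smooth_on D u" and p: "p \<in> D"
    and L: "\<And>q. q \<in> D \<Longrightarrow> liou1 u q = 0"
      "\<And>q. q \<in> D \<Longrightarrow> liou2 u q = 0"
  shows "\<exists>U f. p \<in> U \<and> U \<subseteq> D \<and> point_transformation U f \<and> (\<forall>q\<in>U. lift0 U f (q, u q) = zero_section (f q))"
proof -
  obtain r where r: "0 < r" "ball p r \<subseteq> D" and ex: "\<And>w0. \<exists>W. smooth_on (ball p r) W \<and> W p = w0 \<and> (\<forall>q\<in>ball p r. density_eqs u W q)"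
    by (rule density_system[OF us p L]) blast+
  \<comment> \<open>with these initial values \<open>\<sigma> 1\<close> is \<open>1\<close> at \<open>p\<close>, and the differential of \<open>f\<close> there is the identity\<close>
  obtain W where W: "\<And>k. smooth_on (ball p r) (W k)" "\<And>k. W k p = axis k 1" "\<And>k q. q \<in> ball p r \<Longrightarrow> density_eqs u (W k) q"
  proof -
    have "\<forall>k. \<exists>W. smooth_on (ball p r) W \<and> W p = axis k 1 \<and> (\<forall>q\<in>ball p r. density_eqs u W q)" using ex by blast
    then show ?thesis using that by metis
  qed
  define \<sigma> where "\<sigma> k q = W k q $ 1" for k q
  have \<sigma>s: "smooth_on (ball p r) (\<sigma> k)" for k unfolding \<sigma>_def[abs_def] by (rule smooth_on_nth[OF W(1)])
  have d1: "partial 1 (\<sigma> k) q = W k q $ 2" "partial 2 (\<sigma> k) q = W k q $ 3" if "q \<in> ball p r" for k q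
    using partial_nth[OF smooth_on_differentiable[OF W(1) that], of _ k 1] W(3)[OF that, of k]
    unfolding \<sigma>_def[abs_def] density_eqs_def by simp_all
  have d2: "partial i (partial 1 (\<sigma> k)) q = partial i (W k) q $ 2" "partial i (partial 2 (\<sigma> k)) q = partial i (W k) q $ 3" if "q \<in> ball p r" for i k q
    using partial_cong[OF open_ball that d1(1), where i = i] partial_cong[OF open_ball that d1(2), where i = i]
      partial_nth[OF smooth_on_differentiable[OF W(1) that], of i k 2] partial_nth[OF smooth_on_differentiable[OF W(1) that], of i k 3] by simp_all
  have eq: "partial 1 (partial 1 (\<sigma> k)) q = - ric11 u q * \<sigma> k q + u q $ 1 / 3 * partial 1 (\<sigma> k) q + (- u q $ 0) * partial 2 (\<sigma> k) q"
    "partial 2 (partial 1 (\<sigma> k)) q = - ric12 u q * \<sigma> k q + u q $ 2 / 3 * partial 1 (\<sigma> k) q + (- (u q $ 1 / 3)) * partial 2 (\<sigma> k) q"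
    "partial 2 (partial 2 (\<sigma> k)) q = - ric22 u q * \<sigma> k q + u q $ 3 * partial 1 (\<sigma> k) q + (- (u q $ 2 / 3)) * partial 2 (\<sigma> k) q"
    if "q \<in> ball p r" for k q
    using W(3)[OF that, of k] unfolding density_eqs_def d1[OF that] d2[OF that] by (simp_all add: \<sigma>_def)
  have eq12: "partial 1 (partial 2 (\<sigma> k)) q = partial 2 (partial 1 (\<sigma> k)) q" if "q \<in> ball p r" for k q
    unfolding partial_dird by (rule dird_commute[OF \<sigma>s that])
  define V where "V = ball p r \<inter> \<sigma> 1 -` (- {0})"
  have V: "open V" unfolding V_def
    by (rule continuous_open_preimage[OF smooth_on_continuous[OF \<sigma>s] open_ball]) auto
  have pV: "p \<in> V" using r(1) W(2) by (simp add: V_def \<sigma>_def)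
  have inb: "q \<in> ball p r" "\<sigma> 1 q \<noteq> 0" if "q \<in> V" for q using that by (auto simp: V_def)
  have \<sigma>V: "smooth_on V (\<sigma> k)" for k by (rule smooth_on_subset[OF \<sigma>s V]) (auto simp: V_def)
  define s where "s q = vec2 (\<sigma> 2 q) (\<sigma> 3 q)" for q
  define f where "f q = vec2 (\<sigma> 2 q / \<sigma> 1 q) (\<sigma> 3 q / \<sigma> 1 q)" for q
  have fs: "smooth_on V f" unfolding f_def[abs_def]
    by (intro smooth_on_vec2 smooth_on_divide \<sigma>V) (auto simp: inb)
  have ss: "smooth_on V s" unfolding s_def[abs_def] by (intro smooth_on_vec2 \<sigma>V)
  have sf: "s q = \<sigma> 1 q *\<^sub>R f q" if "q \<in> V" for q using inb(2)[OF that] by (simp add: s_def f_def vec2_eq_iff)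
  then have sfV: "\<forall>q\<in>V. s q = \<sigma> 1 q *\<^sub>R f q" by blast
  have ds: "partial i s q = vec2 (partial i (\<sigma> 2) q) (partial i (\<sigma> 3) q)" if "q \<in> V" for i q
  proof -
    have "partial i s q $ 1 = partial i (\<lambda>q. s q $ 1) q" "partial i s q $ 2 = partial i (\<lambda>q. s q $ 2) q"
      using partial_nth[OF smooth_on_differentiable[OF ss that], of i] by simp_all
    then show ?thesis by (simp add: vec2_eq_iff s_def)
  qed
  have dds: "partial j (partial i s) q = vec2 (partial j (partial i (\<sigma> 2)) q) (partial j (partial i (\<sigma> 3)) q)" if "q \<in> V" for i j q
  proof -
    have "partial j (partial i s) q $ n = partial j (\<lambda>q. partial i s q $ n) q" for n
      using partial_nth[OF smooth_on_differentiable[OF smooth_on_partial[OF ss] that], of j i n] by simp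
    moreover have "partial j (\<lambda>q. partial i s q $ 1) q = partial j (partial i (\<sigma> 2)) q" "partial j (\<lambda>q. partial i s q $ 2) q = partial j (partial i (\<sigma> 3)) q"
      by (rule partial_cong[OF V that]; simp add: ds)+
    ultimately show ?thesis by (simp add: vec2_eq_iff)
  qed
  have f1: "partial i f p = axis i 1" for i
  proof -
    have "partial i s p = partial i (\<lambda>q. \<sigma> 1 q *\<^sub>R f q) p" by (rule partial_cong[OF V pV sf])
    also have "\<dots> = \<sigma> 1 p *\<^sub>R partial i f p + partial i (\<sigma> 1) p *\<^sub>R f p"
      unfolding partial_dird
      by (rule dird_bilinear[OF bounded_bilinear_scaleR]) (use \<sigma>V fs smooth_on_differentiable[OF _ pV] in auto)
    finally show ?thesis
      using exhaust_2[of i] d1[OF inb(1)[OF pV]] by (auto simp: ds[OF pV] \<sigma>_def W(2) f_def vec2_eq_iff)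
  qed
  have "jac f p = 1" by (simp add: jac_def f1)
  then obtain U where U: "U \<subseteq> V" "p \<in> U" "open U" "point_transformation U f"
    using local_point_transformation[OF fs pV] by (metis zero_neq_one)
  have "lift0 U f (q, u q) = zero_section (f q)" if q: "q \<in> U" for q
  proof -
    have J: "jac f q \<noteq> 0" by (rule pt_jac[OF U(4) q])
    have qV: "q \<in> V" using q U(1) by auto
    note qb = inb[OF qV]
    note Q = quotient_chris[OF V qV \<sigma>V fs sfV qb(2) J]
    have e: "partial 1 (partial 1 s) q = - ric11 u q *\<^sub>R s q + (u q $ 1 / 3) *\<^sub>R partial 1 s q + (- u q $ 0) *\<^sub>R partial 2 s q"
      "partial 1 (partial 2 s) q = - ric12 u q *\<^sub>R s q + (u q $ 2 / 3) *\<^sub>R partial 1 s q + (- (u q $ 1 / 3)) *\<^sub>R partial 2 s q"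
      "partial 2 (partial 2 s) q = - ric22 u q *\<^sub>R s q + u q $ 3 *\<^sub>R partial 1 s q + (- (u q $ 2 / 3)) *\<^sub>R partial 2 s q"
      unfolding dds[OF qV] ds[OF qV] s_def[of q] eq12[OF qb(1)] eq[OF qb(1)] by (simp_all add: vec2_eq_iff)
    have c: "chris f 1 1 q = vec2 (u q $ 1 / 3) (- u q $ 0) - (partial 1 (\<sigma> 1) q / \<sigma> 1 q) *\<^sub>R axis 1 1 - (partial 1 (\<sigma> 1) q / \<sigma> 1 q) *\<^sub>R axis 1 1"
      "chris f 1 2 q = vec2 (u q $ 2 / 3) (- (u q $ 1 / 3)) - (partial 1 (\<sigma> 1) q / \<sigma> 1 q) *\<^sub>R axis 2 1 - (partial 2 (\<sigma> 1) q / \<sigma> 1 q) *\<^sub>R axis 1 1"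
      "chris f 2 2 q = vec2 (u q $ 3) (- (u q $ 2 / 3)) - (partial 2 (\<sigma> 1) q / \<sigma> 1 q) *\<^sub>R axis 2 1 - (partial 2 (\<sigma> 1) q / \<sigma> 1 q) *\<^sub>R axis 2 1"
      by (rule Q[OF e(1) eq(1)[OF qb(1)]] Q[OF e(2) eq(2)[OF qb(1), folded eq12[OF qb(1)]]] Q[OF e(3) eq(3)[OF qb(1)]])+
    show ?thesis
      unfolding lift0_zero_iff[OF U(4) q] c by (simp add: field_simps)
  qed
  moreover have "U \<subseteq> D" using U(1) r(2) by (auto simp: V_def)
  ultimately show ?thesis using U(2,4) by blast
qed

theorem theorem4p6:
  fixes S :: "real^2 \<Rightarrow> (real^2) \<times> (real^4)" and D :: "(real^2) set"
  assumes "local_section D S"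
  shows "(\<forall>p\<in>D. \<exists>U f. p \<in> U \<and> U \<subseteq> D \<and> point_transformation U f \<and>
            (\<forall>q\<in>f ` U. (lift0 U f \<circ> S \<circ> inv_into U f) q = zero_section q))
         \<longleftrightarrow> (\<forall>p\<in>D. \<forall>v w. omega2_pullback S p v w = 0)"
proof -
  have us: "smooth_on D (fib S)" by (rule section_smooth[OF assms])
  have S: "S q = (q, fib S q)" if "q \<in> D" for q using assms that by (simp add: local_section_def prod_eq_iff)
  have tr: "(\<forall>q\<in>f ` U. (lift0 U f \<circ> S \<circ> inv_into U f) q = zero_section q) \<longleftrightarrow> (\<forall>q\<in>U. lift0 U f (q, fib S q) = zero_section (f q))"
    if "U \<subseteq> D" "point_transformation U f" for U f
    using pt_inv[OF that(2)] S that(1) by (auto simp: subset_iff)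
  note om = omega_zero_iff[OF assms]
  show ?thesis
  proof
    assume t: "\<forall>p\<in>D. \<exists>U f. p \<in> U \<and> U \<subseteq> D \<and> point_transformation U f \<and>
            (\<forall>q\<in>f ` U. (lift0 U f \<circ> S \<circ> inv_into U f) q = zero_section q)"
    show "\<forall>p\<in>D. \<forall>v w. omega2_pullback S p v w = 0"
    proof
      fix p assume p: "p \<in> D"
      obtain U f where U: "p \<in> U" "U \<subseteq> D" "point_transformation U f" "\<forall>q\<in>f ` U. (lift0 U f \<circ> S \<circ> inv_into U f) q = zero_section q"
        using t p by blast
      have 0: "lift0 U f (q, fib S q) = zero_section (f q)" if "q \<in> U" for q using U(4) tr[OF U(2,3)] that by blast
      have "smooth_on U (fib S)" by (rule smooth_on_subset[OF us pt_smooth(3)[OF U(3)] U(2)])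
      from transformable_liouville[OF U(3) this U(1) 0] show "\<forall>v w. omega2_pullback S p v w = 0"
        unfolding om[OF p] by simp
    qed
  next
    assume "\<forall>p\<in>D. \<forall>v w. omega2_pullback S p v w = 0"
    then have L: "liou1 (fib S) q = 0"
      "liou2 (fib S) q = 0"
      if "q \<in> D" for q
      using om[OF that] that by simp_all
    show "\<forall>p\<in>D. \<exists>U f. p \<in> U \<and> U \<subseteq> D \<and> point_transformation U f \<and>
            (\<forall>q\<in>f ` U. (lift0 U f \<circ> S \<circ> inv_into U f) q = zero_section q)"
    proof
      fix p assume p: "p \<in> D"
      have "\<exists>U f. p \<in> U \<and> U \<subseteq> D \<and> point_transformation U f \<and> (\<forall>q\<in>U. lift0 U f (q, fib S q) = zero_section (f q))"
        by (rule liouville_transformable[OF us p]) (rule L; assumption)+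
      then obtain U f where U: "p \<in> U" "U \<subseteq> D" "point_transformation U f" "\<forall>q\<in>U. lift0 U f (q, fib S q) = zero_section (f q)"
        by blast
      then show "\<exists>U f. p \<in> U \<and> U \<subseteq> D \<and> point_transformation U f \<and>
            (\<forall>q\<in>f ` U. (lift0 U f \<circ> S \<circ> inv_into U f) q = zero_section q)"
        using tr[OF U(2,3)] by blast
    qed
  qed
qed

end
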